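(* Let $M,N\in\mathbb{N}$, $E\ge M+N$, $\rho>0$, and let $z_0\in\mathbb{C}\setminus\Lambda$ with $\mathrm{Re}(z_0)>0$. For a polynomial $Q(z)=\sum_{i=0}^N q_i(z-z_0)^i$ with complex coefficients set $$\bar j_{E,\rho}(Q)=\Big(\sum_{\alpha=M+1}^{E}\big\|(Q\mathcal{S})_{\alpha,z_0}\big\|_{V,\sqrt{\mathrm{Re}(z_0)}}^2\,\rho^{2\alpha}\Big)^{1/2}.$$ Then the constrained minimization problem: find $Q\in\mathbb{P}^{S}_N$ such that $\bar j_{E,\rho}(Q)\le \bar j_{E,\rho}(S)$ for all $S\in\mathbb{P}^{S}_N$, is equivalent to the identification of a normalized eigenvector corresponding to the smallest (non-negative) eigenvalue of the Hermitian positive-semidefinite matrix $\mathcal{G}\in\mathbb{C}^{(N+1)\times(N+1)}$ with entries $$(\mathcal{G})_{i,j}=\sum_{\alpha=M+1}^{E}\big\langle \mathcal{S}_{\alpha-j,z_0},\mathcal{S}_{\alpha-i,z_0}\big\rangle_{V,\sqrt{\mathrm{Re}(z_0)}}\,\rho^{2\alpha},\qquad i,j=0,\dots,N.$$ That is, $Q(z)=\sum_{i=0}^N q_i(z-z_0)^i$ solves the minimization problem if and only if $(q_0,\dots,q_N)^T$ is a eigenvector of $\mathcal{G}$ of unit Euclidean norm associated with its smallest eigenvalue. Here $\mathcal{S}_{\beta,z_0}=0$ for $\beta<0$, $\mathcal{S}_{0,z_0}=\mathcal{S}(z_0)$, and for $\beta\ge 1$ the Taylor coefficient $\mathcal{S}_{\beta,z_0}$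 is the unique element of $V$ satisfying $$\int_D\nabla \mathcal{S}_{\beta,z_0}\cdot\overline{\nabla v}\,d\mathbf{x}-z_0\int_D \mathcal{S}_{\beta,z_0}\,\overline{v}\,d\mathbf{x}=\int_D \mathcal{S}_{\beta-1,z_0}\,\overline{v}\,d\mathbf{x}\qquad\forall v\in V.$$
   Context: $D\subset\mathbb{R}^d$ ($d=1,2,3$) is an open connected bounded Lipschitz domain and $f\in L^2(D)$. All functions are complex-valued. $V=H^1_0(D)$ (homogeneous Dirichlet boundary conditions) or $V=H^1(D)$ (homogeneous Neumann boundary conditions); $\Lambda$ is the set of (real, non-negative) eigenvalues of the Laplace operator $-\Delta$ on $D$ with the corresponding boundary conditions. The frequency response map $\mathcal{S}$ associates to $z\in\mathbb{C}\setminus\Lambda$ the unique $u_z\in V$ with $$\int_D\nabla u_z\cdot\overline{\nabla v}\,d\mathbf{x}-z\int_D u_z\overline{v}\,d\mathbf{x}=\int_D f\overline{v}\,d\mathbf{x}\quad\forall v\in V;$$ it is known that $\mathcal{S}$ is well defined and holomorphic on $\mathbb{C}\setminus\Lambda$. For a $V$-valued map $\mathcal{T}$ holomorphic near $z_0$, $\mathcal{T}_{\alpha,z_0}=(\mathcal{T})_{\alpha,z_0}=\frac{1}{\alpha!}\frac{d^\alpha\mathcal{T}}{dz^\alpha}(z_0)$ denotes its Taylor coefficient of order $\alpha$ at $z_0$. The weighted norm is $\|v\|_{V,\sqrt{\mathrm{Re}(z_0)}}=\big(\|\nabla v\|_{L^2(D)}^2+\mathrm{Re}(z_0)\|v\|_{L^2(D)}^2\big)^{1/2}$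 and $\langle\cdot,\cdot\rangle_{V,\sqrt{\mathrm{Re}(z_0)}}$ is the scalar product inducing it, linear in the first and antilinear in the second argument. $\mathbb{P}^{S}_N$ is the set of polynomials $\sum_{i=0}^N q_i(z-z_0)^i$ with $q_i\in\mathbb{C}$ and $\sum_{i=0}^N|q_i|^2=1$. *)

theory Defs
  imports
    "HOL-Analysis.Analysis"
    "HOL-Computational_Algebra.Polynomial"
    "Jordan_Normal_Form.Schur_Decomposition"
begin

section \<open>Lipschitz domains\<close>

text \<open>Near each boundary point the domain is, in a rotated coordinate system with vertical
  direction \<open>e\<close>, the strict epigraph of a Lipschitz function of the horizontal coordinates,
  i.e. of the orthogonal projection \<open>x - inner x e *\<^sub>R e\<close> onto the hyperplane orthogonal to \<open>e\<close>.\<close>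

definition lipschitz_boundary :: "(real^'n) set \<Rightarrow> bool" where
  "lipschitz_boundary D \<longleftrightarrow>
    (\<forall>p \<in> frontier D. \<exists>U e \<gamma> L.
        open U \<and> p \<in> U \<and> norm e = 1 \<and> L-lipschitz_on {y. inner y e = 0} \<gamma> \<and>
        D \<inter> U = {x \<in> U. \<gamma> (x - inner x e *\<^sub>R e) < inner x e})"

definition bounded_lipschitz_domain :: "(real^'n) set \<Rightarrow> bool" where
  "bounded_lipschitz_domain D \<longleftrightarrow>
    D \<noteq> {} \<and> open D \<and> connected D \<and> bounded D \<and> lipschitz_boundary D"


section \<open>Sobolev spaces of complex-valued functions\<close>

text \<open>Elements of the function spaces are represented by functions on the whole of \<open>real^'n\<close>
  of which only the values on \<open>D\<close> matter; two functions represent the same element iff they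
  agree almost everywhere on \<open>D\<close>.\<close>

definition L2 :: "(real^'n) set \<Rightarrow> (real^'n \<Rightarrow> complex) set" where
  "L2 D = {u. u \<in> borel_measurable (lebesgue_on D) \<and>
              integrable (lebesgue_on D) (\<lambda>x. (cmod (u x))\<^sup>2)}"

definition partial_deriv :: "'n \<Rightarrow> (real^'n \<Rightarrow> complex) \<Rightarrow> real^'n \<Rightarrow> complex" where
  "partial_deriv i \<phi> x = frechet_derivative \<phi> (at x) (axis i 1)"

primrec C_diff :: "nat \<Rightarrow> (real^'n \<Rightarrow> complex) \<Rightarrow> bool" where
  "C_diff 0 \<phi> \<longleftrightarrow> continuous_on UNIV \<phi>"
| "C_diff (Suc k) \<phi> \<longleftrightarrow> \<phi> differentiable_on UNIV \<and> (\<forall>i. C_diff k (partial_deriv i \<phi>))"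

definition test_functions :: "(real^'n) set \<Rightarrow> (real^'n \<Rightarrow> complex) set" where
  "test_functions D = {\<phi>. (\<forall>k. C_diff k \<phi>) \<and>
      compact (closure {x. \<phi> x \<noteq> 0}) \<and> closure {x. \<phi> x \<noteq> 0} \<subseteq> D}"

definition is_weak_partial ::
    "(real^'n) set \<Rightarrow> 'n \<Rightarrow> (real^'n \<Rightarrow> complex) \<Rightarrow> (real^'n \<Rightarrow> complex) \<Rightarrow> bool" where
  "is_weak_partial D i u g \<longleftrightarrow>
    (\<forall>\<phi> \<in> test_functions D.
       (LINT x|lebesgue_on D. u x * partial_deriv i \<phi> x) = - (LINT x|lebesgue_on D. g x * \<phi> x))"

definition H1 :: "(real^'n) set \<Rightarrow> (real^'n \<Rightarrow> complex) set" where
  "H1 D = {u \<in> L2 D. \<forall>i. \<exists>g \<in> L2 D. is_weak_partial D i u g}"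

text \<open>The weak partial derivative is determined only almost everywhere; a representative is chosen.
  The quantities below do not depend on this choice.\<close>

definition weak_partial ::
    "(real^'n) set \<Rightarrow> 'n \<Rightarrow> (real^'n \<Rightarrow> complex) \<Rightarrow> real^'n \<Rightarrow> complex" where
  "weak_partial D i u = (SOME g. g \<in> L2 D \<and> is_weak_partial D i u g)"

definition L2_inner ::
    "(real^'n) set \<Rightarrow> (real^'n \<Rightarrow> complex) \<Rightarrow> (real^'n \<Rightarrow> complex) \<Rightarrow> complex" where
  "L2_inner D u v = (LINT x|lebesgue_on D. u x * cnj (v x))"

definition grad_inner ::
    "(real^'n) set \<Rightarrow> (real^'n \<Rightarrow> complex) \<Rightarrow> (real^'n \<Rightarrow> complex) \<Rightarrow> complex" where
  "grad_inner D u v =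
    (LINT x|lebesgue_on D. (\<Sum>i\<in>UNIV. weak_partial D i u x * cnj (weak_partial D i v x)))"

text \<open>\<open>c\<close> is the weight of the squared \<open>L2\<close> norm itself: the weighted norm with subscript
  \<open>sqrt (Re z0)\<close> is \<open>V_norm D (Re z0)\<close>, and \<open>V_norm D 1\<close> is the standard \<open>H1\<close> norm.\<close>

definition V_inner ::
    "(real^'n) set \<Rightarrow> real \<Rightarrow> (real^'n \<Rightarrow> complex) \<Rightarrow> (real^'n \<Rightarrow> complex) \<Rightarrow> complex" where
  "V_inner D c u v = grad_inner D u v + of_real c * L2_inner D u v"

definition V_norm :: "(real^'n) set \<Rightarrow> real \<Rightarrow> (real^'n \<Rightarrow> complex) \<Rightarrow> real" where
  "V_norm D c v =
    sqrt ((LINT x|lebesgue_on D. (\<Sum>i\<in>UNIV. (cmod (weak_partial D i v x))\<^sup>2))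
          + c * (LINT x|lebesgue_on D. (cmod (v x))\<^sup>2))"

definition H1_0 :: "(real^'n) set \<Rightarrow> (real^'n \<Rightarrow> complex) set" where
  "H1_0 D = {u \<in> H1 D. \<forall>\<epsilon>>0. \<exists>\<phi> \<in> test_functions D. V_norm D 1 (\<lambda>x. u x - \<phi> x) < \<epsilon>}"


section \<open>The Helmholtz problem\<close>

definition helmholtz_solution ::
    "(real^'n) set \<Rightarrow> (real^'n \<Rightarrow> complex) set \<Rightarrow> complex \<Rightarrow>
      (real^'n \<Rightarrow> complex) \<Rightarrow> (real^'n \<Rightarrow> complex) \<Rightarrow> bool" where
  "helmholtz_solution D V z f u \<longleftrightarrow>
    u \<in> V \<and> (\<forall>v\<in>V. grad_inner D u v - z * L2_inner D u v = L2_inner D f v)"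

text \<open>The boundary condition (Dirichlet or Neumann) is encoded in the choice of \<open>V\<close>.\<close>

definition laplace_eigenvalues ::
    "(real^'n) set \<Rightarrow> (real^'n \<Rightarrow> complex) set \<Rightarrow> complex set" where
  "laplace_eigenvalues D V = {l. \<exists>u\<in>V. \<not> (AE x in lebesgue_on D. u x = 0) \<and>
      (\<forall>v\<in>V. grad_inner D u v = l * L2_inner D u v)}"

definition frequency_response ::
    "(real^'n) set \<Rightarrow> (real^'n \<Rightarrow> complex) set \<Rightarrow> (real^'n \<Rightarrow> complex) \<Rightarrow>
      (complex \<Rightarrow> real^'n \<Rightarrow> complex) \<Rightarrow> bool" where
  "frequency_response D V f S \<longleftrightarrow>
    (\<forall>z \<in> - laplace_eigenvalues D V. helmholtz_solution D V z f (S z))"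


section \<open>Holomorphic maps with values in \<open>V\<close>\<close>

definition has_V_deriv ::
    "(real^'n) set \<Rightarrow> (real^'n \<Rightarrow> complex) set \<Rightarrow> (complex \<Rightarrow> real^'n \<Rightarrow> complex) \<Rightarrow>
      (real^'n \<Rightarrow> complex) \<Rightarrow> complex \<Rightarrow> bool" where
  "has_V_deriv D V T g z \<longleftrightarrow> g \<in> V \<and>
    ((\<lambda>w. V_norm D 1 (\<lambda>x. (T w x - T z x) / (w - z) - g x)) \<longlongrightarrow> 0) (at z)"

definition V_holomorphic_on ::
    "(real^'n) set \<Rightarrow> (real^'n \<Rightarrow> complex) set \<Rightarrow> (complex \<Rightarrow> real^'n \<Rightarrow> complex) \<Rightarrow>
      complex set \<Rightarrow> bool" where
  "V_holomorphic_on D V T A \<longleftrightarrow>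
    open A \<and> (\<forall>z\<in>A. T z \<in> V \<and> (\<exists>g. has_V_deriv D V T g z))"

definition V_deriv ::
    "(real^'n) set \<Rightarrow> (real^'n \<Rightarrow> complex) set \<Rightarrow> (complex \<Rightarrow> real^'n \<Rightarrow> complex) \<Rightarrow>
      complex \<Rightarrow> real^'n \<Rightarrow> complex" where
  "V_deriv D V T z = (SOME g. has_V_deriv D V T g z)"

definition taylor_coeff ::
    "(real^'n) set \<Rightarrow> (real^'n \<Rightarrow> complex) set \<Rightarrow> (complex \<Rightarrow> real^'n \<Rightarrow> complex) \<Rightarrow>
      int \<Rightarrow> complex \<Rightarrow> real^'n \<Rightarrow> complex" where
  "taylor_coeff D V T \<beta> z0 =
    (if \<beta> < 0 then (\<lambda>x. 0)
     else (\<lambda>x. ((V_deriv D V ^^ nat \<beta>) T) z0 x / fact (nat \<beta>)))"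


section \<open>The minimization problem and the matrix\<close>

definition centered_poly :: "complex \<Rightarrow> nat \<Rightarrow> (nat \<Rightarrow> complex) \<Rightarrow> complex poly" where
  "centered_poly z0 N q = (\<Sum>i\<le>N. Polynomial.smult (q i) ([:- z0, 1:] ^ i))"

definition sphere_polys :: "complex \<Rightarrow> nat \<Rightarrow> complex poly set" where
  "sphere_polys z0 N = {centered_poly z0 N q | q. (\<Sum>i\<le>N. (cmod (q i))\<^sup>2) = 1}"

definition jbar ::
    "(real^'n) set \<Rightarrow> (real^'n \<Rightarrow> complex) set \<Rightarrow> (complex \<Rightarrow> real^'n \<Rightarrow> complex) \<Rightarrow>
      complex \<Rightarrow> nat \<Rightarrow> nat \<Rightarrow> real \<Rightarrow> complex poly \<Rightarrow> real" where
  "jbar D V S z0 M E \<rho> Q =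
    sqrt (\<Sum>\<alpha>=M+1..E.
      (V_norm D (Re z0) (taylor_coeff D V (\<lambda>z x. poly Q z * S z x) (int \<alpha>) z0))\<^sup>2 * \<rho> ^ (2 * \<alpha>))"

definition solves_minimization ::
    "(real^'n) set \<Rightarrow> (real^'n \<Rightarrow> complex) set \<Rightarrow> (complex \<Rightarrow> real^'n \<Rightarrow> complex) \<Rightarrow>
      complex \<Rightarrow> nat \<Rightarrow> nat \<Rightarrow> nat \<Rightarrow> real \<Rightarrow> complex poly \<Rightarrow> bool" where
  "solves_minimization D V S z0 M N E \<rho> Q \<longleftrightarrow>
    Q \<in> sphere_polys z0 N \<and>
    (\<forall>P \<in> sphere_polys z0 N. jbar D V S z0 M E \<rho> Q \<le> jbar D V S z0 M E \<rho> P)"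

definition gram_matrix ::
    "(real^'n) set \<Rightarrow> (real^'n \<Rightarrow> complex) set \<Rightarrow> (complex \<Rightarrow> real^'n \<Rightarrow> complex) \<Rightarrow>
      complex \<Rightarrow> nat \<Rightarrow> nat \<Rightarrow> nat \<Rightarrow> real \<Rightarrow> complex mat" where
  "gram_matrix D V S z0 M N E \<rho> =
    Matrix.mat (N + 1) (N + 1) (\<lambda>(i, j). \<Sum>\<alpha>=M+1..E.
      V_inner D (Re z0) (taylor_coeff D V S (int \<alpha> - int j) z0)
                        (taylor_coeff D V S (int \<alpha> - int i) z0) * of_real (\<rho> ^ (2 * \<alpha>)))"

definition hermitian_mat :: "complex mat \<Rightarrow> bool" where
  "hermitian_mat A \<longleftrightarrow> square_mat A \<and> mat_adjoint A = A"

text \<open>The order on \<open>complex\<close> is that of \<open>HOL-Library.Complex_Order\<close>: \<open>x \<le> y\<close> means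
  \<open>Re x \<le> Re y\<close> and \<open>Im x = Im y\<close>, so that \<open>0 \<le> x\<close> says that \<open>x\<close> is real and
  non-negative.\<close>

definition positive_semidefinite :: "complex mat \<Rightarrow> bool" where
  "positive_semidefinite A \<longleftrightarrow> (\<forall>v \<in> carrier_vec (dim_row A). 0 \<le> (A *\<^sub>v v) \<bullet>c v)"

definition smallest_eigenvalue :: "complex mat \<Rightarrow> complex \<Rightarrow> bool" where
  "smallest_eigenvalue A \<mu> \<longleftrightarrow> eigenvalue A \<mu> \<and> (\<forall>\<nu>. eigenvalue A \<nu> \<longrightarrow> \<mu> \<le> \<nu>)"

end

theory Submission
  imports
    Defs
    "HOL-Complex_Analysis.Complex_Analysis"
    "HOL-Real_Asymp.Real_Asymp"
begin

text \<open>
  The Leibniz rule expresses the Taylor coefficient of order \<open>\<alpha>\<close> of \<open>Q S\<close> as the sum of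
  \<open>q i\<close> times the Taylor coefficient of order \<open>\<alpha> - i\<close> of \<open>S\<close> (\<open>taylor_coeff_poly_mult\<close>). It is
  linear in the coefficients of \<open>Q\<close>, so the square of the functional to be minimized is the Hermitian
  form of the Gram matrix, evaluated at the coefficient vector (\<open>gram_form_eq_jbar_square\<close>). This
  makes the matrix positive semidefinite, and it reduces the minimization problem to the
  Rayleigh principle: on the unit sphere, a Hermitian form is minimal exactly at the eigenvectors for
  the smallest eigenvalue (\<open>rayleigh\<close>). The Taylor coefficients of \<open>S\<close> obey the Helmholtz recursion
  because the variational equation for \<open>S z\<close> can be differentiated in \<open>z\<close>
  (\<open>helmholtz_taylor_coeff\<close>), and they are unique because \<open>z0\<close> is not an eigenvalue
  (\<open>helmholtz_solution_unique\<close>).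

  For this the Taylor coefficients have to exist, whereas \<open>S\<close> is only known to be complex
  differentiable once. In a complete space once is enough (\<open>vderiv_differentiable\<close>): tested against a
  vector \<open>v\<close>, the map becomes a scalar holomorphic function, and Cauchy's inequalities bound its
  higher derivatives uniformly over all \<open>v\<close> of norm one, so that the difference quotients of the
  derivative converge in norm. The same reduction to scalar functions, by bounded linear functionals,
  yields the Leibniz rule and the recursion.

  What remains is that \<open>V\<close> is a complete semi-inner product space (\<open>semi_hilbert_H1\<close>,
  \<open>semi_hilbert_H1_0\<close>). Completeness is inherited from \<open>L2\<close> (\<open>L2_complete\<close>). Sesquilinearity of the
  inner product needs uniqueness of weak derivatives, that is, the fundamental lemma of the calculus of
  variations, and its proof rests on smooth functions approximating the indicators of boxes. The
  inclusion of the test functions in \<open>H1\<close> is integration by parts, obtained from the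
  translation invariance of Lebesgue measure.
\<close>

section \<open>Positive semidefinite sesquilinear forms on function spaces\<close>

text \<open>The form may vanish on functions other than zero. Elements of Sobolev spaces are
  represented by functions, so their inner products are of this kind: two representatives of the
  same element differ by a function of seminorm zero. The same generality serves a Hermitian matrix
  that is only semidefinite, acting on coefficient sequences.\<close>

locale semi_inner =
  fixes V :: "('b \<Rightarrow> complex) set"
    and B :: "('b \<Rightarrow> complex) \<Rightarrow> ('b \<Rightarrow> complex) \<Rightarrow> complex"
  assumes zero_mem: "(\<lambda>x. 0) \<in> V"
    and add_mem: "\<And>u v. u \<in> V \<Longrightarrow> v \<in> V \<Longrightarrow> (\<lambda>x. u x + v x) \<in> V"
    and scale_mem: "\<And>c u. u \<in> V \<Longrightarrow> (\<lambda>x. c * u x) \<in> V"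
    and add_left: "\<And>u v w. u \<in> V \<Longrightarrow> v \<in> V \<Longrightarrow> w \<in> V \<Longrightarrow> B (\<lambda>x. u x + v x) w = B u w + B v w"
    and scale_left: "\<And>c u w. u \<in> V \<Longrightarrow> w \<in> V \<Longrightarrow> B (\<lambda>x. c * u x) w = c * B u w"
    and cnj_commute: "\<And>u v. u \<in> V \<Longrightarrow> v \<in> V \<Longrightarrow> B v u = cnj (B u v)"
    and nonneg: "\<And>u. u \<in> V \<Longrightarrow> 0 \<le> Re (B u u)"
begin

definition seminorm :: "('b \<Rightarrow> complex) \<Rightarrow> real" where
  "seminorm u = sqrt (Re (B u u))"

lemma diff_mem: "u \<in> V \<Longrightarrow> v \<in> V \<Longrightarrow> (\<lambda>x. u x - v x) \<in> V"
  using add_mem[of u "\<lambda>x. -1 * v x"] scale_mem[of v "-1"] by simp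

lemma diff_left:
  assumes "u \<in> V" "v \<in> V" "w \<in> V"
  shows "B (\<lambda>x. u x - v x) w = B u w - B v w"
  using add_left[of u "\<lambda>x. -1 * v x" w] scale_mem[of v "-1"] scale_left[of v w "-1"] assms by simp

lemma add_right:
  assumes "u \<in> V" "v \<in> V" "w \<in> V"
  shows "B w (\<lambda>x. u x + v x) = B w u + B w v"
  using assms add_left[of u v w] cnj_commute[of u w] cnj_commute[of v w]
    cnj_commute[of "\<lambda>x. u x + v x" w] add_mem[of u v] by simp

lemma scale_right:
  assumes "u \<in> V" "w \<in> V"
  shows "B w (\<lambda>x. c * u x) = cnj c * B w u"
  using assms scale_left[of u w c] cnj_commute[of u w]
    cnj_commute[of "\<lambda>x. c * u x" w] scale_mem[of u c] by simp

lemma zero_left: "w \<in> V \<Longrightarrow> B (\<lambda>x. 0) w = 0"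
  using scale_left[OF zero_mem, of w 0] by simp

lemma sum_mem: "(\<And>i. i \<in> I \<Longrightarrow> u i \<in> V) \<Longrightarrow> (\<lambda>x. \<Sum>i\<in>I. u i x) \<in> V"
  by (induction I rule: infinite_finite_induct) (auto intro: zero_mem add_mem)

lemma sum_left:
  assumes "\<And>i. i \<in> I \<Longrightarrow> u i \<in> V" "w \<in> V"
  shows "B (\<lambda>x. \<Sum>i\<in>I. u i x) w = (\<Sum>i\<in>I. B (u i) w)"
  using assms
  by (induction I rule: infinite_finite_induct) (auto simp: zero_left add_left sum_mem)

lemma sum_right:
  assumes "\<And>i. i \<in> I \<Longrightarrow> u i \<in> V" "w \<in> V"
  shows "B w (\<lambda>x. \<Sum>i\<in>I. u i x) = (\<Sum>i\<in>I. B w (u i))"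
  using assms cnj_commute[of "\<lambda>x. \<Sum>i\<in>I. u i x" w] cnj_commute[of _ w]
  by (simp add: sum_left sum_mem)

lemma form_self: "u \<in> V \<Longrightarrow> B u u = of_real ((seminorm u)\<^sup>2)"
  using cnj_commute[of u u] nonneg[of u]
  by (auto simp: seminorm_def complex_eq_iff)

lemma seminorm_nonneg: "u \<in> V \<Longrightarrow> 0 \<le> seminorm u"
  by (simp add: seminorm_def nonneg)

lemma seminorm_zero: "seminorm (\<lambda>x. 0) = 0"
  by (simp add: seminorm_def zero_left zero_mem)

lemma seminorm_scale: "u \<in> V \<Longrightarrow> seminorm (\<lambda>x. c * u x) = cmod c * seminorm u"
proof -
  assume u: "u \<in> V"
  have "B (\<lambda>x. c * u x) (\<lambda>x. c * u x) = of_real ((cmod c * seminorm u)\<^sup>2)"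
    using u by (simp add: scale_left scale_right scale_mem form_self power_mult_distrib
        complex_norm_square[symmetric] flip: mult.assoc)
  then show ?thesis
    using seminorm_nonneg[OF u] by (simp add: seminorm_def[of "\<lambda>x. c * u x"] del: of_real_power)
qed

lemma seminorm_minus_commute: "u \<in> V \<Longrightarrow> v \<in> V \<Longrightarrow> seminorm (\<lambda>x. u x - v x) = seminorm (\<lambda>x. v x - u x)"
  using seminorm_scale[OF diff_mem, of u v "-1"] by (simp add: algebra_simps)

lemma seminorm_add_square:
  assumes "u \<in> V" "v \<in> V"
  shows "(seminorm (\<lambda>x. u x + v x))\<^sup>2 = (seminorm u)\<^sup>2 + 2 * Re (B u v) + (seminorm v)\<^sup>2"
proof -
  have "B (\<lambda>x. u x + v x) (\<lambda>x. u x + v x) = B u u + B v v + (B u v + cnj (B u v))"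
    using assms cnj_commute[of u v] by (simp add: add_left add_right add_mem)
  from arg_cong[OF this, of Re] show ?thesis
    using assms by (simp add: form_self add_mem)
qed

theorem Cauchy_Schwarz:
  assumes u: "u \<in> V" and v: "v \<in> V"
  shows "cmod (B u v) \<le> seminorm u * seminorm v"
proof -
  \<comment> \<open>Along the real line \<open>t \<mapsto> u + t c v\<close> the squared seminorm is a quadratic polynomial in \<open>t\<close>
    that is nowhere negative; \<open>c\<close> as a factor makes its linear coefficient real.\<close>
  define c where "c = B u v"
  have pos: "0 \<le> (seminorm u)\<^sup>2 + 2 * t * (cmod c)\<^sup>2 + t\<^sup>2 * (cmod c)\<^sup>2 * (seminorm v)\<^sup>2" for t :: real
  proof -
    have "0 \<le> (seminorm (\<lambda>x. u x + (of_real t * c) * v x))\<^sup>2" by simp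
    also have "\<dots> = (seminorm u)\<^sup>2 + 2 * Re (cnj (of_real t * c) * c) + (cmod (of_real t * c) * seminorm v)\<^sup>2"
      using seminorm_add_square[OF u scale_mem[OF v, of "of_real t * c"]] u v
      by (simp only: scale_right seminorm_scale c_def)
    also have "cnj (of_real t * c) * c = of_real (t * (cmod c)\<^sup>2)"
      by (simp del: of_real_power add: complex_norm_square mult_ac)
    finally show ?thesis
      by (simp add: power_mult_distrib norm_mult del: of_real_mult of_real_power)
  qed
  have "(cmod c)\<^sup>2 \<le> (seminorm u)\<^sup>2 * (seminorm v)\<^sup>2"
  proof (cases "seminorm v = 0")
    case True
    show ?thesis
    proof (rule ccontr)
      assume "\<not> ?thesis"
      then have "(cmod c)\<^sup>2 > 0" using True by simp
      \<comment> \<open>The polynomial is now affine with positive slope, and this \<open>t\<close> makes it negative.\<close>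
      then show False
        using pos[of "- ((seminorm u)\<^sup>2 + 1) / (2 * (cmod c)\<^sup>2)"] True by (simp add: field_simps)
    qed
  next
    case False
    then have "(seminorm v)\<^sup>2 > 0" by simp
    then show ?thesis
      \<comment> \<open>The polynomial is evaluated at its minimum.\<close>
      using pos[of "- 1 / (seminorm v)\<^sup>2"]
      by (simp add: power2_eq_square[of "1 / (seminorm v)\<^sup>2"] field_simps)
  qed
  then show ?thesis
    using seminorm_nonneg[OF u] seminorm_nonneg[OF v]
    by (metis c_def mult_nonneg_nonneg power2_le_imp_le power_mult_distrib)
qed

lemma seminorm_triangle:
  assumes "u \<in> V" "v \<in> V"
  shows "seminorm (\<lambda>x. u x + v x) \<le> seminorm u + seminorm v"
proof (rule power2_le_imp_le)
  have "Re (B u v) \<le> seminorm u * seminorm v"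
    using Cauchy_Schwarz[OF assms] complex_Re_le_cmod order_trans by blast
  then show "(seminorm (\<lambda>x. u x + v x))\<^sup>2 \<le> (seminorm u + seminorm v)\<^sup>2"
    by (simp add: seminorm_add_square[OF assms] power2_sum)
qed (use assms seminorm_nonneg in simp)

lemma seminorm_triangle_diff:
  assumes "u \<in> V" "v \<in> V" "w \<in> V"
  shows "seminorm (\<lambda>x. u x - w x) \<le> seminorm (\<lambda>x. u x - v x) + seminorm (\<lambda>x. v x - w x)"
  using seminorm_triangle[OF diff_mem[of u v] diff_mem[of v w]] assms by simp

lemma seminorm_diff_le:
  assumes "u \<in> V" "v \<in> V"
  shows "\<bar>seminorm u - seminorm v\<bar> \<le> seminorm (\<lambda>x. u x - v x)"
  using seminorm_triangle[OF diff_mem[of u v], of v] seminorm_triangle[OF diff_mem[of v u], of u]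
    seminorm_minus_commute[of u v] assms by (simp add: abs_le_iff)

lemma subspace:
  assumes "W \<subseteq> V" "(\<lambda>x. 0) \<in> W" "\<And>u v. u \<in> W \<Longrightarrow> v \<in> W \<Longrightarrow> (\<lambda>x. u x + v x) \<in> W"
    "\<And>c u. u \<in> W \<Longrightarrow> (\<lambda>x. c * u x) \<in> W"
  shows "semi_inner W B"
proof
  show "\<And>u v w. u \<in> W \<Longrightarrow> v \<in> W \<Longrightarrow> w \<in> W \<Longrightarrow> B (\<lambda>x. u x + v x) w = B u w + B v w"
    using assms(1) add_left by blast
  show "\<And>c u w. u \<in> W \<Longrightarrow> w \<in> W \<Longrightarrow> B (\<lambda>x. c * u x) w = c * B u w"
    using assms(1) scale_left by blast
  show "\<And>u v. u \<in> W \<Longrightarrow> v \<in> W \<Longrightarrow> B v u = cnj (B u v)"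
    using assms(1) cnj_commute by blast
  show "\<And>u. u \<in> W \<Longrightarrow> 0 \<le> Re (B u u)"
    using assms(1) nonneg by blast
qed (use assms in auto)

end

section \<open>Holomorphic maps into a complete function space\<close>

context semi_inner
begin

definition has_vderiv :: "(complex \<Rightarrow> 'b \<Rightarrow> complex) \<Rightarrow> ('b \<Rightarrow> complex) \<Rightarrow> complex \<Rightarrow> bool" where
  "has_vderiv T g z \<longleftrightarrow> g \<in> V \<and>
    ((\<lambda>w. seminorm (\<lambda>x. (T w x - T z x) / (w - z) - g x)) \<longlongrightarrow> 0) (at z)"

lemma quotient_mem: "u \<in> V \<Longrightarrow> v \<in> V \<Longrightarrow> (\<lambda>x. (u x - v x) / c) \<in> V"
  using scale_mem[OF diff_mem, of u v "1 / c"] by simp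

text \<open>Bounded linear functionals commute with differentiation. Through them, claims on
  vector-valued maps become claims on holomorphic scalar functions.\<close>

lemma has_vderiv_functional:
  assumes A: "open A" "z \<in> A" "\<And>w. w \<in> A \<Longrightarrow> T w \<in> V"
    and g: "has_vderiv T g z"
    and diff: "\<And>u v. u \<in> V \<Longrightarrow> v \<in> V \<Longrightarrow> l (\<lambda>x. u x - v x) = l u - l v"
    and scale: "\<And>c u. u \<in> V \<Longrightarrow> l (\<lambda>x. c * u x) = c * l u"
    and bound: "\<And>u. u \<in> V \<Longrightarrow> cmod (l u) \<le> C * seminorm u"
  shows "((\<lambda>w. l (T w)) has_field_derivative l g) (at z)"
proof -
  have gV: "g \<in> V" and lim: "((\<lambda>w. seminorm (\<lambda>x. (T w x - T z x) / (w - z) - g x)) \<longlongrightarrow> 0) (at z)"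
    using g by (auto simp: has_vderiv_def)
  have zV: "T z \<in> V" using A by blast
  have "((\<lambda>w. (l (T w) - l (T z)) / (w - z) - l g) \<longlongrightarrow> 0) (at z)"
  proof (rule Lim_null_comparison)
    show "((\<lambda>w. C * seminorm (\<lambda>x. (T w x - T z x) / (w - z) - g x)) \<longlongrightarrow> 0) (at z)"
      using tendsto_mult_right_zero[OF lim] .
    have "eventually (\<lambda>w. w \<in> A \<and> w \<noteq> z) (at z)"
      using A eventually_at_in_open[of A z] by simp
    then show "eventually (\<lambda>w. norm ((l (T w) - l (T z)) / (w - z) - l g)
        \<le> C * seminorm (\<lambda>x. (T w x - T z x) / (w - z) - g x)) (at z)"
    proof eventually_elim
      case (elim w)
      then have w: "T w \<in> V" using A by blast
      have "l (\<lambda>x. (T w x - T z x) / (w - z) - g x) = (l (T w) - l (T z)) / (w - z) - l g"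
        using diff[OF quotient_mem[OF w zV] gV, of "w - z"]
          scale[OF diff_mem[OF w zV], of "1 / (w - z)"] diff[OF w zV] by simp
      then show ?case
        using bound[OF diff_mem[OF quotient_mem[OF w zV] gV], of "w - z"] by simp
    qed
  qed
  then show ?thesis
    by (simp add: has_field_derivative_iff LIM_zero_iff)
qed

lemma has_vderiv_form:
  assumes "open A" "z \<in> A" "\<And>w. w \<in> A \<Longrightarrow> T w \<in> V" "has_vderiv T g z" "v \<in> V"
  shows "((\<lambda>w. B (T w) v) has_field_derivative B g v) (at z)"
  by (rule has_vderiv_functional[OF assms(1-4), where C = "seminorm v"])
    (use assms(5) Cauchy_Schwarz in \<open>auto simp: diff_left scale_left mult.commute\<close>)

lemma has_vderiv_continuous:
  assumes A: "open A" "z \<in> A" "\<And>w. w \<in> A \<Longrightarrow> T w \<in> V"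
    and g: "has_vderiv T g z"
  shows "isCont (\<lambda>w. seminorm (T w)) z"
proof -
  have gV: "g \<in> V" and lim: "((\<lambda>w. seminorm (\<lambda>x. (T w x - T z x) / (w - z) - g x)) \<longlongrightarrow> 0) (at z)"
    using g by (auto simp: has_vderiv_def)
  have zV: "T z \<in> V" using A by blast
  have "((\<lambda>w. seminorm (T w) - seminorm (T z)) \<longlongrightarrow> 0) (at z)"
  proof (rule Lim_null_comparison)
    have "((\<lambda>w. cmod (w - z) * (seminorm (\<lambda>x. (T w x - T z x) / (w - z) - g x) + seminorm g))
        \<longlongrightarrow> cmod (z - z) * (0 + seminorm g)) (at z)"
      by (intro tendsto_intros lim)
    then show "((\<lambda>w. cmod (w - z) * (seminorm (\<lambda>x. (T w x - T z x) / (w - z) - g x) + seminorm g))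
        \<longlongrightarrow> 0) (at z)" by simp
    have "eventually (\<lambda>w. w \<in> A \<and> w \<noteq> z) (at z)"
      using A eventually_at_in_open[of A z] by simp
    then show "eventually (\<lambda>w. norm (seminorm (T w) - seminorm (T z))
        \<le> cmod (w - z) * (seminorm (\<lambda>x. (T w x - T z x) / (w - z) - g x) + seminorm g)) (at z)"
    proof eventually_elim
      case (elim w)
      then have w: "T w \<in> V" using A by blast
      have "\<bar>seminorm (T w) - seminorm (T z)\<bar> \<le> seminorm (\<lambda>x. T w x - T z x)"
        by (rule seminorm_diff_le[OF w zV])
      also have "\<dots> = cmod (w - z) * seminorm (\<lambda>x. (T w x - T z x) / (w - z))"
        using elim seminorm_scale[OF quotient_mem[OF w zV], of "w - z" "w - z"] by simp
      also have "\<dots> \<le> cmod (w - z) * (seminorm (\<lambda>x. (T w x - T z x) / (w - z) - g x) + seminorm g)"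
        using seminorm_triangle[OF diff_mem[OF quotient_mem[OF w zV] gV] gV, of "w - z"]
        by (intro mult_left_mono) auto
      finally show ?case by simp
    qed
  qed
  then show ?thesis
    by (simp add: isCont_def LIM_zero_iff)
qed

lemma has_vderiv_mult:
  assumes A: "open A" "z \<in> A" "\<And>w. w \<in> A \<Longrightarrow> T w \<in> V"
    and g: "has_vderiv T g z"
    and p: "(p has_field_derivative p') (at z)"
  shows "has_vderiv (\<lambda>w x. p w * T w x) (\<lambda>x. p' * T z x + p z * g x) z"
proof -
  have gV: "g \<in> V" and lim: "((\<lambda>w. seminorm (\<lambda>x. (T w x - T z x) / (w - z) - g x)) \<longlongrightarrow> 0) (at z)"
    using g by (auto simp: has_vderiv_def)
  have zV: "T z \<in> V" using A by blast
  define F where "F w = cmod (p w) * seminorm (\<lambda>x. (T w x - T z x) / (w - z) - g x)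
      + (cmod (p w - p z) * seminorm g + cmod ((p w - p z) / (w - z) - p') * seminorm (T z))" for w
  have pl: "((\<lambda>w. (p w - p z) / (w - z)) \<longlongrightarrow> p') (at z)"
    using p by (simp add: has_field_derivative_iff)
  have pc: "(p \<longlongrightarrow> p z) (at z)"
    using DERIV_isCont[OF p] by (simp add: isCont_def)
  have "(F \<longlongrightarrow> cmod (p z) * 0 + (cmod (p z - p z) * seminorm g + cmod (p' - p') * seminorm (T z))) (at z)"
    unfolding F_def by (intro tendsto_intros lim pl pc)
  then have F: "(F \<longlongrightarrow> 0) (at z)" by simp
  have "((\<lambda>w. seminorm (\<lambda>x. (p w * T w x - p z * T z x) / (w - z) - (p' * T z x + p z * g x))) \<longlongrightarrow> 0) (at z)"
  proof (rule Lim_null_comparison[OF _ F])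
    have "eventually (\<lambda>w. w \<in> A \<and> w \<noteq> z) (at z)"
      using A eventually_at_in_open[of A z] by simp
    then show "eventually (\<lambda>w. norm (seminorm (\<lambda>x. (p w * T w x - p z * T z x) / (w - z)
        - (p' * T z x + p z * g x))) \<le> F w) (at z)"
    proof eventually_elim
      case (elim w)
      then have w: "T w \<in> V" using A by blast
      define a where "a = (\<lambda>x. (T w x - T z x) / (w - z) - g x)"
      define c where "c = (p w - p z) / (w - z) - p'"
      have aV: "a \<in> V" unfolding a_def by (rule diff_mem[OF quotient_mem[OF w zV] gV])
      have m: "(\<lambda>x. (p w - p z) * g x + c * T z x) \<in> V"
        by (intro add_mem scale_mem gV zV)
      \<comment> \<open>The error of the difference quotient of the product, as a sum of three terms that tend
        to zero separately.\<close>
      have eq: "(\<lambda>x. (p w * T w x - p z * T z x) / (w - z) - (p' * T z x + p z * g x))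
         = (\<lambda>x. p w * a x + ((p w - p z) * g x + c * T z x))"
        by (simp add: a_def c_def divide_inverse algebra_simps)
      have "seminorm (\<lambda>x. p w * a x + ((p w - p z) * g x + c * T z x))
        \<le> seminorm (\<lambda>x. p w * a x) + seminorm (\<lambda>x. (p w - p z) * g x + c * T z x)"
        by (rule seminorm_triangle[OF scale_mem[OF aV] m])
      also have "\<dots> \<le> seminorm (\<lambda>x. p w * a x) + (seminorm (\<lambda>x. (p w - p z) * g x) + seminorm (\<lambda>x. c * T z x))"
        by (intro add_left_mono seminorm_triangle scale_mem gV zV)
      also have "\<dots> = F w"
        by (simp only: seminorm_scale aV gV zV F_def a_def[symmetric] c_def)
      finally show ?case
        unfolding eq using seminorm_nonneg[OF add_mem[OF scale_mem[OF aV] m], of "p w"] by simp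
    qed
  qed
  then show ?thesis
    unfolding has_vderiv_def using add_mem[OF scale_mem[OF zV] scale_mem[OF gV]] by blast
qed

end

locale semi_hilbert = semi_inner +
  assumes complete: "\<And>u :: nat \<Rightarrow> 'a \<Rightarrow> complex. (\<And>n. u n \<in> V) \<Longrightarrow>
      (\<And>e. e > 0 \<Longrightarrow> \<exists>K. \<forall>m\<ge>K. \<forall>n\<ge>K. seminorm (\<lambda>x. u m x - u n x) < e) \<Longrightarrow>
      \<exists>l\<in>V. (\<lambda>n. seminorm (\<lambda>x. u n x - l x)) \<longlonglongrightarrow> 0"
begin

text \<open>By the hypothesis the difference quotients at \<open>w\<close> form a Cauchy family as
  \<open>w \<longlongrightarrow> z\<close>, and completeness provides a limit along one sequence. Letting \<open>w'\<close> run along that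
  sequence in the hypothesis shows that all difference quotients tend to it, at the rate
  \<open>K \<bar>w - z\<bar>\<close>.\<close>

lemma has_vderiv_of_quotient_Lipschitz:
  assumes A: "open A" "z \<in> A" "\<And>w. w \<in> A \<Longrightarrow> T w \<in> V"
    and K: "\<And>w w'. w \<in> A - {z} \<Longrightarrow> w' \<in> A - {z} \<Longrightarrow>
      seminorm (\<lambda>x. (T w x - T z x) / (w - z) - (T w' x - T z x) / (w' - z))
        \<le> K * (cmod (w - z) + cmod (w' - z))"
  shows "\<exists>g. has_vderiv T g z"
proof -
  have zV: "T z \<in> V" using A by blast
  obtain r where r: "r > 0" "ball z r \<subseteq> A" using A openE by blast
  define h :: "nat \<Rightarrow> complex" where "h n = of_real (r / (2 * (real n + 1)))" for n
  have hr: "cmod (h n) = r / (2 * (real n + 1))" for n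
    using r by (simp add: h_def norm_divide flip: of_real_add)
  have hA: "z + h n \<in> A - {z}" for n
  proof -
    have "cmod (h n) < r" "cmod (h n) > 0"
      using r by (auto simp: hr field_simps add_pos_nonneg)
    then show ?thesis using r by (force simp: dist_norm)
  qed
  have h0: "(\<lambda>n. cmod (h n)) \<longlonglongrightarrow> 0"
    unfolding hr by real_asymp
  define d where "d w = (\<lambda>x. (T w x - T z x) / (w - z))" for w
  have dV: "d w \<in> V" if "w \<in> A" for w
    unfolding d_def using quotient_mem[OF A(3)[OF that] zV] .
  have dK: "seminorm (\<lambda>x. d w x - d w' x) \<le> K * (cmod (w - z) + cmod (w' - z))"
    if "w \<in> A - {z}" "w' \<in> A - {z}" for w w'
    using K[OF that] by (simp add: d_def)
  have "\<exists>g\<in>V. (\<lambda>n. seminorm (\<lambda>x. d (z + h n) x - g x)) \<longlonglongrightarrow> 0"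
  proof (rule complete)
    fix e :: real assume e: "e > 0"
    have "(\<lambda>n. \<bar>K\<bar> * cmod (h n)) \<longlonglongrightarrow> \<bar>K\<bar> * 0"
      by (intro tendsto_intros h0)
    then have "eventually (\<lambda>n. \<bar>K\<bar> * cmod (h n) < e / 2) sequentially"
      using order_tendstoD(2)[of _ "0::real" sequentially "e/2"] e by simp
    then obtain M where M: "\<And>n. n \<ge> M \<Longrightarrow> \<bar>K\<bar> * cmod (h n) < e / 2"
      by (auto simp: eventually_sequentially)
    have "seminorm (\<lambda>x. d (z + h m) x - d (z + h n) x) < e" if "m \<ge> M" "n \<ge> M" for m n
    proof -
      have "seminorm (\<lambda>x. d (z + h m) x - d (z + h n) x) \<le> K * (cmod (h m) + cmod (h n))"
        using dK[OF hA hA, of m n] by simp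
      also have "\<dots> \<le> \<bar>K\<bar> * (cmod (h m) + cmod (h n))"
        by (intro mult_right_mono) auto
      also have "\<dots> < e" using M[OF that(1)] M[OF that(2)] by (simp add: algebra_simps)
      finally show ?thesis .
    qed
    then show "\<exists>M. \<forall>m\<ge>M. \<forall>n\<ge>M. seminorm (\<lambda>x. d (z + h m) x - d (z + h n) x) < e" by blast
  qed (use dV hA in blast)
  then obtain g where gV: "g \<in> V" and g: "(\<lambda>n. seminorm (\<lambda>x. d (z + h n) x - g x)) \<longlonglongrightarrow> 0"
    by blast
  have bd: "seminorm (\<lambda>x. d w x - g x) \<le> K * cmod (w - z)" if w: "w \<in> A - {z}" for w
  proof (rule LIMSEQ_le_const)
    have "(\<lambda>n. K * (cmod (w - z) + cmod (h n)) + seminorm (\<lambda>x. d (z + h n) x - g x))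
      \<longlonglongrightarrow> K * (cmod (w - z) + 0) + 0"
      by (intro tendsto_intros h0 g)
    then show "(\<lambda>n. K * (cmod (w - z) + cmod (h n)) + seminorm (\<lambda>x. d (z + h n) x - g x))
      \<longlonglongrightarrow> K * cmod (w - z)" by simp
    have "seminorm (\<lambda>x. d w x - g x) \<le> K * (cmod (w - z) + cmod (h n))
        + seminorm (\<lambda>x. d (z + h n) x - g x)" for n
      using seminorm_triangle_diff[of "d w" "d (z + h n)" g] dV w hA[of n] gV dK[OF w hA, of n]
      by force
    then show "\<exists>N. \<forall>n\<ge>N. seminorm (\<lambda>x. d w x - g x) \<le> K * (cmod (w - z) + cmod (h n))
        + seminorm (\<lambda>x. d (z + h n) x - g x)" by blast
  qed
  have "((\<lambda>w. seminorm (\<lambda>x. d w x - g x)) \<longlongrightarrow> 0) (at z)"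
  proof (rule Lim_null_comparison)
    have "((\<lambda>w. K * cmod (w - z)) \<longlongrightarrow> K * cmod (z - z)) (at z)" by (intro tendsto_intros)
    then show "((\<lambda>w. K * cmod (w - z)) \<longlongrightarrow> 0) (at z)" by simp
    have "eventually (\<lambda>w. w \<in> A - {z}) (at z)"
      using A eventually_at_in_open[of A z] by simp
    then show "eventually (\<lambda>w. norm (seminorm (\<lambda>x. d w x - g x)) \<le> K * cmod (w - z)) (at z)"
    proof eventually_elim
      case (elim w)
      then show ?case using bd[OF elim] seminorm_nonneg[OF diff_mem[OF dV gV], of w] by simp
    qed
  qed
  then show ?thesis using gV by (auto simp: has_vderiv_def d_def)
qed

text \<open>A derivative of a map that is differentiable on an open set is again differentiable.
  For every \<open>v\<close> the function \<open>\<phi> = (\<lambda>w. B (T w) v)\<close> is holomorphic with \<open>\<phi>' = (\<lambda>w. B (T' w) v)\<close>, and it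
  is bounded near \<open>z\<close> by a constant times \<open>seminorm v\<close>, because \<open>T\<close> is continuous. Cauchy's
  inequalities then bound \<open>\<phi>'''\<close> in the same way, so by Taylor's formula the difference quotients of
  \<open>\<phi>'\<close> approach \<open>\<phi>'' z\<close> at a linear rate that is uniform in \<open>v\<close>. Uniformity lets \<open>v\<close> be the
  difference of two difference quotients of \<open>T'\<close> itself, which makes these a Cauchy family in the
  seminorm.\<close>

theorem vderiv_differentiable:
  assumes A: "open A" "z \<in> A" "\<And>w. w \<in> A \<Longrightarrow> T w \<in> V"
    and T': "\<And>w. w \<in> A \<Longrightarrow> has_vderiv T (T' w) w"
  shows "\<exists>g. has_vderiv T' g z"
proof -
  obtain R where R: "R > 0" "cball z R \<subseteq> A" using A open_contains_cball by blast
  define r where "r = R / 2"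
  have r: "r > 0" "2 * r = R" using R by (auto simp: r_def)
  have T'V: "T' w \<in> V" if "w \<in> A" for w using T'[OF that] by (simp add: has_vderiv_def)
  have "continuous_on (cball z R) (\<lambda>w. seminorm (T w))"
    using has_vderiv_continuous[OF A(1) _ A(3) T'] R
    by (intro continuous_at_imp_continuous_on) blast
  then have "bounded ((\<lambda>w. seminorm (T w)) ` cball z R)"
    by (intro compact_imp_bounded compact_continuous_image) auto
  then obtain C where C: "C > 0" "\<And>w. w \<in> cball z R \<Longrightarrow> seminorm (T w) \<le> C"
    unfolding bounded_pos by (metis abs_le_D1 image_eqI real_norm_def)
  \<comment> \<open>Cauchy's bound for the third derivative: discs of radius \<open>r\<close> about points of
    \<open>ball z r\<close> stay in \<open>cball z R\<close>, where \<open>C\<close> bounds \<open>T\<close>.\<close>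
  define K where "K = 6 * C / r ^ 3"
  have main: "cmod ((B (T' w) v - B (T' z) v) / (w - z) - (deriv ^^ 2) (\<lambda>w. B (T w) v) z)
      \<le> K * seminorm v * cmod (w - z)"
    if v: "v \<in> V" and w: "w \<in> ball z r - {z}" for v w
  proof -
    define \<phi> where "\<phi> = (\<lambda>w. B (T w) v)"
    have d: "(\<phi> has_field_derivative B (T' w) v) (at w)" if "w \<in> A" for w
      unfolding \<phi>_def by (rule has_vderiv_form[OF A(1) that A(3) T'[OF that] v])
    have hol: "\<phi> holomorphic_on A"
      using d by (auto simp: holomorphic_on_open A)
    have rA: "ball z r \<subseteq> A" using R r by auto
    have Dn: "((deriv ^^ n) \<phi> has_field_derivative (deriv ^^ Suc n) \<phi> y) (at y within ball z r)"
      if "y \<in> ball z r" for n y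
      using has_field_derivative_higher_deriv[OF hol A(1) subsetD[OF rA that], of n]
      by (rule has_field_derivative_at_within)
    have bound: "cmod ((deriv ^^ 3) \<phi> y) \<le> K * seminorm v" if y: "y \<in> ball z r" for y
    proof -
      have sub: "cball y r \<subseteq> cball z R"
      proof
        fix x assume "x \<in> cball y r"
        then show "x \<in> cball z R" using y r dist_triangle[of z x y] by auto
      qed
      have hol': "\<phi> holomorphic_on cball y r"
        using hol sub R by (meson holomorphic_on_subset order_trans)
      have "cmod ((deriv ^^ 3) \<phi> y) \<le> fact 3 * (C * seminorm v) / r ^ 3"
      proof (rule Cauchy_inequality)
        show "\<phi> holomorphic_on ball y r" using hol' holomorphic_on_subset by fastforce
        show "continuous_on (cball y r) \<phi>" using hol' holomorphic_on_imp_continuous_on by blast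
        fix x assume "cmod (y - x) = r"
        then have x: "x \<in> cball z R" using sub by (auto simp: dist_norm)
        then have "T x \<in> V" using R A by blast
        then have "cmod (\<phi> x) \<le> seminorm (T x) * seminorm v"
          unfolding \<phi>_def using Cauchy_Schwarz v by blast
        also have "\<dots> \<le> C * seminorm v" using C(2)[OF x] seminorm_nonneg[OF v] by (rule mult_right_mono)
        finally show "cmod (\<phi> x) \<le> C * seminorm v" .
      qed (use r in auto)
      also have "\<dots> = K * seminorm v" by (simp add: K_def fact_numeral)
      finally show ?thesis .
    qed
    have tay: "cmod ((deriv ^^ Suc 0) \<phi> w - (\<Sum>i\<le>1. (deriv ^^ Suc i) \<phi> z * (w - z) ^ i / fact i))
        \<le> K * seminorm v * cmod (w - z) ^ Suc 1 / fact 1"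
    proof (rule field_Taylor[where f = "\<lambda>i. (deriv ^^ Suc i) \<phi>" and S = "ball z r"])
      show "cmod ((deriv ^^ Suc (Suc 1)) \<phi> x) \<le> K * seminorm v" if "x \<in> ball z r" for x
        using bound[OF that] by (simp add: eval_nat_numeral)
      show "((deriv ^^ Suc i) \<phi> has_field_derivative (deriv ^^ Suc (Suc i)) \<phi> x) (at x within ball z r)"
        if "x \<in> ball z r" for i x using Dn[OF that, of "Suc i"] .
    qed (use w r in auto)
    have d1: "deriv \<phi> y = B (T' y) v" if "y \<in> A" for y
      using d[OF that] by (rule DERIV_imp_deriv)
    have wz: "w \<noteq> z" and wA: "w \<in> A" using w rA by auto
    define q where "q = (deriv ^^ 2) \<phi> z"
    have "cmod (B (T' w) v - B (T' z) v - q * (w - z)) \<le> K * seminorm v * cmod (w - z) ^ 2"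
      using tay d1[OF wA] d1[OF A(2)] by (simp add: q_def eval_nat_numeral diff_diff_eq)
    moreover have "B (T' w) v - B (T' z) v - q * (w - z) = ((B (T' w) v - B (T' z) v) / (w - z) - q) * (w - z)"
      using wz by (simp add: field_simps)
    ultimately have "cmod ((B (T' w) v - B (T' z) v) / (w - z) - q) * cmod (w - z)
        \<le> K * seminorm v * cmod (w - z) * cmod (w - z)"
      by (simp add: norm_mult power2_eq_square mult.assoc)
    then show ?thesis
      using wz by (simp add: q_def \<phi>_def mult.assoc)
  qed
  show ?thesis
  proof (rule has_vderiv_of_quotient_Lipschitz)
    show "open (ball z r)" "z \<in> ball z r" using r by auto
    have rA: "ball z r \<subseteq> A" using R r by auto
    then show "T' w \<in> V" if "w \<in> ball z r" for w using T'V that by blast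
    fix w w' assume w: "w \<in> ball z r - {z}" and w': "w' \<in> ball z r - {z}"
    define a where "a y = (\<lambda>x. (T' y x - T' z x) / (y - z))" for y
    have aV: "a y \<in> V" if "y \<in> ball z r" for y
      unfolding a_def using rA that A by (intro quotient_mem T'V) auto
    define v where "v = (\<lambda>x. a w x - a w' x)"
    have v: "v \<in> V" unfolding v_def using w w' by (intro diff_mem aV) auto
    define q where "q = (deriv ^^ 2) (\<lambda>w. B (T w) v) z"
    have Ba: "B (a y) v = (B (T' y) v - B (T' z) v) / (y - z)" if "y \<in> ball z r" for y
      using that rA A v scale_left[OF diff_mem[OF T'V T'V] v, of y z "1 / (y - z)"]
      by (auto simp: a_def diff_left T'V)
    have "(seminorm v)\<^sup>2 = cmod (B v v)"
      using form_self[OF v] by (simp add: norm_power)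
    also have "B v v = B (a w) v - B (a w') v"
      using w w' diff_left[OF aV aV v, of w w'] by (simp add: v_def)
    also have "\<dots> = (B (a w) v - q) - (B (a w') v - q)" by simp
    also have "cmod \<dots> \<le> cmod (B (a w) v - q) + cmod (B (a w') v - q)"
      by (rule norm_triangle_ineq4)
    also have "\<dots> \<le> K * seminorm v * cmod (w - z) + K * seminorm v * cmod (w' - z)"
      using main[OF v w] main[OF v w'] Ba w w' by (intro add_mono) (auto simp: q_def)
    finally have "seminorm v * seminorm v \<le> (K * (cmod (w - z) + cmod (w' - z))) * seminorm v"
      by (simp add: power2_eq_square algebra_simps)
    moreover have "K > 0" using C r by (simp add: K_def)
    ultimately have "seminorm v \<le> K * (cmod (w - z) + cmod (w' - z))"
      using seminorm_nonneg[OF v] by (cases "seminorm v = 0") (auto simp: mult_le_cancel_right)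
    then show "seminorm (\<lambda>x. (T' w x - T' z x) / (w - z) - (T' w' x - T' z x) / (w' - z))
        \<le> K * (cmod (w - z) + cmod (w' - z))"
      by (simp add: v_def a_def)
  qed
qed

end

section \<open>Square-integrable functions\<close>

lemma L2_measurable: "u \<in> L2 D \<Longrightarrow> u \<in> borel_measurable (lebesgue_on D)"
  by (simp add: L2_def)

lemma L2_square_integrable: "u \<in> L2 D \<Longrightarrow> integrable (lebesgue_on D) (\<lambda>x. (cmod (u x))\<^sup>2)"
  by (simp add: L2_def)

lemma integrable_L2_product:
  assumes "u \<in> L2 D" "v \<in> L2 D"
  shows "integrable (lebesgue_on D) (\<lambda>x. u x * v x)"
proof (rule Bochner_Integration.integrable_bound)
  show "integrable (lebesgue_on D) (\<lambda>x. (cmod (u x))\<^sup>2 + (cmod (v x))\<^sup>2)"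
    using assms by (simp add: L2_square_integrable)
  show "(\<lambda>x. u x * v x) \<in> borel_measurable (lebesgue_on D)"
    using assms L2_measurable by (intro borel_measurable_times)
  have "cmod (u x) * cmod (v x) \<le> (cmod (u x))\<^sup>2 + (cmod (v x))\<^sup>2" for x
    using sum_squares_bound[of "cmod (u x)" "cmod (v x)"] mult_nonneg_nonneg[of "cmod (u x)" "cmod (v x)"]
    by (simp del: mult_nonneg_nonneg)
  then show "AE x in lebesgue_on D. norm (u x * v x) \<le> norm ((cmod (u x))\<^sup>2 + (cmod (v x))\<^sup>2)"
    by (simp add: norm_mult)
qed

lemma L2_cnj: "u \<in> L2 D \<Longrightarrow> (\<lambda>x. cnj (u x)) \<in> L2 D"
  using measurable_compose[OF _ borel_measurable_continuous_onI[OF continuous_on_cnj[OF continuous_on_id]]]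
  by (auto simp: L2_def)

lemma integrable_L2_inner:
  assumes "u \<in> L2 D" "v \<in> L2 D"
  shows "integrable (lebesgue_on D) (\<lambda>x. u x * cnj (v x))"
  using integrable_L2_product[OF assms(1) L2_cnj[OF assms(2)]] .

lemma L2_add: "u \<in> L2 D \<Longrightarrow> v \<in> L2 D \<Longrightarrow> (\<lambda>x. u x + v x) \<in> L2 D"
proof -
  assume u: "u \<in> L2 D" and v: "v \<in> L2 D"
  have m: "(\<lambda>x. u x + v x) \<in> borel_measurable (lebesgue_on D)"
    using u v L2_measurable by (intro borel_measurable_add)
  have "integrable (lebesgue_on D) (\<lambda>x. (cmod (u x + v x))\<^sup>2)"
  proof (rule Bochner_Integration.integrable_bound)
    show "integrable (lebesgue_on D) (\<lambda>x. 2 * (cmod (u x))\<^sup>2 + 2 * (cmod (v x))\<^sup>2)"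
      using u v by (simp add: L2_square_integrable)
    show "(\<lambda>x. (cmod (u x + v x))\<^sup>2) \<in> borel_measurable (lebesgue_on D)"
      using m by measurable
    have "(cmod (u x + v x))\<^sup>2 \<le> 2 * (cmod (u x))\<^sup>2 + 2 * (cmod (v x))\<^sup>2" for x
    proof -
      have "(cmod (u x + v x))\<^sup>2 \<le> (cmod (u x) + cmod (v x))\<^sup>2"
        by (intro power_mono norm_triangle_ineq) simp
      then show ?thesis
        using sum_squares_bound[of "cmod (u x)" "cmod (v x)"] by (simp add: power2_sum)
    qed
    then show "AE x in lebesgue_on D. norm ((cmod (u x + v x))\<^sup>2) \<le> norm (2 * (cmod (u x))\<^sup>2 + 2 * (cmod (v x))\<^sup>2)"
      by simp
  qed
  then show ?thesis using m by (simp add: L2_def)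
qed

lemma L2_scale: "u \<in> L2 D \<Longrightarrow> (\<lambda>x. c * u x) \<in> L2 D"
  by (auto simp: L2_def norm_mult power_mult_distrib)

lemma L2_inner_cong_AE:
  assumes "AE x in lebesgue_on D. u x = u' x" "AE x in lebesgue_on D. v x = v' x"
    and "u \<in> L2 D" "u' \<in> L2 D" "v \<in> L2 D" "v' \<in> L2 D"
  shows "L2_inner D u v = L2_inner D u' v'"
  unfolding L2_inner_def
proof (rule integral_cong_AE)
  show "AE x in lebesgue_on D. u x * cnj (v x) = u' x * cnj (v' x)"
    using assms(1,2) by eventually_elim simp
qed (use assms integrable_L2_inner borel_measurable_integrable in blast)+

lemma L2_inner_self:
  "L2_inner D u u = of_real (LINT x|lebesgue_on D. (cmod (u x))\<^sup>2)"
  unfolding L2_inner_def complex_norm_square[symmetric] of_real_power[symmetric]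
  by (rule integral_complex_of_real)

global_interpretation L2: semi_inner "L2 D" "L2_inner D" for D :: "(real^'n) set"
proof
  fix u v w :: "real^'n \<Rightarrow> complex" and c :: complex
  show "(\<lambda>x. 0) \<in> L2 D" by (simp add: L2_def)
  show "u \<in> L2 D \<Longrightarrow> v \<in> L2 D \<Longrightarrow> (\<lambda>x. u x + v x) \<in> L2 D" by (rule L2_add)
  show "u \<in> L2 D \<Longrightarrow> (\<lambda>x. c * u x) \<in> L2 D" by (rule L2_scale)
  show "L2_inner D (\<lambda>x. u x + v x) w = L2_inner D u w + L2_inner D v w"
    if "u \<in> L2 D" "v \<in> L2 D" "w \<in> L2 D"
    using that by (simp add: L2_inner_def distrib_right integrable_L2_inner)
  show "L2_inner D (\<lambda>x. c * u x) w = c * L2_inner D u w" if "u \<in> L2 D" "w \<in> L2 D"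
    by (simp add: L2_inner_def mult.assoc)
  show "L2_inner D v u = cnj (L2_inner D u v)"
    using Bochner_Integration.integral_cnj[of "lebesgue_on D" "\<lambda>x. u x * cnj (v x)"]
    by (simp add: L2_inner_def mult.commute)
  show "0 \<le> Re (L2_inner D u u)"
    by (simp add: L2_inner_self)
qed

lemma L2_seminorm: "L2.seminorm D u = sqrt (LINT x|lebesgue_on D. (cmod (u x))\<^sup>2)"
  by (simp add: L2.seminorm_def L2_inner_self)

lemma nn_integral_L2:
  assumes "u \<in> L2 D"
  shows "(\<integral>\<^sup>+x. ennreal ((cmod (u x))\<^sup>2) \<partial>lebesgue_on D) = ennreal ((L2.seminorm D u)\<^sup>2)"
  using nn_integral_eq_integral[OF L2_square_integrable[OF assms]] by (simp add: L2_seminorm)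

text \<open>The pointwise limit of a sequence inherits a bound on the norms, by Fatou's lemma.\<close>

lemma L2_Fatou:
  assumes w: "\<And>k. w k \<in> L2 D" and g: "g \<in> borel_measurable (lebesgue_on D)"
    and lim: "AE x in lebesgue_on D. (\<lambda>k. w k x) \<longlonglongrightarrow> g x"
    and bd: "eventually (\<lambda>k. L2.seminorm D (w k) \<le> e) sequentially"
  shows "g \<in> L2 D" "L2.seminorm D g \<le> e"
proof -
  have e: "e \<ge> 0"
    using eventually_happens'[OF _ bd] L2.seminorm_nonneg[OF w] by (auto intro: order_trans)
  have "(\<integral>\<^sup>+x. ennreal ((cmod (g x))\<^sup>2) \<partial>lebesgue_on D)
      = (\<integral>\<^sup>+x. liminf (\<lambda>k. ennreal ((cmod (w k x))\<^sup>2)) \<partial>lebesgue_on D)"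
  proof (rule nn_integral_cong_AE, use lim in eventually_elim)
    case (elim x)
    then have "(\<lambda>k. ennreal ((cmod (w k x))\<^sup>2)) \<longlonglongrightarrow> ennreal ((cmod (g x))\<^sup>2)"
      by (intro tendsto_intros)
    then show ?case by (intro lim_imp_Liminf[symmetric]) auto
  qed
  also have "\<dots> \<le> liminf (\<lambda>k. \<integral>\<^sup>+x. ennreal ((cmod (w k x))\<^sup>2) \<partial>lebesgue_on D)"
    by (intro nn_integral_liminf) (use L2_measurable[OF w] in measurable)
  also have "\<dots> \<le> liminf (\<lambda>k. ennreal (e\<^sup>2))"
  proof (rule Liminf_mono, use bd in eventually_elim)
    case (elim k)
    then show ?case
      using L2.seminorm_nonneg[OF w[of k]] by (simp add: nn_integral_L2[OF w] power_mono ennreal_leI)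
  qed
  also have "\<dots> = ennreal (e\<^sup>2)" by (simp add: Liminf_const)
  finally have le: "(\<integral>\<^sup>+x. ennreal ((cmod (g x))\<^sup>2) \<partial>lebesgue_on D) \<le> ennreal (e\<^sup>2)" .
  have "integrable (lebesgue_on D) (\<lambda>x. (cmod (g x))\<^sup>2)"
    using le g by (intro integrableI_bounded) (auto intro: order.strict_trans1)
  with g show gL: "g \<in> L2 D" by (simp add: L2_def)
  show "L2.seminorm D g \<le> e"
    using le e by (simp add: nn_integral_L2[OF gL] ennreal_le_iff power2_le_iff_abs_le)
qed

text \<open>The Riesz--Fischer theorem. Let \<open>d k\<close> be the consecutive differences of a subsequence,
  chosen so that their norms are at most \<open>(1/8) ^ k\<close>. The function
  \<open>\<Sum>k. 4 ^ k * (cmod (d k x))\<^sup>2\<close> then has a finite integral, so it is finite almost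
  everywhere, and where it is finite \<open>d k x\<close> decays like \<open>(1/2) ^ k\<close>. Hence the subsequence
  converges almost everywhere, and Fatou's lemma turns the Cauchy condition into convergence in norm.\<close>

theorem L2_complete:
  fixes u :: "nat \<Rightarrow> real^'n \<Rightarrow> complex"
  assumes u: "\<And>n. u n \<in> L2 D"
    and cauchy: "\<And>e. e > 0 \<Longrightarrow> \<exists>K. \<forall>m\<ge>K. \<forall>n\<ge>K. L2.seminorm D (\<lambda>x. u m x - u n x) < e"
  shows "\<exists>l\<in>L2 D. (\<lambda>n. L2.seminorm D (\<lambda>x. u n x - l x)) \<longlonglongrightarrow> 0"
proof -
  have "\<exists>K. \<forall>m\<ge>K. \<forall>n\<ge>K. L2.seminorm D (\<lambda>x. u m x - u n x) < (1/8) ^ k" for k :: nat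
    by (rule cauchy) simp
  then obtain K where K: "\<And>k m n. m \<ge> K k \<Longrightarrow> n \<ge> K k \<Longrightarrow>
      L2.seminorm D (\<lambda>x. u m x - u n x) < (1/8) ^ k" by metis
  define r where "r k = (\<Sum>i\<le>k. K i) + k" for k
  have r: "r k \<ge> K k" "r (Suc k) \<ge> K k" "r k \<ge> k" for k
    by (auto simp: r_def intro!: member_le_sum trans_le_add1 le_SucI)
  define d where "d k = (\<lambda>x. u (r (Suc k)) x - u (r k) x)" for k
  have dL: "d k \<in> L2 D" for k unfolding d_def by (intro L2.diff_mem u)
  have dn: "L2.seminorm D (d k) \<le> (1/8) ^ k" for k
    unfolding d_def using K[OF r(2,1)] less_imp_le by blast
  have "(\<integral>\<^sup>+x. (\<Sum>k. ennreal (4 ^ k * (cmod (d k x))\<^sup>2)) \<partial>lebesgue_on D)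
      = (\<Sum>k. \<integral>\<^sup>+x. ennreal (4 ^ k * (cmod (d k x))\<^sup>2) \<partial>lebesgue_on D)"
    by (intro nn_integral_suminf) (use L2_measurable[OF dL] in measurable)
  also have "\<dots> \<le> (\<Sum>k. ennreal ((1/2) ^ k))"
  proof (intro suminf_le)
    fix k
    have "(\<integral>\<^sup>+x. ennreal (4 ^ k * (cmod (d k x))\<^sup>2) \<partial>lebesgue_on D)
        = ennreal (4 ^ k) * ennreal ((L2.seminorm D (d k))\<^sup>2)"
      using L2_measurable[OF dL] 
      by (simp add: ennreal_mult nn_integral_cmult nn_integral_L2[OF dL, symmetric] del: ennreal_power)
    also have "\<dots> = ennreal (4 ^ k * (L2.seminorm D (d k))\<^sup>2)"
      by (simp add: ennreal_mult del: ennreal_power)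
    also have "\<dots> \<le> ennreal ((1/2) ^ k)"
    proof (rule ennreal_leI)
      have "4 ^ k * (L2.seminorm D (d k))\<^sup>2 \<le> 4 ^ k * ((1/8) ^ k)\<^sup>2"
        using dn[of k] L2.seminorm_nonneg[OF dL] by (intro mult_left_mono power_mono) auto
      also have "\<dots> = (4 * (1/8)\<^sup>2) ^ k"
        by (simp only: power_mult_distrib power_mult[symmetric] mult.commute[of k 2])
      also have "\<dots> \<le> (1/2) ^ k" by (intro power_mono) (auto simp: power2_eq_square)
      finally show "4 ^ k * (L2.seminorm D (d k))\<^sup>2 \<le> (1/2) ^ k" .
    qed
    finally show "(\<integral>\<^sup>+x. ennreal (4 ^ k * (cmod (d k x))\<^sup>2) \<partial>lebesgue_on D) \<le> ennreal ((1/2) ^ k)" .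
  qed auto
  also have "\<dots> < \<infinity>"
    by (subst suminf_ennreal_eq[OF _ geometric_sums]) auto
  finally have fin: "(\<integral>\<^sup>+x. (\<Sum>k. ennreal (4 ^ k * (cmod (d k x))\<^sup>2)) \<partial>lebesgue_on D) \<noteq> \<infinity>" by simp
  have "AE x in lebesgue_on D. (\<Sum>k. ennreal (4 ^ k * (cmod (d k x))\<^sup>2)) \<noteq> \<infinity>"
    by (rule nn_integral_noteq_infinite[OF _ fin]) (use L2_measurable[OF dL] in measurable)
  then have conv: "AE x in lebesgue_on D. convergent (\<lambda>k. u (r k) x)"
  proof eventually_elim
    case (elim x)
    have "summable (\<lambda>k. 4 ^ k * (cmod (d k x))\<^sup>2)"
      using elim by (intro summable_suminf_not_top) auto
    then have "Bseq (\<lambda>k. 4 ^ k * (cmod (d k x))\<^sup>2)"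
      by (intro convergent_imp_Bseq) (auto simp: convergent_def dest: summable_LIMSEQ_zero)
    then obtain C where C: "C > 0" "\<And>k. \<bar>4 ^ k * (cmod (d k x))\<^sup>2\<bar> \<le> C"
      by (auto elim!: BseqE)
    have "cmod (d k x) \<le> sqrt C * (1/2) ^ k" for k
    proof -
      have "(2 ^ k * cmod (d k x))\<^sup>2 = 4 ^ k * (cmod (d k x))\<^sup>2"
      proof -
        have "((2::real) ^ k)\<^sup>2 = (2\<^sup>2) ^ k"
          by (simp only: power_mult[symmetric] mult.commute)
        then show ?thesis by (simp add: power_mult_distrib)
      qed
      then have "2 ^ k * cmod (d k x) \<le> sqrt C"
        using C(2)[of k] by (intro real_le_rsqrt) simp
      then show ?thesis by (simp add: field_simps)
    qed
    moreover have "summable (\<lambda>k. sqrt C * (1/2) ^ k)"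
      by (intro summable_mult summable_geometric) simp
    ultimately have "summable (\<lambda>k. d k x)"
      using summable_comparison_test'[of "\<lambda>k. sqrt C * (1/2) ^ k" 0 "\<lambda>k. d k x"] by blast
    then have "convergent (\<lambda>n. \<Sum>k<n. d k x)" by (simp add: summable_iff_convergent)
    moreover have "(\<Sum>k<n. d k x) = u (r n) x - u (r 0) x" for n
      unfolding d_def by (rule sum_lessThan_telescope)
    ultimately have "convergent (\<lambda>n. u (r n) x - u (r 0) x)" by simp
    then have "convergent (\<lambda>n. (u (r n) x - u (r 0) x) + u (r 0) x)"
      by (intro convergent_add convergent_const)
    then show ?case by simp
  qed
  define l where "l x = lim (\<lambda>k. u (r k) x)" for x
  have lm: "l \<in> borel_measurable (lebesgue_on D)"
    unfolding l_def using L2_measurable[OF u] by (intro borel_measurable_lim_metric) auto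
  have lim: "AE x in lebesgue_on D. (\<lambda>k. u (r k) x) \<longlonglongrightarrow> l x"
    using conv by eventually_elim (simp add: l_def convergent_LIMSEQ_iff)
  have close: "\<exists>N. \<forall>n\<ge>N. (\<lambda>x. l x - u n x) \<in> L2 D \<and> L2.seminorm D (\<lambda>x. l x - u n x) \<le> e"
    if e: "e > 0" for e
  proof -
    obtain N where N: "\<And>m n. m \<ge> N \<Longrightarrow> n \<ge> N \<Longrightarrow> L2.seminorm D (\<lambda>x. u m x - u n x) < e"
      using cauchy[OF e] by blast
    have "(\<lambda>x. l x - u n x) \<in> L2 D \<and> L2.seminorm D (\<lambda>x. l x - u n x) \<le> e" if n: "n \<ge> N" for n
    proof -
      have 1: "(\<lambda>x. l x - u n x) \<in> borel_measurable (lebesgue_on D)"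
        using lm L2_measurable[OF u] by (intro borel_measurable_diff)
      have 2: "AE x in lebesgue_on D. (\<lambda>k. u (r k) x - u n x) \<longlonglongrightarrow> l x - u n x"
        using lim by eventually_elim (intro tendsto_intros)
      have 3: "eventually (\<lambda>k. L2.seminorm D (\<lambda>x. u (r k) x - u n x) \<le> e) sequentially"
        using eventually_ge_at_top[of N]
      proof eventually_elim
        case (elim k)
        show ?case using N[OF order_trans[OF elim r(3)] n] by (rule less_imp_le)
      qed
      show ?thesis
        using L2_Fatou[OF L2.diff_mem[OF u u] 1 2 3] by blast
    qed
    then show ?thesis by blast
  qed
  obtain N where "(\<lambda>x. l x - u N x) \<in> L2 D" using close[of 1] by auto
  then have lL: "l \<in> L2 D" using L2_add[OF _ u[of N]] by force
  have "(\<lambda>n. L2.seminorm D (\<lambda>x. u n x - l x)) \<longlonglongrightarrow> 0"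
  proof (rule LIMSEQ_I)
    fix e :: real assume "e > 0"
    then obtain N where N: "\<And>n. n \<ge> N \<Longrightarrow> L2.seminorm D (\<lambda>x. l x - u n x) \<le> e / 2"
      using close[of "e/2"] by auto
    show "\<exists>N. \<forall>n\<ge>N. norm (L2.seminorm D (\<lambda>x. u n x - l x) - 0) < e"
    proof (intro exI allI impI)
      fix n assume "n \<ge> N"
      from N[OF this] show "norm (L2.seminorm D (\<lambda>x. u n x - l x) - 0) < e"
        using \<open>e > 0\<close> L2.seminorm_minus_commute[OF lL u, of n]
          L2.seminorm_nonneg[OF L2.diff_mem[OF u lL], of n] by simp
    qed
  qed
  with lL show ?thesis by blast
qed

section \<open>Calculus of test functions\<close>

lemma partial_deriv_eq:
  "(\<phi> has_derivative \<phi>') (at x) \<Longrightarrow> partial_deriv i \<phi> x = \<phi>' (axis i 1)"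
  by (simp add: partial_deriv_def frechet_derivative_at[symmetric])

lemma has_derivative_frechet:
  "\<phi> differentiable_on UNIV \<Longrightarrow> (\<phi> has_derivative frechet_derivative \<phi> (at x)) (at x)"
  by (simp add: differentiable_on_def frechet_derivative_works)

lemma partial_deriv_add:
  assumes "\<phi> differentiable_on UNIV" "\<psi> differentiable_on UNIV"
  shows "partial_deriv i (\<lambda>x. \<phi> x + \<psi> x) = (\<lambda>x. partial_deriv i \<phi> x + partial_deriv i \<psi> x)"
proof
  fix x
  show "partial_deriv i (\<lambda>x. \<phi> x + \<psi> x) x = partial_deriv i \<phi> x + partial_deriv i \<psi> x"
    using partial_deriv_eq[OF has_derivative_add[OF has_derivative_frechet[OF assms(1)] has_derivative_frechet[OF assms(2)]]]
    by (simp add: partial_deriv_def)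
qed

lemma partial_deriv_mult:
  assumes "\<phi> differentiable_on UNIV" "\<psi> differentiable_on UNIV"
  shows "partial_deriv i (\<lambda>x. \<phi> x * \<psi> x) = (\<lambda>x. \<phi> x * partial_deriv i \<psi> x + partial_deriv i \<phi> x * \<psi> x)"
proof
  fix x
  show "partial_deriv i (\<lambda>x. \<phi> x * \<psi> x) x = \<phi> x * partial_deriv i \<psi> x + partial_deriv i \<phi> x * \<psi> x"
    using partial_deriv_eq[OF has_derivative_mult[OF has_derivative_frechet[OF assms(1)] has_derivative_frechet[OF assms(2)]]]
    by (simp add: partial_deriv_def)
qed

lemma partial_deriv_const [simp]: "partial_deriv i (\<lambda>x. c) = (\<lambda>x. 0)"
  using partial_deriv_eq[OF has_derivative_const] by auto

lemma C_diff_const: "C_diff k (\<lambda>x. c)"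
  by (induction k arbitrary: c) (simp_all add: partial_deriv_const)

lemma C_diff_SucD: "C_diff (Suc k) \<phi> \<Longrightarrow> C_diff k \<phi>"
  by (induction k arbitrary: \<phi>) (auto simp: differentiable_imp_continuous_on)

lemma C_diff_continuous: "C_diff k \<phi> \<Longrightarrow> continuous_on UNIV \<phi>"
  by (cases k) (auto simp: differentiable_imp_continuous_on)

lemma C_diff_add: "C_diff k \<phi> \<Longrightarrow> C_diff k \<psi> \<Longrightarrow> C_diff k (\<lambda>x. \<phi> x + \<psi> x)"
  by (induction k arbitrary: \<phi> \<psi>)
    (simp_all add: continuous_on_add differentiable_on_add partial_deriv_add)

lemma C_diff_mult: "C_diff k \<phi> \<Longrightarrow> C_diff k \<psi> \<Longrightarrow> C_diff k (\<lambda>x. \<phi> x * \<psi> x)"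
proof (induction k arbitrary: \<phi> \<psi>)
  case 0
  then show ?case by (simp add: continuous_on_mult)
next
  case (Suc k)
  then have "C_diff k \<phi>" "C_diff k \<psi>" by (blast dest: C_diff_SucD)+
  with Suc show ?case
    by (simp add: differentiable_on_mult partial_deriv_mult C_diff_add)
qed

lemma C_diff_prod: "(\<And>i. i \<in> I \<Longrightarrow> C_diff k (\<phi> i)) \<Longrightarrow> C_diff k (\<lambda>x. \<Prod>i\<in>I. \<phi> i x)"
  by (induction I rule: infinite_finite_induct) (simp_all add: C_diff_const C_diff_mult)

lemma test_functionsI:
  assumes "\<And>k. C_diff k \<phi>" "compact K" "K \<subseteq> D" "\<And>x. x \<notin> K \<Longrightarrow> \<phi> x = 0"
  shows "\<phi> \<in> test_functions D"
proof -
  have "closure {x. \<phi> x \<noteq> 0} \<subseteq> K"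
    using assms by (intro closure_minimal compact_imp_closed) auto
  moreover from this have "compact (closure {x. \<phi> x \<noteq> 0})"
    using compact_Int_closed[OF \<open>compact K\<close> closed_closure, of "{x. \<phi> x \<noteq> 0}"] by (simp add: Int_absorb1)
  ultimately show ?thesis using assms by (auto simp: test_functions_def)
qed

lemma test_functions_C_diff: "\<phi> \<in> test_functions D \<Longrightarrow> C_diff k \<phi>"
  by (simp add: test_functions_def)

lemma test_functions_differentiable: "\<phi> \<in> test_functions D \<Longrightarrow> \<phi> differentiable_on UNIV"
  using test_functions_C_diff[of \<phi> D "Suc 0"] by simp

lemma test_functions_support:
  assumes "\<phi> \<in> test_functions D"
  shows "\<exists>K. compact K \<and> K \<subseteq> D \<and> (\<forall>x. x \<notin> K \<longrightarrow> \<phi> x = 0)"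
  using assms closure_subset[of "{x. \<phi> x \<noteq> 0}"]
  by (intro exI[of _ "closure {x. \<phi> x \<noteq> 0}"]) (auto simp: test_functions_def)

lemma test_functions_add:
  assumes "\<phi> \<in> test_functions D" "\<psi> \<in> test_functions D"
  shows "(\<lambda>x. \<phi> x + \<psi> x) \<in> test_functions D"
proof -
  obtain K where K: "compact K" "K \<subseteq> D" "\<And>x. x \<notin> K \<Longrightarrow> \<phi> x = 0"
    using test_functions_support[OF assms(1)] by blast
  obtain L where L: "compact L" "L \<subseteq> D" "\<And>x. x \<notin> L \<Longrightarrow> \<psi> x = 0"
    using test_functions_support[OF assms(2)] by blast
  show ?thesis
    by (rule test_functionsI[where K = "K \<union> L"])
      (use K L assms in \<open>auto intro: C_diff_add test_functions_C_diff\<close>)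
qed

lemma test_functions_mult:
  assumes "\<phi> \<in> test_functions D" "\<And>k. C_diff k \<psi>"
  shows "(\<lambda>x. \<psi> x * \<phi> x) \<in> test_functions D"
proof -
  obtain K where K: "compact K" "K \<subseteq> D" "\<And>x. x \<notin> K \<Longrightarrow> \<phi> x = 0"
    using test_functions_support[OF assms(1)] by blast
  show ?thesis
    by (rule test_functionsI[where K = "K"])
      (use K assms in \<open>auto intro: C_diff_mult test_functions_C_diff\<close>)
qed

lemma partial_deriv_eq_0:
  assumes "open U" "x \<in> U" "\<And>y. y \<in> U \<Longrightarrow> \<phi> y = 0"
  shows "partial_deriv i \<phi> x = 0"
proof -
  have "(\<phi> has_derivative (\<lambda>h. 0)) (at x)"
    by (rule has_derivative_transform_within_open[of "\<lambda>x. 0", OF _ assms(1,2)]) (use assms(3) in auto)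
  from partial_deriv_eq[OF this] show ?thesis by simp
qed

lemma partial_deriv_outside_support:
  assumes "compact K" "\<And>x. x \<notin> K \<Longrightarrow> \<phi> x = 0" "x \<notin> K"
  shows "partial_deriv i \<phi> x = 0"
  by (rule partial_deriv_eq_0[of "- K"]) (use assms compact_imp_closed in auto)

lemma test_functions_partial_deriv:
  assumes "\<phi> \<in> test_functions D"
  shows "partial_deriv i \<phi> \<in> test_functions D"
proof -
  obtain K where K: "compact K" "K \<subseteq> D" "\<And>x. x \<notin> K \<Longrightarrow> \<phi> x = 0"
    using test_functions_support[OF assms] by blast
  show ?thesis
  proof (rule test_functionsI[OF _ K(1,2)])
    show "C_diff k (partial_deriv i \<phi>)" for k
      using test_functions_C_diff[OF assms, of "Suc k"] by simp
  qed (rule partial_deriv_outside_support[OF K(1,3)])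
qed

lemma test_functions_bounded:
  assumes "\<phi> \<in> test_functions D"
  shows "\<exists>L\<ge>0. \<forall>x. cmod (\<phi> x) \<le> L"
proof -
  obtain K where K: "compact K" "K \<subseteq> D" "\<And>x. x \<notin> K \<Longrightarrow> \<phi> x = 0"
    using test_functions_support[OF assms] by blast
  have "continuous_on K \<phi>"
    using C_diff_continuous[OF test_functions_C_diff[OF assms, of 0]] continuous_on_subset by blast
  then have "bounded (\<phi> ` K)"
    using K(1) by (intro compact_imp_bounded compact_continuous_image)
  then obtain L where "L > 0" "\<forall>y\<in>\<phi> ` K. cmod y \<le> L" unfolding bounded_pos by blast
  then have "cmod (\<phi> x) \<le> L" for x using K(3)[of x] by (cases "x \<in> K") auto
  with \<open>L > 0\<close> show ?thesis by (intro exI[of _ L]) auto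
qed

lemma test_functions_L2:
  assumes "\<phi> \<in> test_functions D" "open D" "bounded D"
  shows "\<phi> \<in> L2 D"
proof -
  obtain L where L: "L \<ge> 0" "\<And>x. cmod (\<phi> x) \<le> L" using test_functions_bounded[OF assms(1)] by blast
  interpret finite_measure "lebesgue_on D"
    using assms by (intro finite_measure_lebesgue_on lmeasurable_open)
  have m: "\<phi> \<in> borel_measurable (lebesgue_on D)"
    using C_diff_continuous[OF test_functions_C_diff[OF assms(1), of 0]] assms(2)
    by (intro continuous_imp_measurable_on_sets_lebesgue) (auto intro: continuous_on_subset)
  have "integrable (lebesgue_on D) (\<lambda>x. (cmod (\<phi> x))\<^sup>2)"
  proof (rule integrable_const_bound[where B = "L\<^sup>2"])
    show "AE x in lebesgue_on D. norm ((cmod (\<phi> x))\<^sup>2) \<le> L\<^sup>2"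
      using L by (simp add: power_mono)
  qed (use m in measurable)
  with m show ?thesis by (simp add: L2_def)
qed

text \<open>Difference quotients of \<open>\<eta>\<close> in a fixed direction have integral zero, because Lebesgue
  measure is invariant under translations. They are bounded by the Lipschitz constant of \<open>\<eta>\<close> and
  supported in a common ball, so dominated convergence passes this on to the derivative.\<close>

lemma integral_partial_deriv_UNIV:
  fixes \<eta> :: "real^'n \<Rightarrow> complex"
  assumes \<eta>: "\<eta> \<in> test_functions UNIV"
  shows "(LINT x|lborel. partial_deriv i \<eta> x) = 0"
proof -
  obtain K where K: "compact K" "K \<subseteq> UNIV" "\<And>x. x \<notin> K \<Longrightarrow> \<eta> x = 0"
    using test_functions_support[OF \<eta>] by blast
  obtain R where R: "R > 0" "\<And>x. x \<in> K \<Longrightarrow> norm x \<le> R"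
    using compact_imp_bounded[OF K(1)] by (auto simp: bounded_pos)
  obtain L where L: "L \<ge> 0" "\<And>x. cmod (partial_deriv i \<eta> x) \<le> L"
    using test_functions_bounded[OF test_functions_partial_deriv[OF \<eta>], of i] by blast
  define e where "e = (axis i 1 :: real^'n)"
  have ne: "norm e = 1" by (simp add: e_def norm_axis_1)
  have cont: "continuous_on UNIV \<eta>" using C_diff_continuous[OF test_functions_C_diff[OF \<eta>, of 0]] .
  have meas: "\<eta> \<in> borel_measurable borel" using cont by (rule borel_measurable_continuous_onI)
  have vd: "((\<lambda>s. \<eta> (x + s *\<^sub>R e)) has_vector_derivative partial_deriv i \<eta> (x + s *\<^sub>R e)) (at s)" for x s
  proof -
    have "((\<lambda>s. \<eta> (x + s *\<^sub>R e)) has_derivative (\<lambda>h. frechet_derivative \<eta> (at (x + s *\<^sub>R e)) (h *\<^sub>R e))) (at s)"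
    proof (rule has_derivative_compose[of "\<lambda>s. x + s *\<^sub>R e" "\<lambda>h. h *\<^sub>R e"])
      show "((\<lambda>s. x + s *\<^sub>R e) has_derivative (\<lambda>h. h *\<^sub>R e)) (at s)"
        by (auto intro!: derivative_eq_intros)
    qed (rule has_derivative_frechet[OF test_functions_differentiable[OF \<eta>]])
    moreover have "frechet_derivative \<eta> (at (x + s *\<^sub>R e)) (h *\<^sub>R e) = h *\<^sub>R partial_deriv i \<eta> (x + s *\<^sub>R e)" for h
      using has_derivative_frechet[OF test_functions_differentiable[OF \<eta>], of "x + s *\<^sub>R e"]
      by (simp add: partial_deriv_def e_def has_derivative_bounded_linear linear_simps bounded_linear.linear)
    ultimately show ?thesis by (simp add: has_vector_derivative_def)
  qed
  have lip: "cmod (\<eta> (x + t *\<^sub>R e) - \<eta> x) \<le> L * t" if t: "t > 0" for x t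
  proof -
    have "norm (\<eta> (x + t *\<^sub>R e) - \<eta> (x + 0 *\<^sub>R e)) \<le> L * t - L * 0"
    proof (rule differentiable_bound_general[OF t, where \<phi>' = "\<lambda>_. L"
          and f' = "\<lambda>s. partial_deriv i \<eta> (x + s *\<^sub>R e)"])
      show "continuous_on {0..t} (\<lambda>s. \<eta> (x + s *\<^sub>R e))"
        by (intro continuous_on_compose2[OF cont] continuous_intros) auto
    qed (use vd L in \<open>auto intro!: continuous_intros derivative_eq_intros\<close>)
    then show ?thesis by simp
  qed
  define t where "t k = 1 / (real k + 1)" for k
  have t: "t k > 0" "t k \<le> 1" for k by (auto simp: t_def)
  have t0: "t \<longlonglongrightarrow> 0" unfolding t_def by real_asymp
  define q where "q k x = (\<eta> (x + t k *\<^sub>R e) - \<eta> x) /\<^sub>R t k" for k x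
  have int: "integrable lborel \<eta>"
  proof -
    have "integrable lborel (\<lambda>x. indicator K x *\<^sub>R \<eta> x)"
      by (rule borel_integrable_compact[OF K(1)]) (use cont continuous_on_subset in blast)
    moreover have "(\<lambda>x. indicator K x *\<^sub>R \<eta> x) = \<eta>" using K(3) by (auto simp: indicator_def)
    ultimately show ?thesis by simp
  qed
  have shift: "integrable lborel (\<lambda>x. \<eta> (x + c))" "(LINT x|lborel. \<eta> (x + c)) = (LINT x|lborel. \<eta> x)" for c
    using int integrable_distr_eq[of "(+) c" lborel borel \<eta>] integral_distr[of "(+) c" lborel borel \<eta>] meas
    by (simp_all add: lborel_distr_plus add.commute)
  have q0: "(LINT x|lborel. q k x) = 0" for k
    unfolding q_def using shift int by simp
  have "(\<lambda>k. LINT x|lborel. q k x) \<longlonglongrightarrow> (LINT x|lborel. partial_deriv i \<eta> x)"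
  proof (rule integral_dominated_convergence[where w = "\<lambda>x. indicator (cball 0 (R + 1)) x *\<^sub>R L"])
    \<comment> \<open>The support of \<open>\<eta>\<close> lies in the ball of radius \<open>R\<close>, and the steps \<open>t k\<close> are at most 1.\<close>
    show "integrable lborel (\<lambda>x. indicator (cball 0 (R + 1)) x *\<^sub>R L :: real)"
      by (rule borel_integrable_compact) auto
    show "partial_deriv i \<eta> \<in> borel_measurable lborel"
      using C_diff_continuous[OF test_functions_C_diff[OF test_functions_partial_deriv[OF \<eta>], of 0]]
      by (simp add: borel_measurable_continuous_onI)
    show "q k \<in> borel_measurable lborel" for k
      unfolding q_def using meas by measurable
    show "AE x in lborel. (\<lambda>k. q k x) \<longlonglongrightarrow> partial_deriv i \<eta> x"
    proof (rule AE_I2)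
      fix x
      have "((\<lambda>s. (\<eta> (x + s *\<^sub>R e) - \<eta> x) /\<^sub>R s) \<longlongrightarrow> partial_deriv i \<eta> x) (at 0)"
      proof (rule LIM_zero_cancel, rule tendsto_norm_zero_cancel)
        have "((\<lambda>s. cmod (\<eta> (x + s *\<^sub>R e) - \<eta> x - s *\<^sub>R partial_deriv i \<eta> x) / \<bar>s\<bar>) \<longlongrightarrow> 0) (at 0)"
          using vd[of x 0] by (simp add: has_vector_derivative_def has_derivative_iff_norm)
        then show "((\<lambda>s. cmod ((\<eta> (x + s *\<^sub>R e) - \<eta> x) /\<^sub>R s - partial_deriv i \<eta> x)) \<longlongrightarrow> 0) (at 0)"
        proof (rule Lim_transform_eventually)
          have "cmod (\<eta> (x + s *\<^sub>R e) - \<eta> x - s *\<^sub>R partial_deriv i \<eta> x) / \<bar>s\<bar>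
              = cmod ((\<eta> (x + s *\<^sub>R e) - \<eta> x) /\<^sub>R s - partial_deriv i \<eta> x)" if "s \<noteq> 0" for s
          proof -
            have "(\<eta> (x + s *\<^sub>R e) - \<eta> x) /\<^sub>R s - partial_deriv i \<eta> x
              = (\<eta> (x + s *\<^sub>R e) - \<eta> x - s *\<^sub>R partial_deriv i \<eta> x) /\<^sub>R s"
              using that by (simp add: scaleR_diff_right)
            then show ?thesis by (simp add: divide_inverse mult.commute)
          qed
          then show "eventually (\<lambda>s. cmod (\<eta> (x + s *\<^sub>R e) - \<eta> x - s *\<^sub>R partial_deriv i \<eta> x) / \<bar>s\<bar>
              = cmod ((\<eta> (x + s *\<^sub>R e) - \<eta> x) /\<^sub>R s - partial_deriv i \<eta> x)) (at 0)"
            by (simp add: eventually_at_filter)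
        qed
      qed
      then show "(\<lambda>k. q k x) \<longlonglongrightarrow> partial_deriv i \<eta> x"
        unfolding q_def
        by (rule filterlim_compose) (use t0 t in \<open>auto simp: filterlim_at less_imp_neq[symmetric]\<close>)
    qed
    show "AE x in lborel. norm (q k x) \<le> indicator (cball 0 (R + 1)) x *\<^sub>R L" for k
    proof (rule AE_I2)
      fix x
      show "norm (q k x) \<le> indicator (cball 0 (R + 1)) x *\<^sub>R L"
      proof (cases "x \<in> cball 0 (R + 1)")
        case True
        have "norm (q k x) = cmod (\<eta> (x + t k *\<^sub>R e) - \<eta> x) / t k"
          using t(1)[of k] by (simp add: q_def divide_inverse mult.commute)
        also have "\<dots> \<le> L" using lip[OF t(1), of x k] t(1)[of k] by (simp add: divide_le_eq)
        finally show ?thesis using True by simp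
      next
        case False
        then have x: "norm x > R + 1" by simp
        have "norm x \<le> norm (x + t k *\<^sub>R e) + norm (t k *\<^sub>R e)"
          using norm_triangle_ineq4[of "x + t k *\<^sub>R e" "t k *\<^sub>R e"] by simp
        then have "norm (x + t k *\<^sub>R e) > R" using x t[of k] ne by simp
        then have "x \<notin> K" "x + t k *\<^sub>R e \<notin> K" using R x by force+
        then show ?thesis using K(3) False by (simp add: q_def)
      qed
    qed
  qed
  then show ?thesis unfolding q0 using LIMSEQ_unique tendsto_const by blast
qed

lemma integral_partial_deriv:
  assumes \<eta>: "\<eta> \<in> test_functions D" and D: "open D"
  shows "(LINT x|lebesgue_on D. partial_deriv i \<eta> x) = 0"
proof -
  obtain K where K: "compact K" "K \<subseteq> D" "\<And>x. x \<notin> K \<Longrightarrow> \<eta> x = 0"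
    using test_functions_support[OF \<eta>] by blast
  have "(\<lambda>x. if x \<in> D then partial_deriv i \<eta> x else 0) = partial_deriv i \<eta>"
    using partial_deriv_outside_support[of K \<eta> _ i] K by (intro ext) (metis subsetD)
  moreover have "D \<in> sets lebesgue" using D by auto
  ultimately have "(LINT x|lebesgue_on D. partial_deriv i \<eta> x) = (LINT x|lebesgue. partial_deriv i \<eta> x)"
    by (simp flip: Lebesgue_Measure.integral_restrict_UNIV)
  also have "\<dots> = (LINT x|lborel. partial_deriv i \<eta> x)"
    using C_diff_continuous[OF test_functions_C_diff[OF test_functions_partial_deriv[OF \<eta>], of 0]]
    by (intro integral_completion) (simp add: borel_measurable_continuous_onI)
  also have "\<dots> = 0"
    by (rule integral_partial_deriv_UNIV, rule test_functionsI[OF test_functions_C_diff[OF \<eta>] K(1) _ K(3)]) auto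
  finally show ?thesis .
qed

text \<open>The classical partial derivatives of a test function are therefore its weak ones.\<close>

lemma integration_by_parts:
  assumes "\<phi> \<in> test_functions D" "\<psi> \<in> test_functions D" and D: "open D" "bounded D"
  shows "(LINT x|lebesgue_on D. \<phi> x * partial_deriv i \<psi> x)
    = - (LINT x|lebesgue_on D. partial_deriv i \<phi> x * \<psi> x)"
proof -
  have "(LINT x|lebesgue_on D. \<phi> x * partial_deriv i \<psi> x + partial_deriv i \<phi> x * \<psi> x) = 0"
    using integral_partial_deriv[OF test_functions_mult[OF assms(2) test_functions_C_diff[OF assms(1)]] D(1), of i]
      partial_deriv_mult[OF assms(1,2)[THEN test_functions_differentiable], of i] by simp
  moreover have "integrable (lebesgue_on D) (\<lambda>x. \<phi> x * partial_deriv i \<psi> x)"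
    "integrable (lebesgue_on D) (\<lambda>x. partial_deriv i \<phi> x * \<psi> x)"
    using assms by (auto intro!: integrable_L2_product test_functions_L2 test_functions_partial_deriv)
  ultimately show ?thesis by (simp add: eq_neg_iff_add_eq_0)
qed

section \<open>The fundamental lemma of the calculus of variations\<close>

text \<open>The functions \<open>p (1/t) exp (- 1/t)\<close>, extended by zero to \<open>t \<le> 0\<close>, are considered for all
  polynomials \<open>p\<close> at once because this class is closed under differentiation. Smoothness
  follows by induction on the order.\<close>

definition flat_exp :: "real poly \<Rightarrow> real \<Rightarrow> real" where
  "flat_exp p t = (if t > 0 then poly p (1 / t) * exp (- 1 / t) else 0)"

lemma poly_div_exp_tendsto_0: "((\<lambda>y. poly p y / exp y) \<longlongrightarrow> (0::real)) at_top"
proof -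
  have "((\<lambda>y. \<Sum>i\<le>degree p. coeff p i * (y ^ i / exp y)) \<longlongrightarrow> (\<Sum>i\<le>degree p. coeff p i * 0)) at_top"
    by (intro tendsto_intros tendsto_power_div_exp_0)
  then show ?thesis by (simp add: poly_altdef sum_divide_distrib)
qed

text \<open>At \<open>t = 0\<close> the difference quotient from the right is \<open>y p(y) / exp y\<close> with \<open>y = 1/t\<close>, which
  tends to zero; for \<open>t > 0\<close> the formula is the product and chain rule.\<close>

lemma flat_exp_deriv:
  "(flat_exp p has_real_derivative flat_exp ([:0, 0, 1:] * (p - pderiv p)) t) (at t)"
proof -
  consider "t > 0" | "t < 0" | "t = 0" by linarith
  then show ?thesis
  proof cases
    case 1
    have "((\<lambda>t. poly p (1 / t) * exp (- 1 / t)) has_real_derivative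
        flat_exp ([:0, 0, 1:] * (p - pderiv p)) t) (at t)"
      using 1 by (auto intro!: derivative_eq_intros DERIV_chain'[OF _ poly_DERIV]
          simp: flat_exp_def field_simps power2_eq_square)
    then show ?thesis
      by (rule has_field_derivative_transform_within_open[of _ _ _ "{0<..}"])
        (use 1 in \<open>auto simp: flat_exp_def\<close>)
  next
    case 2
    have "((\<lambda>t. 0) has_real_derivative flat_exp ([:0, 0, 1:] * (p - pderiv p)) t) (at t)"
      using 2 by (simp add: flat_exp_def)
    then show ?thesis
      by (rule has_field_derivative_transform_within_open[of _ _ _ "{..<0}"])
        (use 2 in \<open>auto simp: flat_exp_def\<close>)
  next
    case 3
    have right: "((\<lambda>h. flat_exp p h / h) \<longlongrightarrow> 0) (at_right 0)"
    proof (rule Lim_transform_eventually)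
      show "((\<lambda>h. poly (p * [:0, 1:]) (inverse h) / exp (inverse h)) \<longlongrightarrow> 0) (at_right (0::real))"
        by (rule filterlim_compose[OF poly_div_exp_tendsto_0 filterlim_inverse_at_top_right])
      show "\<forall>\<^sub>F h in at_right 0. poly (p * [:0, 1:]) (inverse h) / exp (inverse h) = flat_exp p h / h"
        using eventually_at_right_less[of "0::real"]
        by eventually_elim (simp add: flat_exp_def exp_minus field_simps)
    qed
    have left: "((\<lambda>h. flat_exp p h / h) \<longlongrightarrow> 0) (at_left 0)"
    proof (rule Lim_transform_eventually)
      show "((\<lambda>h. 0) \<longlongrightarrow> 0) (at_left (0::real))" by simp
      show "\<forall>\<^sub>F h in at_left 0. 0 = flat_exp p h / h"
        by (auto simp: flat_exp_def eventually_at_filter)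
    qed
    have "((\<lambda>h. flat_exp p h / h) \<longlongrightarrow> 0) (at 0)"
      using left right by (rule filterlim_split_at)
    then show ?thesis
      using 3 by (simp add: has_field_derivative_iff flat_exp_def)
  qed
qed

lemma C_diff_flat_exp:
  fixes i :: "'n::finite"
  shows "C_diff k (\<lambda>x :: real^'n. of_real (flat_exp p (c * (x $ i) + a)))"
proof (induction k arbitrary: p)
  case 0
  have "continuous_on UNIV (flat_exp p)"
    using flat_exp_deriv DERIV_isCont continuous_at_imp_continuous_on by blast
  then show ?case
    by (auto intro!: continuous_intros continuous_on_compose2[of UNIV "flat_exp p"])
next
  case (Suc k)
  let ?p' = "[:0, 0, 1:] * (p - pderiv p)"
  have d: "((\<lambda>x :: real^'n. complex_of_real (flat_exp p (c * (x $ i) + a))) has_derivative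
      (\<lambda>h. of_real (flat_exp ?p' (c * (x $ i) + a) * (c * (h $ i))))) (at x)" for x
  proof -
    have l: "((\<lambda>x :: real^'n. c * (x $ i) + a) has_derivative (\<lambda>h. c * (h $ i))) (at x)"
      by (auto intro!: derivative_eq_intros bounded_linear.has_derivative[OF bounded_linear_vec_nth])
    have "((\<lambda>x :: real^'n. flat_exp p (c * (x $ i) + a)) has_derivative
      (\<lambda>h. flat_exp ?p' (c * (x $ i) + a) * (c * (h $ i)))) (at x)"
      using has_derivative_compose[OF l flat_exp_deriv[unfolded has_field_derivative_def]] by simp
    then show ?thesis by (rule has_derivative_of_real)
  qed
  have "partial_deriv j (\<lambda>x :: real^'n. complex_of_real (flat_exp p (c * (x $ i) + a)))
      = (\<lambda>x. of_real (c * (axis j 1 $ i)) * of_real (flat_exp ?p' (c * (x $ i) + a)))" for j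
    using partial_deriv_eq[OF d] by (auto simp: mult_ac)
  moreover have "(\<lambda>x :: real^'n. complex_of_real (flat_exp p (c * (x $ i) + a))) differentiable_on UNIV"
    using d by (auto simp: differentiable_on_def differentiable_def)
  ultimately show ?case
    using C_diff_mult[OF C_diff_const Suc.IH] by (simp only: C_diff.simps) blast
qed

text \<open>A smooth function that is positive exactly on \<open>box a b\<close>. Inside the box each factor has the form
  \<open>exp (- 1 / ((k + 1) s))\<close>, where \<open>s\<close> is the distance to a face of the box, and tends to 1 as \<open>k\<close>
  grows. The arguments are written in the affine form that \<open>C_diff_flat_exp\<close> expects.\<close>

definition box_bump :: "real^'n \<Rightarrow> real^'n \<Rightarrow> nat \<Rightarrow> real^'n \<Rightarrow> complex" where
  "box_bump a b k x = (\<Prod>i\<in>UNIV.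
    of_real (flat_exp 1 (real (Suc k) * (x $ i) + - (real (Suc k) * (a $ i)))) *
    of_real (flat_exp 1 (- real (Suc k) * (x $ i) + real (Suc k) * (b $ i))))"

lemma box_bump_outside: "x \<notin> box a b \<Longrightarrow> box_bump a b k x = 0"
proof -
  assume "x \<notin> box a b"
  then obtain i where i: "\<not> (a $ i < x $ i \<and> x $ i < b $ i)" by (auto simp: mem_box_cart)
  then have "flat_exp 1 (real (Suc k) * (x $ i) + - (real (Suc k) * (a $ i))) = 0
    \<or> flat_exp 1 (- real (Suc k) * (x $ i) + real (Suc k) * (b $ i)) = 0"
    by (auto simp: flat_exp_def mult_le_cancel_left_pos simp del: of_nat_Suc)
  then show ?thesis unfolding box_bump_def by (intro prod_zero) auto
qed

lemma box_bump_le_1: "cmod (box_bump a b k x) \<le> 1"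
proof -
  have "\<bar>flat_exp 1 t\<bar> \<le> 1" for t by (simp add: flat_exp_def)
  then show ?thesis
    unfolding box_bump_def
    by (auto simp: prod_norm[symmetric] norm_mult intro!: prod_le_1 prod_nonneg mult_le_one)
qed

lemma box_bump_tendsto:
  fixes x :: "real^'n"
  shows "(\<lambda>k. box_bump a b k x) \<longlonglongrightarrow> indicator (box a b) x"
proof (cases "x \<in> box a b")
  case False
  then show ?thesis by (simp add: box_bump_outside)
next
  case True
  have lim: "(\<lambda>k. complex_of_real (flat_exp 1 (real (Suc k) * s))) \<longlonglongrightarrow> of_real 1" if "s > 0" for s
  proof (intro tendsto_of_real)
    have "(\<lambda>k. exp (- 1 / (real (Suc k) * s))) \<longlonglongrightarrow> 1" using that by real_asymp
    then show "(\<lambda>k. flat_exp 1 (real (Suc k) * s)) \<longlonglongrightarrow> 1"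
      using that by (simp add: flat_exp_def del: of_nat_Suc)
  qed
  have "(\<lambda>k. \<Prod>i\<in>UNIV. of_real (flat_exp 1 (real (Suc k) * (x $ i - a $ i))) *
     of_real (flat_exp 1 (real (Suc k) * (b $ i - x $ i)))) \<longlonglongrightarrow> (\<Prod>i\<in>(UNIV::'n set). of_real 1 * of_real 1 :: complex)"
    using True by (intro Limits.tendsto_prod tendsto_mult lim) (auto simp: mem_box_cart)
  then show ?thesis using True by (simp add: box_bump_def algebra_simps)
qed

lemma box_bump_test_function:
  assumes "cbox a b \<subseteq> D"
  shows "box_bump a b k \<in> test_functions D"
proof (rule test_functionsI[OF _ compact_cbox assms])
  show "C_diff n (box_bump a b k)" for n
    unfolding box_bump_def[abs_def]
    by (intro C_diff_prod C_diff_mult C_diff_flat_exp)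
  show "box_bump a b k x = 0" if "x \<notin> cbox a b" for x
    using that box_subset_cbox by (intro box_bump_outside) blast
qed

text \<open>The bump functions converge boundedly to the indicator of a box, so \<open>g\<close> has integral
  zero over every box whose closure lies in \<open>D\<close>. By Lebesgue's differentiation theorem \<open>g\<close> is almost
  everywhere the limit of its means over small cubes, all of which vanish.\<close>

theorem fundamental_lemma_calculus_of_variations:
  fixes g :: "real^'n \<Rightarrow> complex"
  assumes D: "open D" "bounded D" and g: "g \<in> L2 D"
    and orth: "\<And>\<phi>. \<phi> \<in> test_functions D \<Longrightarrow> (LINT x|lebesgue_on D. g x * \<phi> x) = 0"
  shows "AE x in lebesgue_on D. g x = 0"
proof -
  have Ds: "D \<in> sets lebesgue" using D by auto
  interpret finite_measure "lebesgue_on D"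
    using D by (intro finite_measure_lebesgue_on lmeasurable_open)
  have one: "(\<lambda>x. 1) \<in> L2 D" by (simp add: L2_def)
  have gi: "integrable (lebesgue_on D) g" using integrable_L2_product[OF g one] by simp
  define F where "F x = (if x \<in> D then g x else 0)" for x
  have Fi: "integrable lebesgue F"
    unfolding F_def using Lebesgue_Measure.integrable_restrict_UNIV[OF Ds] gi by blast
  have Fon: "integrable (lebesgue_on S) F" if "S \<in> sets lebesgue" for S
    using integrable_mult_indicator[OF that Fi] that by (simp add: integrable_restrict_space)
  have Fbox: "integral (cbox a b) F = 0" if ab: "cbox a b \<subseteq> D" for a b
  proof -
    have "(\<lambda>k. LINT x|lebesgue_on D. g x * box_bump a b k x)
        \<longlonglongrightarrow> (LINT x|lebesgue_on D. g x * indicator (box a b) x)"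
    proof (rule integral_dominated_convergence[where w = "\<lambda>x. cmod (g x)"])
      show "AE x in lebesgue_on D. (\<lambda>k. g x * box_bump a b k x) \<longlonglongrightarrow> g x * indicator (box a b) x"
        by (intro AE_I2 tendsto_intros box_bump_tendsto)
      show "AE x in lebesgue_on D. norm (g x * box_bump a b k x) \<le> cmod (g x)" for k
        by (intro AE_I2) (simp add: norm_mult mult_left_le box_bump_le_1)
      show "(\<lambda>x. g x * box_bump a b k x) \<in> borel_measurable (lebesgue_on D)" for k
        using box_bump_test_function[OF ab] test_functions_L2 D L2_measurable g
        by (intro borel_measurable_times) blast+
      have "(\<lambda>x. indicator (box a b) x :: complex) \<in> borel_measurable (lebesgue_on D)"
        by (intro measurable_restrict_space1 borel_measurable_indicator) simp
      then show "(\<lambda>x. g x * indicator (box a b) x) \<in> borel_measurable (lebesgue_on D)"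
        using L2_measurable[OF g] by (intro borel_measurable_times)
    qed (use gi in auto)
    moreover have "(LINT x|lebesgue_on D. g x * box_bump a b k x) = 0" for k
      by (rule orth[OF box_bump_test_function[OF ab]])
    ultimately have "(LINT x|lebesgue_on D. g x * indicator (box a b) x) = 0"
      by (simp add: LIMSEQ_const_iff)
    moreover have "(\<lambda>x. if x \<in> D then g x * indicator (box a b) x else 0)
        = (\<lambda>x. if x \<in> box a b then F x else 0)"
    proof
      fix x
      show "(if x \<in> D then g x * indicator (box a b) x else 0) = (if x \<in> box a b then F x else 0)"
        using subsetD[OF order_trans[OF box_subset_cbox ab], of x] by (simp add: F_def)
    qed
    ultimately have "(LINT x|lebesgue_on (box a b). F x) = 0"
      using Lebesgue_Measure.integral_restrict_UNIV[OF Ds, of "\<lambda>x. g x * indicator (box a b) x"]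
        Lebesgue_Measure.integral_restrict_UNIV[of "box a b" F] by simp
    moreover have "integrable (lebesgue_on (box a b)) F"
      by (rule Fon) simp
    ultimately have "integral (box a b) F = 0"
      using has_integral_integral_lebesgue_on[of "box a b" F] by (simp add: integral_unique)
    then show ?thesis by (simp add: integral_open_interval)
  qed
  have "F integrable_on cbox a b" for a b
  proof -
    have "integrable (lebesgue_on (cbox a b)) F"
      by (rule Fon) simp
    then show ?thesis
      by (rule has_integral_integrable[OF has_integral_integral_lebesgue_on]) simp
  qed
  then obtain N where N: "negligible N" and lim: "\<And>x e. x \<notin> N \<Longrightarrow> 0 < e \<Longrightarrow>
      \<exists>d>0. \<forall>h. 0 < h \<and> h < d \<longrightarrow>
        norm (integral (cbox x (x + h *\<^sub>R One)) F /\<^sub>R h ^ DIM(real^'n) - F x) < e"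
    using integrable_ccontinuous_explicit[of F] by blast
  have "F x = 0" if xN: "x \<notin> N" and xD: "x \<in> D" for x
  proof (rule ccontr)
    assume "F x \<noteq> 0"
    then obtain d where d: "d > 0" "\<And>h. 0 < h \<Longrightarrow> h < d \<Longrightarrow>
        norm (integral (cbox x (x + h *\<^sub>R One)) F /\<^sub>R h ^ DIM(real^'n) - F x) < norm (F x)"
      using lim[OF xN, of "norm (F x)"] by auto
    obtain a b where ab: "cbox a b \<subseteq> D" "x \<in> box a b"
      by (rule open_contains_cbox[OF D(1) xD]) (rule that; assumption)
    have "((\<lambda>h. x + h *\<^sub>R One) \<longlongrightarrow> x + 0 *\<^sub>R One) (at_right (0::real))"
      by (intro tendsto_intros)
    then have "((\<lambda>h. x + h *\<^sub>R One) \<longlongrightarrow> x) (at_right (0::real))" by simp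
    then have "\<forall>\<^sub>F h in at_right 0. x + h *\<^sub>R One \<in> box a b"
      by (rule topological_tendstoD) (use ab in auto)
    moreover have "\<forall>\<^sub>F h in at_right 0. h \<in> {0<..<d}" using d(1) by (rule eventually_at_right_real)
    ultimately have "\<forall>\<^sub>F h in at_right 0. x + h *\<^sub>R One \<in> box a b \<and> h < d \<and> 0 < h"
      by eventually_elim auto
    then obtain h where h: "x + h *\<^sub>R One \<in> box a b" "h < d" "0 < h"
      using eventually_happens'[OF trivial_limit_at_right_real] by blast
    have "cbox x (x + h *\<^sub>R One) \<subseteq> cbox a b"
      using h(1) ab(2) box_subset_cbox subset_box(1)[of x "x + h *\<^sub>R One" a b]
      by (simp add: mem_box less_imp_le)
    then have "integral (cbox x (x + h *\<^sub>R One)) F = 0"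
      using ab(1) by (intro Fbox) auto
    then show False using d(2)[OF h(3,2)] by simp
  qed
  moreover have "AE x in lebesgue_on D. x \<notin> N"
    using AE_not_in[of N lebesgue] N by (auto simp: AE_restrict_space_iff Ds negligible_iff_null_sets)
  ultimately have "AE x in lebesgue_on D. x \<in> D \<longrightarrow> F x = 0" by (auto elim: eventually_mono)
  moreover have "AE x in lebesgue_on D. x \<in> D" by (rule AE_I2) simp
  ultimately show ?thesis by eventually_elim (auto simp: F_def)
qed

section \<open>The Sobolev spaces as complete semi-inner product spaces\<close>

lemma L2_inner_tendsto:
  assumes "\<And>n. u n \<in> L2 D" "l \<in> L2 D" "v \<in> L2 D"
    and lim: "(\<lambda>n. L2.seminorm D (\<lambda>x. u n x - l x)) \<longlonglongrightarrow> 0"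
  shows "(\<lambda>n. L2_inner D (u n) v) \<longlonglongrightarrow> L2_inner D l v"
proof -
  have "(\<lambda>n. L2_inner D (u n) v - L2_inner D l v) \<longlonglongrightarrow> 0"
  proof (rule Lim_null_comparison)
    show "(\<lambda>n. L2.seminorm D (\<lambda>x. u n x - l x) * L2.seminorm D v) \<longlonglongrightarrow> 0"
      using tendsto_mult_left_zero[OF lim] .
    show "eventually (\<lambda>n. norm (L2_inner D (u n) v - L2_inner D l v)
        \<le> L2.seminorm D (\<lambda>x. u n x - l x) * L2.seminorm D v) sequentially"
      using L2.Cauchy_Schwarz[OF L2.diff_mem[OF assms(1,2)] assms(3)]
      by (simp add: L2.diff_left assms)
  qed
  then show ?thesis by (simp add: LIM_zero_iff)
qed

lemma L2_seminorm_cong_AE: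
  assumes "AE x in lebesgue_on D. u x = v x" "u \<in> L2 D" "v \<in> L2 D"
  shows "L2.seminorm D u = L2.seminorm D v"
  using L2_inner_cong_AE[OF assms(1,1)] assms by (simp add: L2.seminorm_def)

locale sobolev_domain =
  fixes D :: "(real^'n) set"
  assumes open_D: "open D" and bounded_D: "bounded D"
begin

lemma test_L2: "\<phi> \<in> test_functions D \<Longrightarrow> \<phi> \<in> L2 D"
  using test_functions_L2 open_D bounded_D by blast

lemma test_partial_L2: "\<phi> \<in> test_functions D \<Longrightarrow> partial_deriv i \<phi> \<in> L2 D"
  by (intro test_L2 test_functions_partial_deriv)

text \<open>With the test function conjugated, both sides are inner products in \<open>L2\<close>, linear in the
  first argument and continuous.\<close>

lemma is_weak_partial_iff:
  "is_weak_partial D i u g \<longleftrightarrow> (\<forall>\<phi>\<in>test_functions D.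
    L2_inner D u (\<lambda>x. cnj (partial_deriv i \<phi> x)) = - L2_inner D g (\<lambda>x. cnj (\<phi> x)))"
  by (simp add: is_weak_partial_def L2_inner_def)

lemma is_weak_partial_add:
  assumes "is_weak_partial D i u g" "is_weak_partial D i v h"
    and "u \<in> L2 D" "v \<in> L2 D" "g \<in> L2 D" "h \<in> L2 D"
  shows "is_weak_partial D i (\<lambda>x. u x + v x) (\<lambda>x. g x + h x)"
  using assms by (simp add: is_weak_partial_iff L2.add_left L2_cnj test_L2 test_partial_L2)

lemma is_weak_partial_scale:
  assumes "is_weak_partial D i u g" "u \<in> L2 D" "g \<in> L2 D"
  shows "is_weak_partial D i (\<lambda>x. c * u x) (\<lambda>x. c * g x)"
  using assms by (simp add: is_weak_partial_iff L2.scale_left L2_cnj test_L2 test_partial_L2)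

text \<open>The operator \<open>weak_partial\<close> chooses a representative for each function separately, and
  nothing in the choice makes it linear. Uniqueness up to null sets restores linearity almost
  everywhere, which is all that integrals see.\<close>

lemma weak_partial_unique:
  assumes "is_weak_partial D i u g" "is_weak_partial D i u h" "g \<in> L2 D" "h \<in> L2 D"
  shows "AE x in lebesgue_on D. g x = h x"
proof -
  have "AE x in lebesgue_on D. g x - h x = 0"
  proof (rule fundamental_lemma_calculus_of_variations[OF open_D bounded_D L2.diff_mem])
    fix \<phi> assume \<phi>: "\<phi> \<in> test_functions D"
    have "(LINT x|lebesgue_on D. (g x - h x) * \<phi> x) = L2_inner D (\<lambda>x. g x - h x) (\<lambda>x. cnj (\<phi> x))"
      by (simp add: L2_inner_def)
    also have "\<dots> = 0"
      using assms \<phi> by (simp add: L2.diff_left L2_cnj test_L2 is_weak_partial_iff)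
    finally show "(LINT x|lebesgue_on D. (g x - h x) * \<phi> x) = 0" .
  qed (use assms in auto)
  then show ?thesis by eventually_elim simp
qed

lemma H1_L2: "u \<in> H1 D \<Longrightarrow> u \<in> L2 D" by (simp add: H1_def)

lemma weak_partial:
  assumes "u \<in> H1 D"
  shows weak_partial_L2: "weak_partial D i u \<in> L2 D"
    and is_weak_partial_weak_partial: "is_weak_partial D i u (weak_partial D i u)"
proof -
  have "\<exists>g. g \<in> L2 D \<and> is_weak_partial D i u g" using assms by (auto simp: H1_def)
  from someI_ex[OF this] show "weak_partial D i u \<in> L2 D" "is_weak_partial D i u (weak_partial D i u)"
    by (auto simp: weak_partial_def)
qed

lemma weak_partial_AE_eq:
  assumes "u \<in> H1 D" "is_weak_partial D i u g" "g \<in> L2 D"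
  shows "AE x in lebesgue_on D. weak_partial D i u x = g x"
  using weak_partial_unique[OF is_weak_partial_weak_partial[OF assms(1)] assms(2) weak_partial_L2[OF assms(1)] assms(3)] .

lemma H1_add: "u \<in> H1 D \<Longrightarrow> v \<in> H1 D \<Longrightarrow> (\<lambda>x. u x + v x) \<in> H1 D"
  unfolding H1_def using is_weak_partial_add by (blast intro: L2_add)

lemma H1_scale: "u \<in> H1 D \<Longrightarrow> (\<lambda>x. c * u x) \<in> H1 D"
  unfolding H1_def using is_weak_partial_scale by (blast intro: L2_scale)

lemma test_H1: "\<phi> \<in> test_functions D \<Longrightarrow> \<phi> \<in> H1 D"
  unfolding H1_def is_weak_partial_def
  using integration_by_parts open_D bounded_D test_L2 test_partial_L2 by blast

lemma zero_test: "(\<lambda>x. 0) \<in> test_functions D"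
  by (rule test_functionsI[where K = "{}"]) (auto intro: C_diff_const)

lemma zero_H1: "(\<lambda>x. 0) \<in> H1 D"
  using test_H1[OF zero_test] .

lemma weak_partial_add:
  assumes "u \<in> H1 D" "v \<in> H1 D"
  shows "AE x in lebesgue_on D. weak_partial D i (\<lambda>x. u x + v x) x = weak_partial D i u x + weak_partial D i v x"
  using assms by (intro weak_partial_AE_eq H1_add is_weak_partial_add L2_add
      is_weak_partial_weak_partial weak_partial_L2 H1_L2)

lemma weak_partial_scale:
  assumes "u \<in> H1 D"
  shows "AE x in lebesgue_on D. weak_partial D i (\<lambda>x. c * u x) x = c * weak_partial D i u x"
  using assms by (intro weak_partial_AE_eq H1_scale is_weak_partial_scale L2_scale
      is_weak_partial_weak_partial weak_partial_L2 H1_L2)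

lemma grad_inner_eq_sum:
  assumes "u \<in> H1 D" "v \<in> H1 D"
  shows "grad_inner D u v = (\<Sum>i\<in>UNIV. L2_inner D (weak_partial D i u) (weak_partial D i v))"
  unfolding grad_inner_def L2_inner_def
  using assms by (intro Bochner_Integration.integral_sum integrable_L2_inner weak_partial_L2)

lemma semi_inner_grad: "semi_inner (H1 D) (grad_inner D)"
proof
  fix u v w :: "real^'n \<Rightarrow> complex" and c :: complex
  show "grad_inner D (\<lambda>x. u x + v x) w = grad_inner D u w + grad_inner D v w"
    if u: "u \<in> H1 D" and v: "v \<in> H1 D" and w: "w \<in> H1 D"
  proof -
    have "L2_inner D (weak_partial D i (\<lambda>x. u x + v x)) (weak_partial D i w)
      = L2_inner D (weak_partial D i u) (weak_partial D i w)
        + L2_inner D (weak_partial D i v) (weak_partial D i w)" for i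
      using L2_inner_cong_AE[OF weak_partial_add[OF u v] AE_I2, of "weak_partial D i w" "weak_partial D i w" i] u v w
      by (simp add: L2.add_left weak_partial_L2 H1_add L2_add)
    then show ?thesis using u v w by (simp add: grad_inner_eq_sum H1_add sum.distrib)
  qed
  show "grad_inner D (\<lambda>x. c * u x) w = c * grad_inner D u w" if u: "u \<in> H1 D" and w: "w \<in> H1 D"
  proof -
    have "L2_inner D (weak_partial D i (\<lambda>x. c * u x)) (weak_partial D i w)
      = c * L2_inner D (weak_partial D i u) (weak_partial D i w)" for i
      using L2_inner_cong_AE[OF weak_partial_scale[OF u] AE_I2, of "weak_partial D i w" "weak_partial D i w" i c] u w
      by (simp add: L2.scale_left weak_partial_L2 H1_scale L2_scale)
    then show ?thesis using u w by (simp add: grad_inner_eq_sum H1_scale sum_distrib_left)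
  qed
  show "grad_inner D v u = cnj (grad_inner D u v)" if "u \<in> H1 D" "v \<in> H1 D"
    using that L2.cnj_commute[OF weak_partial_L2 weak_partial_L2, of v u]
    by (simp add: grad_inner_eq_sum cnj_sum)
  show "0 \<le> Re (grad_inner D u u)" if "u \<in> H1 D"
    using that by (simp add: grad_inner_eq_sum sum_nonneg L2.nonneg weak_partial_L2)
qed (auto intro: H1_add H1_scale zero_H1)

lemma semi_inner_V:
  assumes "0 \<le> c"
  shows "semi_inner (H1 D) (V_inner D c)"
proof -
  interpret grad: semi_inner "H1 D" "grad_inner D" by (rule semi_inner_grad)
  show ?thesis
  proof
    fix u v w :: "real^'n \<Rightarrow> complex" and a :: complex
    show "V_inner D c (\<lambda>x. u x + v x) w = V_inner D c u w + V_inner D c v w"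
      if "u \<in> H1 D" "v \<in> H1 D" "w \<in> H1 D"
      using that by (simp add: V_inner_def grad.add_left L2.add_left H1_L2 algebra_simps)
    show "V_inner D c (\<lambda>x. a * u x) w = a * V_inner D c u w" if "u \<in> H1 D" "w \<in> H1 D"
      using that by (simp add: V_inner_def grad.scale_left L2.scale_left H1_L2 algebra_simps)
    show "V_inner D c v u = cnj (V_inner D c u v)" if "u \<in> H1 D" "v \<in> H1 D"
      using that grad.cnj_commute[of u v] L2.cnj_commute[of u D v] by (simp add: V_inner_def H1_L2)
    show "0 \<le> Re (V_inner D c u u)" if "u \<in> H1 D"
      using that assms grad.nonneg[of u] L2.nonneg[of u D] by (simp add: V_inner_def H1_L2)
  qed (auto intro: H1_add H1_scale zero_H1)
qed

lemma V_norm_eq_seminorm: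
  assumes "0 \<le> c"
  shows "V_norm D c u = semi_inner.seminorm (V_inner D c) u"
proof -
  have "grad_inner D u u = (LINT x|lebesgue_on D. of_real (\<Sum>i\<in>UNIV. (cmod (weak_partial D i u x))\<^sup>2))"
    unfolding grad_inner_def complex_norm_square[symmetric] by simp
  also have "\<dots> = of_real (LINT x|lebesgue_on D. (\<Sum>i\<in>UNIV. (cmod (weak_partial D i u x))\<^sup>2))"
    by (rule integral_complex_of_real)
  finally show ?thesis
    unfolding V_norm_def semi_inner.seminorm_def[OF semi_inner_V[OF assms]]
    by (simp add: V_inner_def L2_inner_self)
qed

lemma V_norm_square:
  assumes "0 \<le> c" "u \<in> H1 D"
  shows "(V_norm D c u)\<^sup>2 = (\<Sum>i\<in>UNIV. (L2.seminorm D (weak_partial D i u))\<^sup>2) + c * (L2.seminorm D u)\<^sup>2"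
proof -
  have "complex_of_real ((V_norm D c u)\<^sup>2) = V_inner D c u u"
    using semi_inner.form_self[OF semi_inner_V] assms by (simp add: V_norm_eq_seminorm)
  also have "\<dots> = of_real ((\<Sum>i\<in>UNIV. (L2.seminorm D (weak_partial D i u))\<^sup>2) + c * (L2.seminorm D u)\<^sup>2)"
    using assms by (simp add: V_inner_def grad_inner_eq_sum L2.form_self weak_partial_L2 H1_L2)
  finally show ?thesis by (simp only: of_real_eq_iff)
qed

lemma V_norm_1_bounds:
  assumes "u \<in> H1 D"
  shows "L2.seminorm D u \<le> V_norm D 1 u" "L2.seminorm D (weak_partial D i u) \<le> V_norm D 1 u"
proof -
  have n: "0 \<le> V_norm D 1 u"
    using semi_inner.seminorm_nonneg[OF semi_inner_V] assms by (simp add: V_norm_eq_seminorm)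
  have le: "(L2.seminorm D (weak_partial D i u))\<^sup>2 \<le> (\<Sum>i\<in>UNIV. (L2.seminorm D (weak_partial D i u))\<^sup>2)"
    by (rule member_le_sum) auto
  have "(L2.seminorm D u)\<^sup>2 \<le> (V_norm D 1 u)\<^sup>2"
    using assms by (simp add: V_norm_square sum_nonneg)
  then show "L2.seminorm D u \<le> V_norm D 1 u" using n by (rule power2_le_imp_le)
  have "(L2.seminorm D (weak_partial D i u))\<^sup>2 \<le> (V_norm D 1 u)\<^sup>2"
    using assms order_trans[OF le, of "(\<Sum>i\<in>UNIV. (L2.seminorm D (weak_partial D i u))\<^sup>2) + (L2.seminorm D u)\<^sup>2"]
    by (simp add: V_norm_square)
  then show "L2.seminorm D (weak_partial D i u) \<le> V_norm D 1 u" using n by (rule power2_le_imp_le)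
qed

lemma H1_diff: "u \<in> H1 D \<Longrightarrow> v \<in> H1 D \<Longrightarrow> (\<lambda>x. u x - v x) \<in> H1 D"
  using semi_inner.diff_mem[OF semi_inner_grad] .

lemma weak_partial_diff:
  assumes "u \<in> H1 D" "v \<in> H1 D"
  shows "AE x in lebesgue_on D. weak_partial D i (\<lambda>x. u x - v x) x = weak_partial D i u x - weak_partial D i v x"
proof -
  have "AE x in lebesgue_on D. weak_partial D i (\<lambda>x. u x + -1 * v x) x
      = weak_partial D i u x + weak_partial D i (\<lambda>x. -1 * v x) x"
    by (rule weak_partial_add[OF assms(1) H1_scale[OF assms(2)]])
  with weak_partial_scale[OF assms(2), of i "-1"] show ?thesis
    by eventually_elim simp
qed

text \<open>The functions and their weak partial derivatives have limits in \<open>L2\<close>. The identity that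
  defines a weak derivative equates inner products with fixed functions, so it survives the passage
  to the limit.\<close>

theorem H1_complete:
  fixes u :: "nat \<Rightarrow> real^'n \<Rightarrow> complex"
  assumes u: "\<And>n. u n \<in> H1 D"
    and cauchy: "\<And>e. e > 0 \<Longrightarrow> \<exists>K. \<forall>m\<ge>K. \<forall>n\<ge>K. V_norm D 1 (\<lambda>x. u m x - u n x) < e"
  shows "\<exists>l\<in>H1 D. (\<lambda>n. V_norm D 1 (\<lambda>x. u n x - l x)) \<longlonglongrightarrow> 0"
proof -
  have "\<exists>l\<in>L2 D. (\<lambda>n. L2.seminorm D (\<lambda>x. u n x - l x)) \<longlonglongrightarrow> 0"
  proof (rule L2_complete[OF H1_L2[OF u]])
    fix e :: real assume "e > 0"
    from cauchy[OF this] show "\<exists>K. \<forall>m\<ge>K. \<forall>n\<ge>K. L2.seminorm D (\<lambda>x. u m x - u n x) < e"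
      using V_norm_1_bounds(1)[OF H1_diff[OF u u]] by (meson le_less_trans)
  qed
  then obtain l where l: "l \<in> L2 D" and lim: "(\<lambda>n. L2.seminorm D (\<lambda>x. u n x - l x)) \<longlonglongrightarrow> 0" by blast
  have wdiff: "L2.seminorm D (weak_partial D i (\<lambda>x. u m x - u n x))
      = L2.seminorm D (\<lambda>x. weak_partial D i (u m) x - weak_partial D i (u n) x)" for i m n
    using u by (intro L2_seminorm_cong_AE weak_partial_diff weak_partial_L2 H1_diff L2.diff_mem)
  have "\<exists>g. g \<in> L2 D \<and> (\<lambda>n. L2.seminorm D (\<lambda>x. weak_partial D i (u n) x - g x)) \<longlonglongrightarrow> 0" for i
    unfolding Bex_def[symmetric]
  proof (rule L2_complete[OF weak_partial_L2[OF u]])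
    fix e :: real assume "e > 0"
    from cauchy[OF this] show "\<exists>K. \<forall>m\<ge>K. \<forall>n\<ge>K.
        L2.seminorm D (\<lambda>x. weak_partial D i (u m) x - weak_partial D i (u n) x) < e"
      using V_norm_1_bounds(2)[OF H1_diff[OF u u], of i] unfolding wdiff by (meson le_less_trans)
  qed
  then have "\<forall>i. \<exists>g. g \<in> L2 D \<and> (\<lambda>n. L2.seminorm D (\<lambda>x. weak_partial D i (u n) x - g x)) \<longlonglongrightarrow> 0"
    by (rule allI)
  from choice[OF this] obtain g where g: "\<And>i. g i \<in> L2 D"
    and glim: "\<And>i. (\<lambda>n. L2.seminorm D (\<lambda>x. weak_partial D i (u n) x - g i x)) \<longlonglongrightarrow> 0" by blast
  have wg: "is_weak_partial D i l (g i)" for i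
    unfolding is_weak_partial_iff
  proof
    fix \<phi> assume \<phi>: "\<phi> \<in> test_functions D"
    have "(\<lambda>n. L2_inner D (u n) (\<lambda>x. cnj (partial_deriv i \<phi> x)))
        \<longlonglongrightarrow> L2_inner D l (\<lambda>x. cnj (partial_deriv i \<phi> x))"
      by (intro L2_inner_tendsto H1_L2 u l lim L2_cnj test_partial_L2 \<phi>)
    moreover have "L2_inner D (u n) (\<lambda>x. cnj (partial_deriv i \<phi> x))
        = - L2_inner D (weak_partial D i (u n)) (\<lambda>x. cnj (\<phi> x))" for n
      using is_weak_partial_weak_partial[OF u, of i n] \<phi> by (simp add: is_weak_partial_iff)
    moreover have "(\<lambda>n. - L2_inner D (weak_partial D i (u n)) (\<lambda>x. cnj (\<phi> x)))
        \<longlonglongrightarrow> - L2_inner D (g i) (\<lambda>x. cnj (\<phi> x))"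
      by (intro tendsto_minus L2_inner_tendsto weak_partial_L2 u g glim L2_cnj test_L2 \<phi>)
    ultimately show "L2_inner D l (\<lambda>x. cnj (partial_deriv i \<phi> x)) = - L2_inner D (g i) (\<lambda>x. cnj (\<phi> x))"
      using LIMSEQ_unique by simp
  qed
  have lH: "l \<in> H1 D" using l g wg by (auto simp: H1_def)
  have wl: "L2.seminorm D (weak_partial D i (\<lambda>x. u n x - l x))
      = L2.seminorm D (\<lambda>x. weak_partial D i (u n) x - g i x)" for i n
  proof (rule L2_seminorm_cong_AE)
    show "AE x in lebesgue_on D. weak_partial D i (\<lambda>x. u n x - l x) x = weak_partial D i (u n) x - g i x"
      using weak_partial_diff[OF u lH, of i n] weak_partial_AE_eq[OF lH wg g, of i]
      by eventually_elim simp
  qed (intro weak_partial_L2 H1_diff u lH L2.diff_mem g)+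
  have "(\<lambda>n. sqrt ((\<Sum>i\<in>UNIV. (L2.seminorm D (\<lambda>x. weak_partial D i (u n) x - g i x))\<^sup>2)
      + 1 * (L2.seminorm D (\<lambda>x. u n x - l x))\<^sup>2)) \<longlonglongrightarrow> sqrt ((\<Sum>i\<in>(UNIV::'n set). 0\<^sup>2) + 1 * 0\<^sup>2)"
    by (intro tendsto_intros glim lim)
  moreover have "sqrt ((\<Sum>i\<in>UNIV. (L2.seminorm D (\<lambda>x. weak_partial D i (u n) x - g i x))\<^sup>2)
      + 1 * (L2.seminorm D (\<lambda>x. u n x - l x))\<^sup>2) = V_norm D 1 (\<lambda>x. u n x - l x)" for n
    using V_norm_square[OF _ H1_diff[OF u lH], of 1 n] semi_inner.seminorm_nonneg[OF semi_inner_V H1_diff[OF u lH], of 1 n]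
    by (simp add: wl[symmetric] V_norm_eq_seminorm real_sqrt_unique)
  ultimately show ?thesis using lH by (auto simp del: mult_1)
qed

lemma semi_hilbert_H1: "semi_hilbert (H1 D) (V_inner D 1)"
proof -
  interpret semi_inner "H1 D" "V_inner D 1" by (rule semi_inner_V) simp
  have "seminorm = V_norm D 1" by (rule ext) (simp add: V_norm_eq_seminorm)
  then show ?thesis
    using H1_complete by unfold_locales auto
qed

text \<open>\<open>H1_0\<close> is the closure of the test functions in \<open>H1\<close>, hence a closed subspace of a
  complete space.\<close>

lemma semi_hilbert_H1_0: "semi_hilbert (H1_0 D) (V_inner D 1)"
proof -
  interpret H: semi_hilbert "H1 D" "V_inner D 1" by (rule semi_hilbert_H1)
  have norm: "V_norm D 1 = H.seminorm" by (rule ext) (simp add: V_norm_eq_seminorm)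
  have H0: "u \<in> H1_0 D \<longleftrightarrow> u \<in> H1 D \<and> (\<forall>\<epsilon>>0. \<exists>\<phi>\<in>test_functions D. H.seminorm (\<lambda>x. u x - \<phi> x) < \<epsilon>)" for u
    by (simp add: H1_0_def norm)
  have approx: "\<exists>\<phi>\<in>test_functions D. H.seminorm (\<lambda>x. u x - \<phi> x) < \<epsilon>" if "u \<in> H1_0 D" "\<epsilon> > 0" for u \<epsilon>
    using that by (simp add: H0)
  have sub: "H1_0 D \<subseteq> H1 D" by (auto simp: H1_0_def)
  have zero: "(\<lambda>x. 0) \<in> H1_0 D"
    using zero_H1 zero_test H.seminorm_zero by (auto simp: H0 intro!: bexI[of _ "\<lambda>x. 0"])
  have add: "(\<lambda>x. u x + v x) \<in> H1_0 D" if u: "u \<in> H1_0 D" and v: "v \<in> H1_0 D" for u v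
  proof -
    have uH: "u \<in> H1 D" and vH: "v \<in> H1 D" using u v sub by auto
    have "\<exists>\<phi>\<in>test_functions D. H.seminorm (\<lambda>x. (u x + v x) - \<phi> x) < \<epsilon>" if e: "\<epsilon> > 0" for \<epsilon>
    proof -
      obtain \<phi> where \<phi>: "\<phi> \<in> test_functions D" "H.seminorm (\<lambda>x. u x - \<phi> x) < \<epsilon> / 2"
        using approx[OF u half_gt_zero[OF e]] by blast
      obtain \<psi> where \<psi>: "\<psi> \<in> test_functions D" "H.seminorm (\<lambda>x. v x - \<psi> x) < \<epsilon> / 2"
        using approx[OF v half_gt_zero[OF e]] by blast
      have "H.seminorm (\<lambda>x. (u x + v x) - (\<phi> x + \<psi> x)) < \<epsilon>"
        using H.seminorm_triangle[OF H1_diff[OF uH test_H1[OF \<phi>(1)]] H1_diff[OF vH test_H1[OF \<psi>(1)]]] \<phi> \<psi>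
        by (simp add: algebra_simps)
      then show ?thesis
        by (rule bexI[of _ "\<lambda>x. \<phi> x + \<psi> x"]) (rule test_functions_add[OF \<phi>(1) \<psi>(1)])
    qed
    then show ?thesis using H1_add[OF uH vH] by (simp add: H0)
  qed
  have scale: "(\<lambda>x. c * u x) \<in> H1_0 D" if u: "u \<in> H1_0 D" for c u
  proof -
    have uH: "u \<in> H1 D" using u sub by auto
    have "\<exists>\<phi>\<in>test_functions D. H.seminorm (\<lambda>x. c * u x - \<phi> x) < \<epsilon>" if "\<epsilon> > 0" for \<epsilon>
    proof -
      have "\<epsilon> / (cmod c + 1) > 0" using that by (simp add: add_nonneg_pos)
      then obtain \<phi> where \<phi>: "\<phi> \<in> test_functions D" "H.seminorm (\<lambda>x. u x - \<phi> x) < \<epsilon> / (cmod c + 1)"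
        using approx[OF u] by blast
      have d: "(\<lambda>x. u x - \<phi> x) \<in> H1 D" by (rule H1_diff[OF uH test_H1[OF \<phi>(1)]])
      have "H.seminorm (\<lambda>x. c * u x - c * \<phi> x) = cmod c * H.seminorm (\<lambda>x. u x - \<phi> x)"
        using H.seminorm_scale[OF d, of c] by (simp add: algebra_simps)
      also have "\<dots> \<le> (cmod c + 1) * H.seminorm (\<lambda>x. u x - \<phi> x)"
        using H.seminorm_nonneg[OF d] by (intro mult_right_mono) auto
      also have "\<dots> < \<epsilon>"
        using \<phi>(2) by (simp add: less_divide_eq add_nonneg_pos mult.commute split: if_splits)
      finally show ?thesis
        by (rule bexI[of _ "\<lambda>x. c * \<phi> x"]) (rule test_functions_mult[OF \<phi>(1) C_diff_const])
    qed
    then show ?thesis using H1_scale[OF uH] by (simp add: H0)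
  qed
  interpret W: semi_inner "H1_0 D" "V_inner D 1"
    by (rule H.subspace[OF sub zero add scale])
  show ?thesis
  proof
    fix u :: "nat \<Rightarrow> real^'n \<Rightarrow> complex"
    assume u: "\<And>n. u n \<in> H1_0 D"
      and c: "\<And>e. e > 0 \<Longrightarrow> \<exists>K. \<forall>m\<ge>K. \<forall>n\<ge>K. H.seminorm (\<lambda>x. u m x - u n x) < e"
    have uH: "u n \<in> H1 D" for n using u sub by blast
    obtain l where l: "l \<in> H1 D" and lim: "(\<lambda>n. H.seminorm (\<lambda>x. u n x - l x)) \<longlonglongrightarrow> 0"
      using H.complete[OF uH c] by blast
    have "\<exists>\<phi>\<in>test_functions D. H.seminorm (\<lambda>x. l x - \<phi> x) < \<epsilon>" if e: "\<epsilon> > 0" for \<epsilon>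
    proof -
      have "eventually (\<lambda>n. H.seminorm (\<lambda>x. u n x - l x) < \<epsilon> / 2) sequentially"
        using order_tendstoD(2)[OF lim half_gt_zero[OF e]] .
      then obtain n where n: "H.seminorm (\<lambda>x. u n x - l x) < \<epsilon> / 2"
        using eventually_happens' sequentially_bot by blast
      obtain \<phi> where \<phi>: "\<phi> \<in> test_functions D" "H.seminorm (\<lambda>x. u n x - \<phi> x) < \<epsilon> / 2"
        using approx[OF u half_gt_zero[OF e], of n] by blast
      have "H.seminorm (\<lambda>x. l x - \<phi> x) < \<epsilon>"
        using H.seminorm_triangle_diff[OF l uH test_H1[OF \<phi>(1)], of n] \<phi> n
          H.seminorm_minus_commute[OF l uH, of n] by simp
      then show ?thesis using \<phi> by blast
    qed
    then have "l \<in> H1_0 D" using l by (simp add: H0)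
    then show "\<exists>l\<in>H1_0 D. (\<lambda>n. H.seminorm (\<lambda>x. u n x - l x)) \<longlonglongrightarrow> 0" using lim by blast
  qed
qed

end

section \<open>Taylor coefficients\<close>

lemma higher_deriv_centered_poly:
  "(deriv ^^ n) (poly (centered_poly z0 N q)) z0 = (if n \<le> N then fact n * q n else 0)"
proof -
  have power: "(deriv ^^ n) (\<lambda>w. (w - z0) ^ k) z0 = (if k = n then fact n else 0)" for k
  proof -
    have "(deriv ^^ n) (\<lambda>w. (w - z0) ^ k) z0 = pochhammer (of_nat (Suc k - n)) n * 0 ^ (k - n)"
      using higher_deriv_power[of n z0 k z0] by simp
    also have "\<dots> = (if k = n then fact n else 0)"
      by (cases k n rule: linorder_cases) (auto simp: pochhammer_0_left pochhammer_fact)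
    finally show ?thesis .
  qed
  have poly: "poly (centered_poly z0 N q) = (\<lambda>z. \<Sum>k\<in>{..N}. q k * (z - z0) ^ k)"
    by (rule ext) (simp add: centered_poly_def poly_sum poly_power)
  have "(deriv ^^ n) (\<lambda>z. \<Sum>k\<in>I. q k * (z - z0) ^ k) z0 = (\<Sum>k\<in>I. q k * (if k = n then fact n else 0))"
    if "finite I" for I
    using that
  proof induction
    case empty
    then show ?case using higher_deriv_cmult[of "\<lambda>_. 0" UNIV z0 n 0] by simp
  next
    case (insert k I)
    have "(deriv ^^ n) (\<lambda>z. q k * (z - z0) ^ k + (\<Sum>k\<in>I. q k * (z - z0) ^ k)) z0
      = (deriv ^^ n) (\<lambda>z. q k * (z - z0) ^ k) z0 + (deriv ^^ n) (\<lambda>z. \<Sum>k\<in>I. q k * (z - z0) ^ k) z0"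
      by (rule higher_deriv_add[where S = UNIV]) (auto intro!: holomorphic_intros)
    also have "(deriv ^^ n) (\<lambda>z. q k * (z - z0) ^ k) z0 = q k * (deriv ^^ n) (\<lambda>z. (z - z0) ^ k) z0"
      by (rule higher_deriv_cmult[where A = UNIV]) (auto intro!: holomorphic_intros)
    finally show ?case using insert by (simp add: power)
  qed
  from this[of "{..N}"] show ?thesis by (simp add: poly if_distrib cong: if_cong)
qed

locale sobolev_space = sobolev_domain D for D :: "(real^'n) set" +
  fixes V :: "(real^'n \<Rightarrow> complex) set"
  assumes V_cases: "V = H1_0 D \<or> V = H1 D"
begin

lemma V_subset: "u \<in> V \<Longrightarrow> u \<in> H1 D"
  using V_cases by (auto simp: H1_0_def)

sublocale H: semi_hilbert V "V_inner D 1"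
  using V_cases semi_hilbert_H1 semi_hilbert_H1_0 by auto

lemma V_norm_1: "V_norm D 1 u = H.seminorm u"
  by (simp add: V_norm_eq_seminorm)

lemma has_V_deriv_iff: "has_V_deriv D V T g z \<longleftrightarrow> H.has_vderiv T g z"
  by (simp add: has_V_deriv_def H.has_vderiv_def V_norm_1)

definition bounded_functional :: "((real^'n \<Rightarrow> complex) \<Rightarrow> complex) \<Rightarrow> bool" where
  "bounded_functional l \<longleftrightarrow>
    (\<forall>u\<in>V. \<forall>v\<in>V. l (\<lambda>x. u x - v x) = l u - l v) \<and>
    (\<forall>c. \<forall>u\<in>V. l (\<lambda>x. c * u x) = c * l u) \<and>
    (\<exists>C. \<forall>u\<in>V. cmod (l u) \<le> C * H.seminorm u)"

lemma bounded_functional_V_inner: "v \<in> V \<Longrightarrow> bounded_functional (\<lambda>u. V_inner D 1 u v)"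
  unfolding bounded_functional_def
  using H.Cauchy_Schwarz[of _ v]
  by (auto simp: H.diff_left H.scale_left mult.commute intro!: exI[of _ "H.seminorm v"])

lemma bounded_functional_L2:
  assumes "v \<in> L2 D"
  shows "bounded_functional (\<lambda>u. L2_inner D u v)"
  unfolding bounded_functional_def
proof (intro conjI ballI allI exI)
  fix u assume u: "u \<in> V"
  have "cmod (L2_inner D u v) \<le> L2.seminorm D u * L2.seminorm D v"
    using L2.Cauchy_Schwarz u assms V_subset H1_L2 by blast
  also have "\<dots> \<le> L2.seminorm D v * H.seminorm u"
    using mult_right_mono[OF V_norm_1_bounds(1)[OF V_subset[OF u]] L2.seminorm_nonneg[OF assms]]
    by (simp add: V_norm_1 mult.commute)
  finally show "cmod (L2_inner D u v) \<le> L2.seminorm D v * H.seminorm u" .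
qed (use assms in \<open>simp_all add: L2.diff_left L2.scale_left V_subset H1_L2\<close>)

lemma bounded_functional_grad:
  assumes "v \<in> V"
  shows "bounded_functional (\<lambda>u. grad_inner D u v)"
proof -
  interpret grad: semi_inner "H1 D" "grad_inner D" by (rule semi_inner_grad)
  show ?thesis
    unfolding bounded_functional_def
  proof (intro conjI ballI allI exI)
    fix u assume u: "u \<in> V"
    have "grad.seminorm u \<le> H.seminorm u"
      using L2.nonneg[OF H1_L2[OF V_subset[OF u]]]
      by (simp add: grad.seminorm_def H.seminorm_def V_inner_def)
    have "cmod (grad_inner D u v) \<le> grad.seminorm u * grad.seminorm v"
      using grad.Cauchy_Schwarz u assms V_subset by blast
    also have "\<dots> \<le> grad.seminorm v * H.seminorm u"
      using mult_right_mono[OF \<open>grad.seminorm u \<le> H.seminorm u\<close> grad.seminorm_nonneg[OF V_subset[OF assms]]]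
      by (simp add: mult.commute)
    finally show "cmod (grad_inner D u v) \<le> grad.seminorm v * H.seminorm u" .
  qed (use assms in \<open>simp_all add: grad.diff_left grad.scale_left V_subset\<close>)
qed

lemma V_deriv:
  assumes "has_V_deriv D V T g z"
  shows "has_V_deriv D V T (V_deriv D V T z) z"
  unfolding V_deriv_def using assms by (rule someI[where P = "\<lambda>g. has_V_deriv D V T g z"])

text \<open>All iterates of \<open>V_deriv\<close> are genuine derivatives: completeness of \<open>V\<close> makes each
  derivative differentiable in turn. The operator chooses one representative at every point, and the
  argument applies to any such choice.\<close>

theorem V_holomorphic_higher_deriv:
  assumes "V_holomorphic_on D V T A" "z \<in> A"
  shows "(V_deriv D V ^^ n) T z \<in> V"
    and "has_V_deriv D V ((V_deriv D V ^^ n) T) ((V_deriv D V ^^ Suc n) T z) z"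
proof -
  have A: "open A" using assms(1) by (simp add: V_holomorphic_on_def)
  have ex: "\<forall>z\<in>A. (V_deriv D V ^^ n) T z \<in> V \<and> (\<exists>g. has_V_deriv D V ((V_deriv D V ^^ n) T) g z)"
  proof (induction n)
    case 0
    then show ?case using assms(1) by (auto simp: V_holomorphic_on_def)
  next
    case (Suc n)
    have d: "has_V_deriv D V ((V_deriv D V ^^ n) T) ((V_deriv D V ^^ Suc n) T w) w" if "w \<in> A" for w
      using Suc that V_deriv by auto
    show ?case
    proof
      fix z assume z: "z \<in> A"
      have "(V_deriv D V ^^ Suc n) T z \<in> V" using d[OF z] by (simp add: has_V_deriv_def)
      moreover have "\<exists>g. has_V_deriv D V ((V_deriv D V ^^ Suc n) T) g z"
        unfolding has_V_deriv_iff
        by (rule H.vderiv_differentiable[OF A z, of "(V_deriv D V ^^ n) T"])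
          (use Suc d in \<open>auto simp: has_V_deriv_iff\<close>)
      ultimately show "(V_deriv D V ^^ Suc n) T z \<in> V \<and> (\<exists>g. has_V_deriv D V ((V_deriv D V ^^ Suc n) T) g z)" ..
    qed
  qed
  then show "(V_deriv D V ^^ n) T z \<in> V" using assms(2) by blast
  show "has_V_deriv D V ((V_deriv D V ^^ n) T) ((V_deriv D V ^^ Suc n) T z) z"
    using ex assms(2) V_deriv by auto
qed

lemma functional_has_deriv:
  assumes "V_holomorphic_on D V T A" "z \<in> A" "bounded_functional l"
  shows "((\<lambda>w. l ((V_deriv D V ^^ n) T w)) has_field_derivative l ((V_deriv D V ^^ Suc n) T z)) (at z)"
proof -
  obtain C where C: "\<And>u. u \<in> V \<Longrightarrow> cmod (l u) \<le> C * H.seminorm u"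
    using assms(3) unfolding bounded_functional_def by blast
  have A: "open A" using assms(1) by (simp add: V_holomorphic_on_def)
  show ?thesis
    by (rule H.has_vderiv_functional[OF A assms(2) V_holomorphic_higher_deriv(1)[OF assms(1)]
        V_holomorphic_higher_deriv(2)[OF assms(1,2), unfolded has_V_deriv_iff] _ _ C])
      (use assms(3) in \<open>auto simp: bounded_functional_def\<close>)
qed

lemma functional_holomorphic:
  assumes "V_holomorphic_on D V T A" "bounded_functional l"
  shows "(\<lambda>w. l (T w)) holomorphic_on A"
  using functional_has_deriv[OF assms(1) _ assms(2), of _ 0] assms(1)
  by (auto simp: holomorphic_on_open V_holomorphic_on_def)

lemma functional_higher_deriv:
  assumes "V_holomorphic_on D V T A" "z \<in> A" "bounded_functional l"
  shows "(deriv ^^ n) (\<lambda>w. l (T w)) z = l ((V_deriv D V ^^ n) T z)"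
  using assms(2)
proof (induction n arbitrary: z)
  case 0
  then show ?case by simp
next
  case (Suc n)
  have A: "open A" using assms(1) by (simp add: V_holomorphic_on_def)
  have "((deriv ^^ n) (\<lambda>w. l (T w)) has_field_derivative l ((V_deriv D V ^^ Suc n) T z)) (at z)"
    using functional_has_deriv[OF assms(1) Suc.prems assms(3), of n]
    by (rule has_field_derivative_transform_within_open[OF _ A Suc.prems]) (simp add: Suc.IH)
  then show ?case by (simp add: DERIV_imp_deriv)
qed

lemma taylor_coeff_mem:
  assumes "V_holomorphic_on D V T A" "z \<in> A"
  shows "taylor_coeff D V T \<beta> z \<in> V"
  using H.zero_mem H.scale_mem[OF V_holomorphic_higher_deriv(1)[OF assms, of "nat \<beta>"], of "1 / fact (nat \<beta>)"]
  by (simp add: taylor_coeff_def)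

lemma functional_taylor_coeff:
  assumes "V_holomorphic_on D V T A" "z \<in> A" "bounded_functional l"
  shows "l (taylor_coeff D V T (int n) z) = l ((V_deriv D V ^^ n) T z) / fact n"
proof -
  have "l (\<lambda>x. 1 / fact n * (V_deriv D V ^^ n) T z x) = 1 / fact n * l ((V_deriv D V ^^ n) T z)"
    using assms(3) V_holomorphic_higher_deriv(1)[OF assms(1,2)] unfolding bounded_functional_def by blast
  then show ?thesis by (simp add: taylor_coeff_def)
qed

lemma V_holomorphic_mult:
  assumes T: "V_holomorphic_on D V T A" and p: "p holomorphic_on A"
  shows "V_holomorphic_on D V (\<lambda>z x. p z * T z x) A"
  unfolding V_holomorphic_on_def
proof (intro conjI ballI)
  have A: "open A" and TV: "\<And>w. w \<in> A \<Longrightarrow> T w \<in> V" using T by (simp_all add: V_holomorphic_on_def)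
  show "open A" by (rule A)
  fix z assume z: "z \<in> A"
  show "(\<lambda>x. p z * T z x) \<in> V" using H.scale_mem[OF TV[OF z]] .
  obtain g where g: "H.has_vderiv T g z"
    using T z by (auto simp: V_holomorphic_on_def has_V_deriv_iff)
  show "\<exists>g. has_V_deriv D V (\<lambda>z x. p z * T z x) g z"
    unfolding has_V_deriv_iff
    using H.has_vderiv_mult[OF A z TV g holomorphic_derivI[OF p A z]] by blast
qed

text \<open>The Leibniz rule for the Taylor coefficients of \<open>Q S\<close>. Both sides are compared through
  their norms because Taylor coefficients are determined only up to null functions. Tested against
  an element \<open>v\<close> of \<open>V\<close>, the rule is the one for the scalar functions \<open>Q\<close> and
  \<open>\<lambda>w. V_inner D 1 (S w) v\<close>; with \<open>v\<close> the difference of the two sides, it says that this difference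
  has norm zero. The terms with \<open>i > n\<close> vanish, since Taylor coefficients of negative order do.\<close>

theorem taylor_coeff_poly_mult:
  assumes S: "V_holomorphic_on D V S A" and z0: "z0 \<in> A" and c: "0 \<le> c"
  shows "V_norm D c (taylor_coeff D V (\<lambda>z x. poly (centered_poly z0 N q) z * S z x) (int n) z0)
    = V_norm D c (\<lambda>x. \<Sum>i\<le>N. q i * taylor_coeff D V S (int n - int i) z0 x)"
proof -
  let ?Q = "poly (centered_poly z0 N q)"
  let ?T = "\<lambda>z x. ?Q z * S z x"
  define a where "a = taylor_coeff D V ?T (int n) z0"
  define b where "b = (\<lambda>x. \<Sum>i\<le>N. q i * taylor_coeff D V S (int n - int i) z0 x)"
  have A: "open A" using S by (simp add: V_holomorphic_on_def)
  have hQ: "?Q holomorphic_on A" by (intro holomorphic_intros)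
  have T: "V_holomorphic_on D V ?T A" using S hQ by (rule V_holomorphic_mult)
  have sV: "taylor_coeff D V S \<beta> z0 \<in> V" for \<beta> by (rule taylor_coeff_mem[OF S z0])
  have aV: "a \<in> V" unfolding a_def by (rule taylor_coeff_mem[OF T z0])
  have bV: "b \<in> V" unfolding b_def by (intro H.sum_mem H.scale_mem sV)
  have eq: "V_inner D 1 a v = V_inner D 1 b v" if v: "v \<in> V" for v
  proof -
    define l where "l u = V_inner D 1 u v" for u
    have l: "bounded_functional l"
      unfolding l_def[abs_def] by (rule bounded_functional_V_inner[OF v])
    have Sn: "(deriv ^^ k) (\<lambda>w. l (S w)) z0 = fact k * l (taylor_coeff D V S (int k) z0)" for k
      using functional_higher_deriv[OF S z0 l] functional_taylor_coeff[OF S z0 l, of k] by simp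
    have lS: "l (\<lambda>x. c * u x) = c * l u" if "u \<in> V" for c u
      using l that by (simp add: bounded_functional_def)
    have "fact n * l a = (deriv ^^ n) (\<lambda>w. l (?T w)) z0"
      using functional_higher_deriv[OF T z0 l] functional_taylor_coeff[OF T z0 l, of n] by (simp add: a_def)
    also have "\<dots> = (deriv ^^ n) (\<lambda>w. ?Q w * l (S w)) z0"
    proof (rule higher_deriv_transform_within_open[OF _ _ A z0])
      show "(\<lambda>w. l (?T w)) holomorphic_on A" by (rule functional_holomorphic[OF T l])
      show "(\<lambda>w. ?Q w * l (S w)) holomorphic_on A"
        by (intro holomorphic_on_mult hQ functional_holomorphic[OF S l])
      show "l (?T w) = ?Q w * l (S w)" if "w \<in> A" for w
        using S that by (intro lS) (simp add: V_holomorphic_on_def)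
    qed
    also have "\<dots> = (\<Sum>i = 0..n. of_nat (n choose i) * (deriv ^^ i) ?Q z0 * (deriv ^^ (n - i)) (\<lambda>w. l (S w)) z0)"
      by (rule higher_deriv_mult[OF hQ functional_holomorphic[OF S l] A z0])
    also have "\<dots> = (\<Sum>i = 0..n. fact n * ((if i \<le> N then q i else 0) * l (taylor_coeff D V S (int n - int i) z0)))"
    proof (intro sum.cong refl)
      fix i assume i: "i \<in> {0..n}"
      have "of_nat (n choose i) * fact i * fact (n - i) = (fact n :: complex)"
        using i by (simp add: binomial_fact)
      then show "of_nat (n choose i) * (deriv ^^ i) ?Q z0 * (deriv ^^ (n - i)) (\<lambda>w. l (S w)) z0
        = fact n * ((if i \<le> N then q i else 0) * l (taylor_coeff D V S (int n - int i) z0))"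
        using i by (simp add: higher_deriv_centered_poly Sn of_nat_diff) (metis (no_types, opaque_lifting) mult.assoc mult.commute)
    qed
    also have "\<dots> = fact n * (\<Sum>i\<in>{0..n} \<inter> {..N}. q i * l (taylor_coeff D V S (int n - int i) z0))"
      unfolding sum_distrib_left[symmetric]
      by (subst sum.inter_restrict) (auto intro!: sum.cong)
    also have "(\<Sum>i\<in>{0..n} \<inter> {..N}. q i * l (taylor_coeff D V S (int n - int i) z0))
        = (\<Sum>i\<le>N. q i * l (taylor_coeff D V S (int n - int i) z0))"
    proof (rule sum.mono_neutral_left)
      show "\<forall>i\<in>{..N} - {0..n} \<inter> {..N}. q i * l (taylor_coeff D V S (int n - int i) z0) = 0"
        using lS[OF H.zero_mem, of 0] by (auto simp: taylor_coeff_def)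
    qed auto
    also have "\<dots> = l b"
      unfolding b_def l_def using v sV by (simp add: H.sum_left H.scale_left H.scale_mem)
    finally show ?thesis by (simp add: l_def)
  qed
  have dV: "(\<lambda>x. a x - b x) \<in> V" by (rule H.diff_mem[OF aV bV])
  have "V_norm D 1 (\<lambda>x. a x - b x) = 0"
    using eq[OF dV] H.diff_left[OF aV bV dV] by (simp add: V_norm_1 H.seminorm_def)
  then have "L2.seminorm D (\<lambda>x. a x - b x) = 0"
    "\<And>i. L2.seminorm D (weak_partial D i (\<lambda>x. a x - b x)) = 0"
    using V_norm_1_bounds[OF V_subset[OF dV]] L2.seminorm_nonneg[OF H1_L2[OF V_subset[OF dV]]]
      L2.seminorm_nonneg[OF weak_partial_L2[OF V_subset[OF dV]]] by (simp_all add: order_antisym)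
  then have 0: "V_norm D c (\<lambda>x. a x - b x) = 0"
    using V_norm_square[OF c V_subset[OF dV]] by simp
  interpret Vc: semi_inner "H1 D" "V_inner D c" by (rule semi_inner_V[OF c])
  have "V_norm D c a = V_norm D c b"
    using Vc.seminorm_diff_le[OF V_subset[OF aV] V_subset[OF bV]] 0 by (simp add: V_norm_eq_seminorm[OF c])
  then show ?thesis by (simp add: a_def b_def)
qed

text \<open>Let \<open>U n\<close> be the \<open>n\<close>-th derivative of \<open>S\<close>. Differentiating \<open>n\<close> times the identity
  \<open>grad_inner D (S z) v - z * L2_inner D (S z) v = L2_inner D f v\<close>, whose right-hand side is constant
  in \<open>z\<close>, gives \<open>grad_inner D (U n z) v - z * L2_inner D (U n z) v = n * L2_inner D (U (n - 1) z) v\<close>.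
  Division by \<open>n!\<close> is the recursion for the Taylor coefficients.\<close>

theorem helmholtz_taylor_coeff:
  assumes S: "V_holomorphic_on D V S A"
    and sol: "\<And>z. z \<in> A \<Longrightarrow> helmholtz_solution D V z f (S z)"
    and z: "z \<in> A" and \<beta>: "\<beta> \<ge> 1"
  shows "helmholtz_solution D V z (taylor_coeff D V S (\<beta> - 1) z) (taylor_coeff D V S \<beta> z)"
proof -
  have A: "open A" using S by (simp add: V_holomorphic_on_def)
  define U where "U n = (V_deriv D V ^^ n) S" for n
  have eq: "grad_inner D (U n z) v - z * L2_inner D (U n z) v
      = (if n = 0 then L2_inner D f v else of_nat n * L2_inner D (U (n - 1) z) v)"
    if v: "v \<in> V" and "z \<in> A" for v n z
    using that(2)
  proof (induction n arbitrary: z)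
    case 0
    then show ?case using sol v by (auto simp: U_def helmholtz_solution_def)
  next
    case (Suc n)
    note z = Suc.prems
    have a: "((\<lambda>w. grad_inner D (U n w) v) has_field_derivative grad_inner D (U (Suc n) z) v) (at z)" for n
      unfolding U_def by (rule functional_has_deriv[OF S z bounded_functional_grad[OF v]])
    have b: "((\<lambda>w. L2_inner D (U n w) v) has_field_derivative L2_inner D (U (Suc n) z) v) (at z)" for n
      unfolding U_def by (rule functional_has_deriv[OF S z bounded_functional_L2[OF H1_L2[OF V_subset[OF v]]]])
    have 1: "((\<lambda>w. grad_inner D (U n w) v - w * L2_inner D (U n w) v) has_field_derivative
        grad_inner D (U (Suc n) z) v - (z * L2_inner D (U (Suc n) z) v + L2_inner D (U n z) v)) (at z)"
      using DERIV_diff[OF a DERIV_mult[OF DERIV_ident b]] by (simp add: algebra_simps)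
    have 2: "((\<lambda>w. if n = 0 then L2_inner D f v else of_nat n * L2_inner D (U (n - 1) w) v) has_field_derivative
        of_nat n * L2_inner D (U n z) v) (at z)"
      using DERIV_cmult[OF b[of "n - 1"], of "of_nat n"] by (cases n) auto
    have "((\<lambda>w. grad_inner D (U n w) v - w * L2_inner D (U n w) v) has_field_derivative
        of_nat n * L2_inner D (U n z) v) (at z)"
      by (rule has_field_derivative_transform_within_open[OF 2 A z]) (simp add: Suc.IH)
    from DERIV_unique[OF 1 this] show ?case by (simp add: algebra_simps)
  qed
  define n where "n = nat (\<beta> - 1)"
  have n: "\<beta> = int (Suc n)" using \<beta> by (simp add: n_def)
  show ?thesis
    unfolding helmholtz_solution_def
  proof (intro conjI ballI)
    show "taylor_coeff D V S \<beta> z \<in> V" by (rule taylor_coeff_mem[OF S z])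
    fix v assume v: "v \<in> V"
    note bl = bounded_functional_L2[OF H1_L2[OF V_subset[OF v]]]
    have "grad_inner D (taylor_coeff D V S (int (Suc n)) z) v = grad_inner D (U (Suc n) z) v / fact (Suc n)"
      "L2_inner D (taylor_coeff D V S (int (Suc n)) z) v = L2_inner D (U (Suc n) z) v / fact (Suc n)"
      "L2_inner D (taylor_coeff D V S (int n) z) v = L2_inner D (U n z) v / fact n"
      unfolding U_def
      by (rule functional_taylor_coeff[OF S z bounded_functional_grad[OF v]] functional_taylor_coeff[OF S z bl])+
    moreover have "grad_inner D (U (Suc n) z) v / fact (Suc n) - z * (L2_inner D (U (Suc n) z) v / fact (Suc n))
        = L2_inner D (U n z) v / fact n"
    proof -
      have "grad_inner D (U (Suc n) z) v / fact (Suc n) - z * (L2_inner D (U (Suc n) z) v / fact (Suc n))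
        = (grad_inner D (U (Suc n) z) v - z * L2_inner D (U (Suc n) z) v) / fact (Suc n)"
        by (simp add: diff_divide_distrib del: fact_Suc)
      also have "\<dots> = of_nat (Suc n) * L2_inner D (U n z) v / fact (Suc n)"
        using eq[OF v z, of "Suc n"] by simp
      also have "\<dots> = L2_inner D (U n z) v / fact n"
        by (simp add: fact_Suc del: of_nat_Suc)
      finally show ?thesis .
    qed
    ultimately show "grad_inner D (taylor_coeff D V S \<beta> z) v - z * L2_inner D (taylor_coeff D V S \<beta> z) v
        = L2_inner D (taylor_coeff D V S (\<beta> - 1) z) v"
      by (simp add: n del: of_nat_Suc fact_Suc) (simp add: of_nat_Suc)
  qed
qed

text \<open>A difference of two solutions satisfies the eigenvalue equation at \<open>z\<close>, so it can be
  nonzero only if \<open>z\<close> is an eigenvalue.\<close>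

lemma helmholtz_solution_unique:
  assumes "z \<notin> laplace_eigenvalues D V"
    and u: "helmholtz_solution D V z f u" and w: "helmholtz_solution D V z f w"
  shows "AE x in lebesgue_on D. w x = u x"
proof -
  interpret grad: semi_inner "H1 D" "grad_inner D" by (rule semi_inner_grad)
  have uV: "u \<in> V" and wV: "w \<in> V" using u w by (auto simp: helmholtz_solution_def)
  have dV: "(\<lambda>x. w x - u x) \<in> V" by (rule H.diff_mem[OF wV uV])
  have "grad_inner D (\<lambda>x. w x - u x) v = z * L2_inner D (\<lambda>x. w x - u x) v" if v: "v \<in> V" for v
  proof -
    have "grad_inner D u v - z * L2_inner D u v = grad_inner D w v - z * L2_inner D w v"
      using u w v by (simp add: helmholtz_solution_def)
    then show ?thesis
      using uV wV v by (simp add: grad.diff_left L2.diff_left V_subset H1_L2 algebra_simps)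
  qed
  moreover have "z \<in> laplace_eigenvalues D V"
    if "\<not> (AE x in lebesgue_on D. w x - u x = 0)"
      "\<And>v. v \<in> V \<Longrightarrow> grad_inner D (\<lambda>x. w x - u x) v = z * L2_inner D (\<lambda>x. w x - u x) v"
    unfolding laplace_eigenvalues_def
    by (intro CollectI bexI[OF _ dV] conjI ballI that)
  ultimately have "AE x in lebesgue_on D. w x - u x = 0"
    using assms(1) by blast
  then show ?thesis by eventually_elim simp
qed

end

section \<open>The Rayleigh principle\<close>

definition mat_form :: "complex mat \<Rightarrow> nat \<Rightarrow> (nat \<Rightarrow> complex) \<Rightarrow> (nat \<Rightarrow> complex) \<Rightarrow> complex" where
  "mat_form A N p q = (\<Sum>i\<le>N. \<Sum>j\<le>N. A $$ (i, j) * p j * cnj (q i))"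

lemma compact_coordinate_box:
  "compact {p :: nat \<Rightarrow> complex. \<forall>i. p i \<in> (if i \<le> N then cball 0 1 else {0})}"
proof -
  have "compactin (product_topology (\<lambda>i. euclidean) UNIV)
      (PiE UNIV (\<lambda>i :: nat. if i \<le> N then cball 0 1 else {0 :: complex}))"
    unfolding compactin_PiE by simp
  then show ?thesis
    by (simp add: euclidean_product_topology PiE_UNIV_domain Pi_def)
qed

text \<open>Coefficient sequences are functions on all of \<open>nat\<close>. Setting the coordinates beyond \<open>N\<close>
  to zero makes the unit sphere a closed subset of a product of compact sets.\<close>

lemma compact_coordinate_sphere:
  "compact {p :: nat \<Rightarrow> complex. (\<Sum>i\<le>N. (cmod (p i))\<^sup>2) = 1 \<and> (\<forall>i>N. p i = 0)}"
proof -
  let ?B = "{p :: nat \<Rightarrow> complex. \<forall>i. p i \<in> (if i \<le> N then cball 0 1 else {0})}"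
  let ?C = "{p :: nat \<Rightarrow> complex. (\<Sum>i\<le>N. (cmod (p i))\<^sup>2) = 1}"
  have "closed ?C"
    by (intro closed_Collect_eq continuous_intros continuous_on_product_coordinates)
  then have "compact (?B \<inter> ?C)"
    using compact_coordinate_box by (intro compact_Int_closed)
  moreover have "{p :: nat \<Rightarrow> complex. (\<Sum>i\<le>N. (cmod (p i))\<^sup>2) = 1 \<and> (\<forall>i>N. p i = 0)} = ?B \<inter> ?C"
  proof -
    have "cmod (p i) \<le> 1" if s: "(\<Sum>i\<le>N. (cmod (p i))\<^sup>2) = 1" and "i \<le> N" for p :: "nat \<Rightarrow> complex" and i
    proof -
      have "(cmod (p i))\<^sup>2 \<le> (\<Sum>i\<le>N. (cmod (p i))\<^sup>2)"
        using that(2) by (intro member_le_sum) auto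
      then show ?thesis using s power2_le_imp_le[of "cmod (p i)" 1] by simp
    qed
    then show ?thesis by (auto split: if_splits simp: not_le)
  qed
  ultimately show ?thesis by simp
qed

lemma eigenvector_vec_iff:
  assumes A: "A \<in> carrier_mat (N + 1) (N + 1)"
  shows "eigenvector A (Matrix.vec (N + 1) q) k \<longleftrightarrow>
    (\<exists>i\<le>N. q i \<noteq> 0) \<and> (\<forall>i\<le>N. (\<Sum>j\<le>N. A $$ (i, j) * q j) = k * q i)"
proof -
  have "Matrix.vec (N + 1) q \<noteq> 0\<^sub>v (N + 1) \<longleftrightarrow> (\<exists>i\<le>N. q i \<noteq> 0)"
    by (auto simp: vec_eq_iff less_Suc_eq_le)
  moreover have "A *\<^sub>v Matrix.vec (N + 1) q = k \<cdot>\<^sub>v Matrix.vec (N + 1) q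
      \<longleftrightarrow> (\<forall>i\<le>N. (\<Sum>j\<le>N. A $$ (i, j) * q j) = k * q i)"
  proof -
    have "(A *\<^sub>v Matrix.vec (N + 1) q) $ i = (\<Sum>j\<le>N. A $$ (i, j) * q j)" if "i \<le> N" for i
      using A that by (auto simp: scalar_prod_def lessThan_Suc_atMost[symmetric] atLeast0LessThan intro!: sum.cong)
    then show ?thesis
      using A by (auto simp: vec_eq_iff less_Suc_eq_le)
  qed
  ultimately show ?thesis using A by (simp add: eigenvector_def)
qed

locale hermitian_form =
  fixes A :: "complex mat" and N :: nat
  assumes carrier: "A \<in> carrier_mat (N + 1) (N + 1)"
    and hermitian: "\<And>i j. i \<le> N \<Longrightarrow> j \<le> N \<Longrightarrow> A $$ (j, i) = cnj (A $$ (i, j))"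
begin

lemma form_cnj: "mat_form A N q p = cnj (mat_form A N p q)"
proof -
  have "cnj (mat_form A N p q) = (\<Sum>i\<le>N. \<Sum>j\<le>N. A $$ (j, i) * cnj (p j) * q i)"
    unfolding mat_form_def cnj_sum by (intro sum.cong refl) (simp add: hermitian[symmetric])
  also have "\<dots> = (\<Sum>j\<le>N. \<Sum>i\<le>N. A $$ (j, i) * cnj (p j) * q i)"
    by (rule sum.swap)
  finally show ?thesis by (simp add: mat_form_def mult_ac)
qed

lemma form_self_real: "mat_form A N q q = of_real (Re (mat_form A N q q))"
  using form_cnj[of q q] by (simp add: complex_eq_iff)

lemma form_eigenvector:
  assumes "\<And>i. i \<le> N \<Longrightarrow> (\<Sum>j\<le>N. A $$ (i, j) * q j) = k * q i"
  shows "mat_form A N q q = k * of_real (\<Sum>i\<le>N. (cmod (q i))\<^sup>2)"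
proof -
  have "mat_form A N q q = (\<Sum>i\<le>N. (\<Sum>j\<le>N. A $$ (i, j) * q j) * cnj (q i))"
    by (simp add: mat_form_def sum_distrib_right)
  also have "\<dots> = (\<Sum>i\<le>N. k * of_real ((cmod (q i))\<^sup>2))"
    using assms by (intro sum.cong refl) (simp add: complex_norm_square mult.assoc del: of_real_power)
  finally show ?thesis by (simp add: sum_distrib_left)
qed

text \<open>By compactness the form attains a minimum \<open>m\<close> on the unit sphere. The form \<open>C\<close> of
  \<open>A - m\<close> is then positive semidefinite, and a unit vector \<open>q\<close> is a minimizer iff \<open>C q q = 0\<close>. The
  Cauchy--Schwarz inequality for \<open>C\<close> sharpens this to \<open>C q w = 0\<close> for all \<open>w\<close>, which is the
  equation \<open>A q = m q\<close>. The eigenvalue belonging to an eigenvector is the value of the form on its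
  normalization, so none is smaller than \<open>m\<close>.\<close>

theorem rayleigh:
  shows "\<exists>m. smallest_eigenvalue A (of_real m) \<and>
    (\<exists>p. (\<Sum>i\<le>N. (cmod (p i))\<^sup>2) = 1 \<and> Re (mat_form A N p p) = m) \<and>
    (\<forall>q. (\<Sum>i\<le>N. (cmod (q i))\<^sup>2) = 1 \<longrightarrow>
      ((\<forall>p. (\<Sum>i\<le>N. (cmod (p i))\<^sup>2) = 1 \<longrightarrow> Re (mat_form A N q q) \<le> Re (mat_form A N p p))
        \<longleftrightarrow> eigenvector A (Matrix.vec (N + 1) q) (of_real m)))"
proof -
  let ?K = "{p :: nat \<Rightarrow> complex. (\<Sum>i\<le>N. (cmod (p i))\<^sup>2) = 1 \<and> (\<forall>i>N. p i = 0)}"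
  define sq :: "(nat \<Rightarrow> complex) \<Rightarrow> real" where "sq p = (\<Sum>i\<le>N. (cmod (p i))\<^sup>2)" for p
  have "(\<lambda>i. if i = 0 then 1 else 0) \<in> ?K"
    by (auto simp: if_distrib[of cmod] if_distrib[of "\<lambda>x. x\<^sup>2"] cong: if_cong)
  then have ne: "?K \<noteq> {}" by (simp only: ex_in_conv[symmetric]) (rule exI)
  have "continuous_on UNIV (\<lambda>p. Re (mat_form A N p p))"
    unfolding mat_form_def
    by (intro continuous_intros continuous_on_product_coordinates)
  then have cont: "continuous_on ?K (\<lambda>p. Re (mat_form A N p p))"
    by (rule continuous_on_subset) simp
  obtain p0 where p0: "p0 \<in> ?K" and min: "\<forall>p\<in>?K. Re (mat_form A N p0 p0) \<le> Re (mat_form A N p p)"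
    by (rule bexE[OF continuous_attains_inf[OF compact_coordinate_sphere ne cont]])
  define m where "m = Re (mat_form A N p0 p0)"
  have scale: "mat_form A N (\<lambda>i. if i \<le> N then of_real c * p i else 0) (\<lambda>i. if i \<le> N then of_real c * p i else 0)
      = of_real (c\<^sup>2) * mat_form A N p p" for p c
    unfolding mat_form_def sum_distrib_left by (intro sum.cong refl) (simp add: power2_eq_square)
  have lower: "m * sq p \<le> Re (mat_form A N p p)" for p
  proof (cases "sq p = 0")
    case True
    then have "\<And>i. i \<le> N \<Longrightarrow> p i = 0" by (simp add: sq_def sum_nonneg_eq_0_iff)
    then have "mat_form A N p p = 0" by (simp add: mat_form_def)
    then show ?thesis using True by simp
  next
    case False
    then have pos: "sq p > 0" by (simp add: sq_def order_less_le sum_nonneg)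
    define c where "c = 1 / sqrt (sq p)"
    have c2: "c\<^sup>2 = 1 / sq p" using pos by (simp add: c_def power_divide)
    have "(\<lambda>i. if i \<le> N then of_real c * p i else 0) \<in> ?K"
    proof -
      have "(\<Sum>i\<le>N. (cmod (if i \<le> N then of_real c * p i else 0))\<^sup>2) = c\<^sup>2 * sq p"
        unfolding sq_def sum_distrib_left
        by (intro sum.cong refl) (simp add: norm_mult power_mult_distrib)
      then show ?thesis using c2 pos by simp
    qed
    from bspec[OF min this] have "m \<le> c\<^sup>2 * Re (mat_form A N p p)"
      unfolding scale m_def by (simp del: of_real_power)
    then show ?thesis using pos by (simp add: c2 field_simps)
  qed
  define C where "C p q = mat_form A N p q - of_real m * (\<Sum>i\<le>N. p i * cnj (q i))" for p q
  have sq_sum: "(\<Sum>i\<le>N. p i * cnj (p i)) = of_real (sq p)" for p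
    by (simp add: sq_def complex_norm_square del: of_real_power)
  interpret C: semi_inner UNIV C
  proof
    fix u v w :: "nat \<Rightarrow> complex" and c :: complex
    show "C (\<lambda>x. u x + v x) w = C u w + C v w"
      by (simp add: C_def mat_form_def algebra_simps sum.distrib)
    show "C (\<lambda>x. c * u x) w = c * C u w"
      by (simp add: C_def mat_form_def algebra_simps sum_distrib_left)
    show "C v u = cnj (C u v)"
      using form_cnj[of v u] by (simp add: C_def mult.commute)
    show "0 \<le> Re (C u u)"
      using lower[of u] by (simp add: C_def sq_sum)
  qed auto
  have null: "eigenvector A (Matrix.vec (N + 1) q) (of_real m) \<longleftrightarrow> Re (mat_form A N q q) = m"
    if q: "sq q = 1" for q
  proof
    assume "eigenvector A (Matrix.vec (N + 1) q) (of_real m)"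
    then have "mat_form A N q q = of_real m * of_real (sq q)"
      unfolding sq_def eigenvector_vec_iff[OF carrier] by (intro form_eigenvector) blast
    then show "Re (mat_form A N q q) = m" using q by simp
  next
    assume "Re (mat_form A N q q) = m"
    then have "C.seminorm q = 0" using q by (simp add: C.seminorm_def C_def sq_sum)
    then have 0: "C q w = 0" for w using C.Cauchy_Schwarz[of q w] by simp
    have "(\<Sum>j\<le>N. A $$ (i, j) * q j) = of_real m * q i" if i: "i \<le> N" for i
    proof -
      have "mat_form A N q (\<lambda>k. if k = i then 1 else 0) = (\<Sum>k\<le>N. if k = i then (\<Sum>j\<le>N. A $$ (k, j) * q j) else 0)"
        unfolding mat_form_def by (intro sum.cong refl) auto
      then have "C q (\<lambda>k. if k = i then 1 else 0) = (\<Sum>j\<le>N. A $$ (i, j) * q j) - of_real m * q i"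
        using i by (simp add: C_def if_distrib[of cnj] if_distrib[of "\<lambda>x. _ * x"] cong: if_cong)
      with 0 show ?thesis by simp
    qed
    moreover have "\<exists>i\<le>N. q i \<noteq> 0"
    proof (rule ccontr)
      assume "\<not> ?thesis"
      then have "sq q = 0" by (simp add: sq_def)
      with q show False by simp
    qed
    ultimately show "eigenvector A (Matrix.vec (N + 1) q) (of_real m)"
      unfolding eigenvector_vec_iff[OF carrier] by blast
  qed
  have p0': "sq p0 = 1" "Re (mat_form A N p0 p0) = m" using p0 by (auto simp: sq_def m_def)
  have "smallest_eigenvalue A (of_real m)"
    unfolding smallest_eigenvalue_def
  proof (intro conjI allI impI)
    show "eigenvalue A (of_real m)"
      using null[OF p0'(1)] p0'(2) by (auto simp: eigenvalue_def)
    fix \<nu> assume "eigenvalue A \<nu>"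
    then obtain v where v: "eigenvector A v \<nu>" by (auto simp: eigenvalue_def)
    then have "v = Matrix.vec (N + 1) (\<lambda>i. v $ i)"
      using carrier by (auto simp: eigenvector_def)
    with v have "eigenvector A (Matrix.vec (N + 1) (\<lambda>i. v $ i)) \<nu>" by simp
    then have ex: "\<exists>i\<le>N. v $ i \<noteq> 0" and ev: "\<And>i. i \<le> N \<Longrightarrow> (\<Sum>j\<le>N. A $$ (i, j) * v $ j) = \<nu> * v $ i"
      unfolding eigenvector_vec_iff[OF carrier] by auto
    have "sq (\<lambda>i. v $ i) \<noteq> 0" using ex by (auto simp: sq_def sum_nonneg_eq_0_iff)
    then have pos: "sq (\<lambda>i. v $ i) > 0" by (simp add: sq_def order_less_le sum_nonneg)
    define F where "F = mat_form A N (\<lambda>i. v $ i) (\<lambda>i. v $ i)"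
    have F: "F = \<nu> * of_real (sq (\<lambda>i. v $ i))"
      unfolding F_def sq_def by (rule form_eigenvector[OF ev])
    have "Im F = 0" using arg_cong[OF form_self_real, of Im] by (simp add: F_def)
    then have "Im \<nu> = 0" using pos by (simp add: F)
    moreover have "m * sq (\<lambda>i. v $ i) \<le> Re \<nu> * sq (\<lambda>i. v $ i)"
      using lower[of "\<lambda>i. v $ i"] by (simp add: F_def[symmetric] F)
    then have "m \<le> Re \<nu>" using pos by simp
    ultimately show "of_real m \<le> \<nu>" by (simp add: less_eq_complex_def)
  qed
  moreover have "(\<forall>p. sq p = 1 \<longrightarrow> Re (mat_form A N q q) \<le> Re (mat_form A N p p))
      \<longleftrightarrow> eigenvector A (Matrix.vec (N + 1) q) (of_real m)" if q: "sq q = 1" for q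
    unfolding null[OF q] using p0' lower q by (metis mult.right_neutral order_antisym)
  ultimately show ?thesis using p0' unfolding sq_def by blast
qed

end

lemma mat_adjoint_index:
  assumes "i < dim_col A" "j < dim_row A"
  shows "mat_adjoint A $$ (i, j) = conjugate (A $$ (j, i))"
  using assms by (simp add: mat_adjoint_def mat_of_rows_def)

lemma hermitian_mat_iff:
  assumes "A \<in> carrier_mat (N + 1) (N + 1)"
  shows "hermitian_mat A \<longleftrightarrow> (\<forall>i\<le>N. \<forall>j\<le>N. A $$ (j, i) = cnj (A $$ (i, j)))"
proof -
  have dim: "dim_row (mat_adjoint A) = dim_col A" "dim_col (mat_adjoint A) = dim_row A"
    by (simp_all add: mat_adjoint_def)
  have "hermitian_mat A \<longleftrightarrow> (\<forall>i\<le>N. \<forall>j\<le>N. cnj (A $$ (j, i)) = A $$ (i, j))"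
    using assms unfolding hermitian_mat_def mat_eq_iff
    by (auto simp: dim mat_adjoint_index less_Suc_eq_le)
  then show ?thesis by (metis complex_cnj_cnj)
qed

lemma mat_form_eq_scalar_prod:
  assumes A: "A \<in> carrier_mat (N + 1) (N + 1)" and v: "v \<in> carrier_vec (N + 1)"
  shows "(A *\<^sub>v v) \<bullet>c v = mat_form A N (\<lambda>i. v $ i) (\<lambda>i. v $ i)"
proof -
  have "(A *\<^sub>v v) \<bullet>c v = (\<Sum>i = 0..<N + 1. (\<Sum>j = 0..<N + 1. A $$ (i, j) * v $ j) * cnj (v $ i))"
    using A v by (auto simp: scalar_prod_def intro!: sum.cong)
  also have "{0..<N + 1} = {..N}" by auto
  finally show ?thesis by (simp add: mat_form_def sum_distrib_right)
qed

section \<open>The minimization problem as an eigenvalue problem\<close>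

lemma centered_poly_inject:
  assumes "centered_poly z0 N p = centered_poly z0 N q" "i \<le> N"
  shows "p i = q i"
  using higher_deriv_centered_poly[of i z0 N p] higher_deriv_centered_poly[of i z0 N q] assms by simp

text \<open>The set \<open>sphere_polys\<close> asks for some normalized coefficient sequence; as the coefficients
  up to \<open>N\<close> are determined by the polynomial, it is \<open>q\<close> itself that is normalized.\<close>

lemma centered_poly_in_sphere_polys_iff:
  "centered_poly z0 N q \<in> sphere_polys z0 N \<longleftrightarrow> (\<Sum>i\<le>N. (cmod (q i))\<^sup>2) = 1"
proof
  assume "centered_poly z0 N q \<in> sphere_polys z0 N"
  then obtain p where p: "centered_poly z0 N q = centered_poly z0 N p" "(\<Sum>i\<le>N. (cmod (p i))\<^sup>2) = 1"
    unfolding sphere_polys_def by blast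
  have "(\<Sum>i\<le>N. (cmod (q i))\<^sup>2) = (\<Sum>i\<le>N. (cmod (p i))\<^sup>2)"
    by (intro sum.cong refl) (simp add: centered_poly_inject[OF p(1)])
  then show "(\<Sum>i\<le>N. (cmod (q i))\<^sup>2) = 1" using p(2) by simp
qed (auto simp: sphere_polys_def)

lemma gram_matrix_carrier: "gram_matrix D V S z0 M N E \<rho> \<in> carrier_mat (N + 1) (N + 1)"
  by (simp add: gram_matrix_def)

lemma gram_matrix_index:
  "i \<le> N \<Longrightarrow> j \<le> N \<Longrightarrow> gram_matrix D V S z0 M N E \<rho> $$ (i, j) = (\<Sum>\<alpha>=M+1..E.
    V_inner D (Re z0) (taylor_coeff D V S (int \<alpha> - int j) z0) (taylor_coeff D V S (int \<alpha> - int i) z0)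
      * of_real (\<rho> ^ (2 * \<alpha>)))"
  by (simp add: gram_matrix_def)

context sobolev_space
begin

lemma gram_matrix_hermitian:
  assumes S: "V_holomorphic_on D V S A" "z0 \<in> A" and "0 \<le> Re z0" and ij: "i \<le> N" "j \<le> N"
  shows "gram_matrix D V S z0 M N E \<rho> $$ (j, i) = cnj (gram_matrix D V S z0 M N E \<rho> $$ (i, j))"
proof -
  interpret B: semi_inner "H1 D" "V_inner D (Re z0)" by (rule semi_inner_V) fact
  have "taylor_coeff D V S \<beta> z0 \<in> H1 D" for \<beta> by (rule V_subset[OF taylor_coeff_mem[OF S]])
  then show ?thesis
    unfolding gram_matrix_index[OF ij] gram_matrix_index[OF ij(2,1)] cnj_sum
    by (intro sum.cong refl) (simp add: B.cnj_commute[symmetric])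
qed

text \<open>By the Leibniz rule the Taylor coefficient of order \<open>\<alpha>\<close> of \<open>Q S\<close> is a linear combination
  of those of \<open>S\<close> with the coefficients of \<open>Q\<close>. Expanding its squared norm sesquilinearly and
  summing over \<open>\<alpha>\<close> produces the entries of the Gram matrix.\<close>

lemma gram_form_eq_jbar_square:
  assumes S: "V_holomorphic_on D V S A" "z0 \<in> A" and c: "0 \<le> Re z0"
  shows "mat_form (gram_matrix D V S z0 M N E \<rho>) N q q
    = of_real ((jbar D V S z0 M E \<rho> (centered_poly z0 N q))\<^sup>2)"
proof -
  interpret B: semi_inner "H1 D" "V_inner D (Re z0)" by (rule semi_inner_V[OF c])
  define s where "s \<alpha> i = taylor_coeff D V S (int \<alpha> - int i) z0" for \<alpha> i :: nat
  have sH: "s \<alpha> i \<in> H1 D" for \<alpha> i unfolding s_def by (rule V_subset[OF taylor_coeff_mem[OF S]])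
  define w where "w \<alpha> = (\<lambda>x. \<Sum>i\<le>N. q i * s \<alpha> i x)" for \<alpha>
  have wH: "w \<alpha> \<in> H1 D" for \<alpha> unfolding w_def by (intro B.sum_mem B.scale_mem sH)
  have expand: "V_inner D (Re z0) (w \<alpha>) (w \<alpha>)
      = (\<Sum>i\<le>N. \<Sum>j\<le>N. V_inner D (Re z0) (s \<alpha> j) (s \<alpha> i) * q j * cnj (q i))" for \<alpha>
  proof -
    have "V_inner D (Re z0) (w \<alpha>) (w \<alpha>) = (\<Sum>i\<le>N. V_inner D (Re z0) (w \<alpha>) (\<lambda>x. q i * s \<alpha> i x))"
      by (subst (2) w_def) (intro B.sum_right B.scale_mem sH wH)
    also have "\<dots> = (\<Sum>i\<le>N. \<Sum>j\<le>N. V_inner D (Re z0) (\<lambda>x. q j * s \<alpha> j x) (\<lambda>x. q i * s \<alpha> i x))"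
      unfolding w_def by (intro sum.cong refl B.sum_left B.scale_mem sH)
    also have "\<dots> = (\<Sum>i\<le>N. \<Sum>j\<le>N. V_inner D (Re z0) (s \<alpha> j) (s \<alpha> i) * q j * cnj (q i))"
      by (intro sum.cong refl) (simp add: B.scale_left B.scale_right B.scale_mem sH mult_ac)
    finally show ?thesis .
  qed
  have "mat_form (gram_matrix D V S z0 M N E \<rho>) N q q
      = (\<Sum>i\<le>N. \<Sum>j\<le>N. \<Sum>\<alpha>=M+1..E. V_inner D (Re z0) (s \<alpha> j) (s \<alpha> i) * q j * cnj (q i) * of_real (\<rho> ^ (2 * \<alpha>)))"
    unfolding mat_form_def
    by (intro sum.cong refl) (simp add: gram_matrix_index s_def sum_distrib_left sum_distrib_right mult_ac)
  also have "\<dots> = (\<Sum>i\<le>N. \<Sum>\<alpha>=M+1..E. \<Sum>j\<le>N. V_inner D (Re z0) (s \<alpha> j) (s \<alpha> i) * q j * cnj (q i) * of_real (\<rho> ^ (2 * \<alpha>)))"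
    by (intro sum.cong refl sum.swap)
  also have "\<dots> = (\<Sum>\<alpha>=M+1..E. \<Sum>i\<le>N. \<Sum>j\<le>N. V_inner D (Re z0) (s \<alpha> j) (s \<alpha> i) * q j * cnj (q i) * of_real (\<rho> ^ (2 * \<alpha>)))"
    by (rule sum.swap)
  also have "\<dots> = (\<Sum>\<alpha>=M+1..E. V_inner D (Re z0) (w \<alpha>) (w \<alpha>) * of_real (\<rho> ^ (2 * \<alpha>)))"
    unfolding expand sum_distrib_right ..
  also have "\<dots> = of_real (\<Sum>\<alpha>=M+1..E. (V_norm D (Re z0) (w \<alpha>))\<^sup>2 * \<rho> ^ (2 * \<alpha>))"
    by (simp add: B.form_self wH V_norm_eq_seminorm[OF c])
  also have "(\<Sum>\<alpha>=M+1..E. (V_norm D (Re z0) (w \<alpha>))\<^sup>2 * \<rho> ^ (2 * \<alpha>))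
      = (jbar D V S z0 M E \<rho> (centered_poly z0 N q))\<^sup>2"
  proof -
    have "0 \<le> (\<Sum>\<alpha>=M+1..E. (V_norm D (Re z0) (w \<alpha>))\<^sup>2 * \<rho> ^ (2 * \<alpha>))"
      by (intro sum_nonneg mult_nonneg_nonneg) (simp_all add: power_mult)
    then show ?thesis
      by (simp add: jbar_def taylor_coeff_poly_mult[OF S c] w_def s_def)
  qed
  finally show ?thesis .
qed

end

theorem proposition3p2:
  fixes D :: "(real^'n) set"
    and V :: "(real^'n \<Rightarrow> complex) set"
    and f :: "real^'n \<Rightarrow> complex"
    and S :: "complex \<Rightarrow> real^'n \<Rightarrow> complex"
    and z0 :: complex and \<rho> :: real and M N E :: nat
  assumes "CARD('n) \<in> {1, 2, 3}"
    and "bounded_lipschitz_domain D"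
    and "V = H1_0 D \<or> V = H1 D"
    and "f \<in> L2 D"
    and "frequency_response D V f S"
    and "V_holomorphic_on D V S (- laplace_eigenvalues D V)"
    and "E \<ge> M + N"
    and "\<rho> > 0"
    and "z0 \<notin> laplace_eigenvalues D V"
    and "Re z0 > 0"
  defines "G \<equiv> gram_matrix D V S z0 M N E \<rho>"
  shows "hermitian_mat G \<and> positive_semidefinite G \<and>
    (\<exists>\<mu>. smallest_eigenvalue G \<mu> \<and> 0 \<le> \<mu> \<and>
      (\<forall>q :: nat \<Rightarrow> complex.
        solves_minimization D V S z0 M N E \<rho> (centered_poly z0 N q) \<longleftrightarrow>
        eigenvector G (Matrix.vec (N + 1) q) \<mu> \<and> L2_set (\<lambda>i. cmod (q i)) {..N} = 1)) \<and>
    taylor_coeff D V S 0 z0 = S z0 \<and>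
    (\<forall>\<beta>\<ge>1.
      helmholtz_solution D V z0 (taylor_coeff D V S (\<beta> - 1) z0) (taylor_coeff D V S \<beta> z0) \<and>
      (\<forall>w. helmholtz_solution D V z0 (taylor_coeff D V S (\<beta> - 1) z0) w \<longrightarrow>
           (AE x in lebesgue_on D. w x = taylor_coeff D V S \<beta> z0 x)))"
proof -
  interpret sobolev_space D V
    using assms(2,3) by unfold_locales (auto simp: bounded_lipschitz_domain_def)
  let ?A = "- laplace_eigenvalues D V"
  note S = assms(6)
  have z0: "z0 \<in> ?A" and c: "0 \<le> Re z0" using assms(9,10) by auto
  have carrier: "G \<in> carrier_mat (N + 1) (N + 1)" unfolding G_def by (rule gram_matrix_carrier)
  have herm: "G $$ (j, i) = cnj (G $$ (i, j))" if "i \<le> N" "j \<le> N" for i j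
    unfolding G_def by (rule gram_matrix_hermitian[OF S z0 c that])
  interpret hermitian_form G N by unfold_locales (rule carrier, rule herm)
  have form: "mat_form G N q q = of_real ((jbar D V S z0 M E \<rho> (centered_poly z0 N q))\<^sup>2)" for q
    unfolding G_def by (rule gram_form_eq_jbar_square[OF S z0 c])
  have jbar_nonneg: "0 \<le> jbar D V S z0 M E \<rho> Q" for Q
    unfolding jbar_def by (intro real_sqrt_ge_zero sum_nonneg mult_nonneg_nonneg) (simp_all add: power_mult)
  obtain m where m: "smallest_eigenvalue G (of_real m)"
    and attained: "\<exists>p. (\<Sum>i\<le>N. (cmod (p i))\<^sup>2) = 1 \<and> Re (mat_form G N p p) = m"
    and min: "\<And>q. (\<Sum>i\<le>N. (cmod (q i))\<^sup>2) = 1 \<Longrightarrow>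
      (\<forall>p. (\<Sum>i\<le>N. (cmod (p i))\<^sup>2) = 1 \<longrightarrow> Re (mat_form G N q q) \<le> Re (mat_form G N p p))
        \<longleftrightarrow> eigenvector G (Matrix.vec (N + 1) q) (of_real m)"
    using rayleigh by blast
  have "0 \<le> m" using attained by (auto simp: form)
  have solves: "solves_minimization D V S z0 M N E \<rho> (centered_poly z0 N q) \<longleftrightarrow>
      eigenvector G (Matrix.vec (N + 1) q) (of_real m) \<and> L2_set (\<lambda>i. cmod (q i)) {..N} = 1" for q
  proof -
    have le: "jbar D V S z0 M E \<rho> (centered_poly z0 N q) \<le> jbar D V S z0 M E \<rho> (centered_poly z0 N p)
        \<longleftrightarrow> Re (mat_form G N q q) \<le> Re (mat_form G N p p)" for p
      using abs_le_square_iff[of "jbar D V S z0 M E \<rho> (centered_poly z0 N q)"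
          "jbar D V S z0 M E \<rho> (centered_poly z0 N p)"] jbar_nonneg
      by (simp add: form del: of_real_power)
    have "(\<forall>P\<in>sphere_polys z0 N. jbar D V S z0 M E \<rho> (centered_poly z0 N q) \<le> jbar D V S z0 M E \<rho> P)
      \<longleftrightarrow> (\<forall>p. (\<Sum>i\<le>N. (cmod (p i))\<^sup>2) = 1 \<longrightarrow> Re (mat_form G N q q) \<le> Re (mat_form G N p p))"
      unfolding le[symmetric] by (auto simp: sphere_polys_def)
    then show ?thesis
      using min[of q] by (auto simp: solves_minimization_def centered_poly_in_sphere_polys_iff L2_set_def)
  qed
  have "hermitian_mat G"
    unfolding hermitian_mat_iff[OF carrier] using herm by blast
  moreover have "positive_semidefinite G"
    unfolding positive_semidefinite_def
  proof
    fix v :: "complex Matrix.vec" assume "v \<in> carrier_vec (dim_row G)"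
    then have "v \<in> carrier_vec (N + 1)" using carrier by simp
    then show "0 \<le> (G *\<^sub>v v) \<bullet>c v"
      by (simp add: mat_form_eq_scalar_prod[OF carrier] form less_eq_complex_def del: of_real_power)
  qed
  moreover have "\<exists>\<mu>. smallest_eigenvalue G \<mu> \<and> 0 \<le> \<mu> \<and>
      (\<forall>q :: nat \<Rightarrow> complex.
        solves_minimization D V S z0 M N E \<rho> (centered_poly z0 N q) \<longleftrightarrow>
        eigenvector G (Matrix.vec (N + 1) q) \<mu> \<and> L2_set (\<lambda>i. cmod (q i)) {..N} = 1)"
    using m \<open>0 \<le> m\<close> solves by (intro exI[of _ "complex_of_real m"]) (simp add: less_eq_complex_def)
  moreover have "taylor_coeff D V S 0 z0 = S z0"
    by (simp add: taylor_coeff_def)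
  moreover have "helmholtz_solution D V z0 (taylor_coeff D V S (\<beta> - 1) z0) (taylor_coeff D V S \<beta> z0)"
    if "\<beta> \<ge> 1" for \<beta>
    using assms(5) by (intro helmholtz_taylor_coeff[OF S _ z0 that]) (auto simp: frequency_response_def)
  ultimately show ?thesis
    using helmholtz_solution_unique[OF assms(9)] by blast
qed

end
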